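(* Let $N\ge1$. The set $\mathcal{F}^N_{Slice}(\mathbb{H})$ is a right quaternionic reproducing kernel Hilbert space whose reproducing kernel is given by $$K_N(q,r)=e_*(q\overline r)*\varphi_N(q,r),\qquad (q,r)\in\mathbb{H}\times\mathbb{H},$$ where $$\varphi_N(q,r)=\sum_{k=0}^{N-1}(-1)^k\binom{N}{k+1}\frac{1}{k!}\left(\overline q q-q\overline r-\overline q r+\overline r r\right)^{k*},$$ and $*$ (and the power $k*$) is taken with respect to the first variable $q$. That is, for each $r\in\mathbb{H}$ the function $q\mapsto K_N(q,r)$ belongs to $\mathcal{F}^N_{Slice}(\mathbb{H})$ and $f(r)=\langle f,K_N(\cdot,r)\rangle_{\mathcal{F}^N_{Slice}(\mathbb{H})}$ for all $f\in\mathcal{F}^N_{Slice}(\mathbb{H})$.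
   Context: $\mathbb{H}$ denotes the quaternions, $\mathbb{S}=\{q\in\mathbb{H}: q^2=-1\}$, and for $I\in\mathbb{S}$, $\mathbb{C}_I=\mathbb{R}+\mathbb{R}I$; $f_I$ is the restriction of $f$ to $\mathbb{C}_I$. Slice polyanalytic functions: a function $f:\mathbb{H}\to\mathbb{H}$ is a (left) slice function if $f(x+Iy)=\alpha(x,y)+I\beta(x,y)$ for all $x,y\in\mathbb{R}$, $I\in\mathbb{S}$, where $\alpha,\beta:\mathbb{R}^2\to\mathbb{H}$ do not depend on $I$ and satisfy $\alpha(x,-y)=\alpha(x,y)$, $\beta(x,-y)=-\beta(x,y)$. If moreover $\alpha,\beta$ are of class $\mathcal{C}^N$ and $\frac{1}{2^N}(\partial_x+I\partial_y)^N(\alpha+I\beta)=0$ for all $I\in\mathbb{S}$, then $f$ is (left) slice polyanalytic of order $N$; the set of these is $\mathcal{SP}_N(\mathbb{H})$. The $*$-product of two slice functions $f=\alpha_1+I\beta_1$, $g=\alpha_2+I\beta_2$ is the slice function $f*g=(\alpha_1\alpha_2-\beta_1\beta_2)+I(\alpha_1\beta_2+\beta_1\alpha_2)$; $f^{k*}$ is the $k$-th $*$-power ($f^{0*}=1$). Also $e_*(q\overline r)=\sum_{n=0}^\infty\frac{q^n\overline r^n}{n!}$. The slice polyanalytic Fock space $\mathcal{F}^N_{Slice}(\mathbb{H})$ is the set of $f\in\mathcal{SP}_N(\mathbb{H})$ with $\int_{\mathbb{C}_I}|f_I(p)|^2e^{-|p|^2}d\lambda_I(p)<\infty$, where $I\in\mathbb{S}$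 and $d\lambda_I(p)=dx\,dy$ for $p=x+Iy$; as a set it does not depend on the choice of $I\in\mathbb{S}$. Its inner product is $$\langle f,g\rangle=\frac1\pi\int_{\mathbb{C}_I}\overline{g_I(p)}f_I(p)e^{-|p|^2}d\lambda_I(p).$$ *)

theory Defs
  imports "HOL-Analysis.Analysis"
begin

codatatype quat = Quat (qRe: real) (qIm1: real) (qIm2: real) (qIm3: real)

lemma quat_eqI [intro?]:
  "qRe x = qRe y \<Longrightarrow> qIm1 x = qIm1 y \<Longrightarrow> qIm2 x = qIm2 y \<Longrightarrow> qIm3 x = qIm3 y \<Longrightarrow> x = y"
  by (rule quat.expand) simp

lemma quat_eq_iff:
  "x = y \<longleftrightarrow> qRe x = qRe y \<and> qIm1 x = qIm1 y \<and> qIm2 x = qIm2 y \<and> qIm3 x = qIm3 y"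
  by (auto intro: quat.expand)

instantiation quat :: ab_group_add
begin

primcorec zero_quat where
  "qRe 0 = 0" | "qIm1 0 = 0" | "qIm2 0 = 0" | "qIm3 0 = 0"

primcorec plus_quat where
  "qRe (x + y) = qRe x + qRe y"
| "qIm1 (x + y) = qIm1 x + qIm1 y"
| "qIm2 (x + y) = qIm2 x + qIm2 y"
| "qIm3 (x + y) = qIm3 x + qIm3 y"

primcorec uminus_quat where
  "qRe (- x) = - qRe x"
| "qIm1 (- x) = - qIm1 x"
| "qIm2 (- x) = - qIm2 x"
| "qIm3 (- x) = - qIm3 x"

primcorec minus_quat where
  "qRe (x - y) = qRe x - qRe y"
| "qIm1 (x - y) = qIm1 x - qIm1 y"
| "qIm2 (x - y) = qIm2 x - qIm2 y"
| "qIm3 (x - y) = qIm3 x - qIm3 y"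

instance
  by standard (simp_all add: quat_eq_iff)

end

instantiation quat :: division_ring
begin

primcorec one_quat where
  "qRe 1 = 1" | "qIm1 1 = 0" | "qIm2 1 = 0" | "qIm3 1 = 0"

primcorec times_quat where
  "qRe (x * y) = qRe x * qRe y - qIm1 x * qIm1 y - qIm2 x * qIm2 y - qIm3 x * qIm3 y"
| "qIm1 (x * y) = qRe x * qIm1 y + qIm1 x * qRe y + qIm2 x * qIm3 y - qIm3 x * qIm2 y"
| "qIm2 (x * y) = qRe x * qIm2 y - qIm1 x * qIm3 y + qIm2 x * qRe y + qIm3 x * qIm1 y"
| "qIm3 (x * y) = qRe x * qIm3 y + qIm1 x * qIm2 y - qIm2 x * qIm1 y + qIm3 x * qRe y"

primcorec inverse_quat where
  "qRe (inverse x) = qRe x / ((qRe x)\<^sup>2 + (qIm1 x)\<^sup>2 + (qIm2 x)\<^sup>2 + (qIm3 x)\<^sup>2)"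
| "qIm1 (inverse x) = - qIm1 x / ((qRe x)\<^sup>2 + (qIm1 x)\<^sup>2 + (qIm2 x)\<^sup>2 + (qIm3 x)\<^sup>2)"
| "qIm2 (inverse x) = - qIm2 x / ((qRe x)\<^sup>2 + (qIm1 x)\<^sup>2 + (qIm2 x)\<^sup>2 + (qIm3 x)\<^sup>2)"
| "qIm3 (inverse x) = - qIm3 x / ((qRe x)\<^sup>2 + (qIm1 x)\<^sup>2 + (qIm2 x)\<^sup>2 + (qIm3 x)\<^sup>2)"

definition "x div y = x * inverse y" for x y :: quat

lemma quat_sumsq_pos:
  "x \<noteq> 0 \<Longrightarrow> (qRe x)\<^sup>2 + (qIm1 x)\<^sup>2 + (qIm2 x)\<^sup>2 + (qIm3 x)\<^sup>2 > 0"
  by (auto simp: quat_eq_iff less_le add_nonneg_eq_0_iff)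

instance
proof
  fix x :: quat
  assume x: "x \<noteq> 0"
  define s where "s = (qRe x)\<^sup>2 + (qIm1 x)\<^sup>2 + (qIm2 x)\<^sup>2 + (qIm3 x)\<^sup>2"
  have s: "s \<noteq> 0"
    using quat_sumsq_pos[OF x] by (simp add: s_def)
  have sq: "qRe x * qRe x + qIm1 x * qIm1 x + qIm2 x * qIm2 x + qIm3 x * qIm3 x = s"
    by (simp add: s_def power2_eq_square)
  have one: "qRe x * qRe x / s + qIm1 x * qIm1 x / s + qIm2 x * qIm2 x / s + qIm3 x * qIm3 x / s = 1"
    using s unfolding add_divide_distrib[symmetric] sq by simp
  show "inverse x * x = 1"
    using one unfolding quat_eq_iff times_quat.simps inverse_quat.simps one_quat.simps s_def[symmetric]
    by (auto simp: mult.commute)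
  show "x * inverse x = 1"
    using one unfolding quat_eq_iff times_quat.simps inverse_quat.simps one_quat.simps s_def[symmetric]
    by (auto simp: mult.commute)
next
  fix x y z :: quat
  show "(x * y) * z = x * (y * z)"
    unfolding quat_eq_iff times_quat.simps by (simp add: algebra_simps)
  show "1 * x = x" "x * 1 = x"
    by (simp_all add: quat_eq_iff)
  show "(x + y) * z = x * z + y * z" "x * (y + z) = x * y + x * z"
    unfolding quat_eq_iff times_quat.simps plus_quat.simps by (simp_all add: algebra_simps)
  show "x div y = x * inverse y"
    by (rule divide_quat_def)
qed (simp_all add: quat_eq_iff)

end

instantiation quat :: real_div_algebra
begin

primcorec scaleR_quat where
  "qRe (scaleR r x) = r * qRe x"
| "qIm1 (scaleR r x) = r * qIm1 x"
| "qIm2 (scaleR r x) = r * qIm2 x"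
| "qIm3 (scaleR r x) = r * qIm3 x"

instance
  by standard (simp_all add: quat_eq_iff algebra_simps)

end

instantiation quat :: real_inner
begin

definition "inner x y = qRe x * qRe y + qIm1 x * qIm1 y + qIm2 x * qIm2 y + qIm3 x * qIm3 y"
  for x y :: quat

definition "norm x = sqrt ((qRe x)\<^sup>2 + (qIm1 x)\<^sup>2 + (qIm2 x)\<^sup>2 + (qIm3 x)\<^sup>2)"
  for x :: quat

definition "sgn x = x /\<^sub>R norm x" for x :: quat

definition "dist x y = norm (x - y)" for x y :: quat

definition
  "(uniformity :: (quat \<times> quat) filter) = (INF e\<in>{0 <..}. principal {(x, y). dist x y < e})"

definition
  "open (U :: quat set) \<longleftrightarrow> (\<forall>x\<in>U. eventually (\<lambda>(x', y). x' = x \<longrightarrow> y \<in> U) uniformity)"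

instance
proof
  fix x :: quat
  show "0 \<le> inner x x"
    by (simp add: inner_quat_def)
  show "inner x x = 0 \<longleftrightarrow> x = 0"
    using quat_sumsq_pos[of x] by (cases "x = 0") (auto simp: inner_quat_def power2_eq_square)
  show "norm x = sqrt (inner x x)"
    by (simp add: inner_quat_def norm_quat_def power2_eq_square)
qed (simp_all add: inner_quat_def sgn_quat_def dist_quat_def uniformity_quat_def open_quat_def
      algebra_simps)

end

primcorec qcnj :: "quat \<Rightarrow> quat" where
  "qRe (qcnj x) = qRe x"
| "qIm1 (qcnj x) = - qIm1 x"
| "qIm2 (qcnj x) = - qIm2 x"
| "qIm3 (qcnj x) = - qIm3 x"

lemma quat_of_real_simps [simp]: "qRe (of_real x) = x" "qIm1 (of_real x) = 0"
  "qIm2 (of_real x) = 0" "qIm3 (of_real x) = 0"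
  by (simp_all add: of_real_def)

lemma qcnj_mult: "qcnj (x * y) = qcnj y * qcnj x"
  by (simp add: quat_eq_iff algebra_simps)

lemma mult_qcnj: "x * qcnj x = of_real ((norm x)\<^sup>2)"
  by (simp add: quat_eq_iff norm_quat_def power2_eq_square)

instance quat :: real_normed_div_algebra
proof
  fix x y :: quat
  have "of_real ((norm (x * y))\<^sup>2) = x * (y * qcnj y) * qcnj x"
    by (simp only: mult_qcnj[symmetric] qcnj_mult mult.assoc)
  also have "\<dots> = of_real ((norm y)\<^sup>2) * (x * qcnj x)"
    unfolding mult_qcnj[of y] of_real_def by simp
  also have "\<dots> = of_real ((norm x * norm y)\<^sup>2)"
    by (simp add: mult_qcnj power_mult_distrib mult.commute flip: of_real_mult of_real_power)
  finally have "(norm (x * y))\<^sup>2 = (norm x * norm y)\<^sup>2"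
    by (simp only: of_real_eq_iff)
  then show "norm (x * y) = norm x * norm y"
    by (rule power2_eq_imp_eq) (simp_all add: norm_quat_def)
qed

instantiation quat :: euclidean_space
begin

definition "Basis = {Quat 1 0 0 0, Quat 0 1 0 0, Quat 0 0 1 0, Quat 0 0 0 1}"

instance
proof
  fix x u v :: quat
  show "inner u v = (if u = v then 1 else 0)" if "u \<in> Basis" "v \<in> Basis"
    using that unfolding Basis_quat_def by (elim insertE emptyE) (simp_all add: inner_quat_def)
  show "(\<forall>u\<in>Basis. inner x u = 0) \<longleftrightarrow> x = 0"
    unfolding Basis_quat_def ball_simps by (simp add: inner_quat_def) (simp add: quat_eq_iff)
qed (simp_all add: Basis_quat_def)

end

definition im_units :: "quat set" where
  "im_units = {q. q\<^sup>2 = -1}"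

text \<open>The identification of the plane with the slice spanned by 1 and \<open>I\<close>.\<close>

definition slice_pt :: "quat \<Rightarrow> real \<times> real \<Rightarrow> quat" where
  "slice_pt I z = of_real (fst z) + I * of_real (snd z)"

definition slice_stem ::
  "(real \<times> real \<Rightarrow> quat) \<Rightarrow> (real \<times> real \<Rightarrow> quat) \<Rightarrow> (quat \<Rightarrow> quat) \<Rightarrow> bool" where
  "slice_stem \<alpha> \<beta> f \<longleftrightarrow>
     (\<forall>x y. \<alpha> (x, - y) = \<alpha> (x, y) \<and> \<beta> (x, - y) = - \<beta> (x, y)) \<and>
     (\<forall>I\<in>im_units. \<forall>x y. f (slice_pt I (x, y)) = \<alpha> (x, y) + I * \<beta> (x, y))"

text \<open>
  For slice functions \<open>f\<close>, \<open>g\<close> the description picks a unique function: a stem is determined by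
  its function (\<open>slice_stem_unique\<close>) and conversely (\<open>slice_stem_ex1\<close>), so \<open>slice_star f g\<close> is the
  slice function of the product stem (\<open>slice_stem_slice_star\<close>). Otherwise the value is unspecified.
\<close>

definition slice_star :: "(quat \<Rightarrow> quat) \<Rightarrow> (quat \<Rightarrow> quat) \<Rightarrow> quat \<Rightarrow> quat" where
  "slice_star f g = (THE h. \<exists>\<alpha>1 \<beta>1 \<alpha>2 \<beta>2. slice_stem \<alpha>1 \<beta>1 f \<and> slice_stem \<alpha>2 \<beta>2 g \<and>
     slice_stem (\<lambda>z. \<alpha>1 z * \<alpha>2 z - \<beta>1 z * \<beta>2 z) (\<lambda>z. \<alpha>1 z * \<beta>2 z + \<beta>1 z * \<alpha>2 z) h)"

primrec slice_star_power :: "(quat \<Rightarrow> quat) \<Rightarrow> nat \<Rightarrow> quat \<Rightarrow> quat" where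
  "slice_star_power f 0 = (\<lambda>_. 1)"
| "slice_star_power f (Suc k) = slice_star f (slice_star_power f k)"

lemma im_units_nonempty: "Quat 0 1 0 0 \<in> im_units"
  by (simp add: im_units_def quat_eq_iff power2_eq_square)

lemma im_units_iff: "I \<in> im_units \<longleftrightarrow> qRe I = 0 \<and> (qIm1 I)\<^sup>2 + (qIm2 I)\<^sup>2 + (qIm3 I)\<^sup>2 = 1"
proof
  assume I: "I \<in> im_units"
  then have *: "qRe I * qRe I - qIm1 I * qIm1 I - qIm2 I * qIm2 I - qIm3 I * qIm3 I = -1"
    "qRe I * qIm1 I = 0" "qRe I * qIm2 I = 0" "qRe I * qIm3 I = 0"
    by (auto simp: im_units_def quat_eq_iff power2_eq_square)
  have "qRe I = 0"
  proof (rule ccontr)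
    assume "qRe I \<noteq> 0"
    with * have "qRe I * qRe I = -1" by simp
    then show False using zero_le_square[of "qRe I"] by linarith
  qed
  with * show "qRe I = 0 \<and> (qIm1 I)\<^sup>2 + (qIm2 I)\<^sup>2 + (qIm3 I)\<^sup>2 = 1"
    by (simp add: power2_eq_square)
qed (simp add: im_units_def quat_eq_iff power2_eq_square)

lemma im_units_uminus: "I \<in> im_units \<Longrightarrow> - I \<in> im_units"
  by (simp add: im_units_def)

lemma im_units_mult_self: "I \<in> im_units \<Longrightarrow> I * (I * x) = - x"
  by (simp add: im_units_def power2_eq_square flip: mult.assoc)

lemma slice_pt_uminus: "slice_pt (- I) (x, - y) = slice_pt I (x, y)"
  by (simp add: slice_pt_def)

lemma slice_pt_surj: "\<exists>I\<in>im_units. \<exists>x y. q = slice_pt I (x, y)"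
proof -
  define n where "n = sqrt ((qIm1 q)\<^sup>2 + (qIm2 q)\<^sup>2 + (qIm3 q)\<^sup>2)"
  have n2: "n\<^sup>2 = (qIm1 q)\<^sup>2 + (qIm2 q)\<^sup>2 + (qIm3 q)\<^sup>2"
    by (simp add: n_def)
  show ?thesis
  proof (cases "n = 0")
    case True
    with n2 have "qIm1 q = 0" "qIm2 q = 0" "qIm3 q = 0"
      by (simp_all add: add_nonneg_eq_0_iff)
    then have "q = slice_pt (Quat 0 1 0 0) (qRe q, 0)"
      by (simp add: slice_pt_def quat_eq_iff)
    then show ?thesis using im_units_nonempty by blast
  next
    case False
    define I where "I = Quat 0 (qIm1 q / n) (qIm2 q / n) (qIm3 q / n)"
    have "I \<in> im_units"
      using False by (simp add: I_def im_units_iff power_divide flip: add_divide_distrib n2)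
    moreover have "q = slice_pt I (qRe q, n)"
      using False by (simp add: I_def slice_pt_def quat_eq_iff)
    ultimately show ?thesis by blast
  qed
qed

lemma slice_pt_eq_cases:
  assumes I: "I \<in> im_units" and J: "J \<in> im_units" and eq: "slice_pt I (x, y) = slice_pt J (u, v)"
  shows "u = x" "(I = J \<and> v = y) \<or> (J = - I \<and> v = - y) \<or> (y = 0 \<and> v = 0)"
proof -
  have r: "qRe I = 0" "qRe J = 0"
    and nI: "(qIm1 I)\<^sup>2 + (qIm2 I)\<^sup>2 + (qIm3 I)\<^sup>2 = 1" and nJ: "(qIm1 J)\<^sup>2 + (qIm2 J)\<^sup>2 + (qIm3 J)\<^sup>2 = 1"
    using I J by (simp_all add: im_units_iff)
  have e: "x = u" "qIm1 I * y = qIm1 J * v" "qIm2 I * y = qIm2 J * v" "qIm3 I * y = qIm3 J * v"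
    using eq r by (simp_all add: slice_pt_def quat_eq_iff)
  show "u = x" using e by simp
  have "y\<^sup>2 = (qIm1 I * y)\<^sup>2 + (qIm2 I * y)\<^sup>2 + (qIm3 I * y)\<^sup>2"
    using nI by (simp add: power_mult_distrib flip: distrib_right)
  also have "\<dots> = v\<^sup>2"
    unfolding e using nJ by (simp add: power_mult_distrib flip: distrib_right)
  finally have "v = y \<or> v = - y"
    by (metis power2_eq_iff)
  then show "(I = J \<and> v = y) \<or> (J = - I \<and> v = - y) \<or> (y = 0 \<and> v = 0)"
  proof
    assume "v = y"
    then show ?thesis using e r by (cases "y = 0") (simp_all add: quat_eq_iff)
  next
    assume v: "v = - y"
    show ?thesis
    proof (cases "y = 0")
      case False
      have "c = - d" if "c * y = d * v" for c d :: real
        using that v False by (metis mult_cancel_right mult_minus_left mult_minus_right)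
      from this[OF e(2)] this[OF e(3)] this[OF e(4)] show ?thesis
        using r v by (simp add: quat_eq_iff)
    qed (use v in simp)
  qed
qed

lemma slice_stem_unique:
  assumes "slice_stem \<alpha> \<beta> f" "slice_stem \<alpha>' \<beta>' f"
  shows "\<alpha> = \<alpha>'" "\<beta> = \<beta>'"
proof -
  define I where "I = Quat 0 1 0 0"
  have I: "I \<in> im_units" "- I \<in> im_units"
    using im_units_nonempty im_units_uminus by (auto simp: I_def)
  have *: "\<alpha> z + I * \<beta> z = \<alpha>' z + I * \<beta>' z" "\<alpha> z - I * \<beta> z = \<alpha>' z - I * \<beta>' z" for z
  proof -
    obtain x y where z: "z = (x, y)" by fastforce
    have "\<alpha> z + J * \<beta> z = \<alpha>' z + J * \<beta>' z" if "J \<in> im_units" for J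
      using assms that unfolding slice_stem_def z by metis
    from this[OF I(1)] this[OF I(2)]
    show "\<alpha> z + I * \<beta> z = \<alpha>' z + I * \<beta>' z" "\<alpha> z - I * \<beta> z = \<alpha>' z - I * \<beta>' z"
      by simp_all
  qed
  have a: "\<alpha> z = \<alpha>' z" for z
  proof -
    have "2 *\<^sub>R \<alpha> z = (\<alpha> z + I * \<beta> z) + (\<alpha> z - I * \<beta> z)" by (simp add: scaleR_2)
    also have "\<dots> = 2 *\<^sub>R \<alpha>' z" unfolding * by (simp add: scaleR_2)
    finally show ?thesis by simp
  qed
  then show "\<alpha> = \<alpha>'" by blast
  have "I * \<beta> z = I * \<beta>' z" for z using *(1)[of z] a[of z] by simp
  moreover have "I \<noteq> 0" by (simp add: I_def quat_eq_iff)
  ultimately show "\<beta> = \<beta>'" by (simp add: fun_eq_iff)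
qed

lemma slice_stem_ex1:
  assumes "\<And>x y. \<alpha> (x, - y) = \<alpha> (x, y)" "\<And>x y. \<beta> (x, - y) = - \<beta> (x, y)"
  shows "\<exists>!f. slice_stem \<alpha> \<beta> f"
proof -
  have \<beta>0: "\<beta> (x, 0) = 0" for x
  proof -
    have "\<beta> (x, 0) = - \<beta> (x, 0)" using assms(2)[of x 0] by simp
    then show ?thesis by (simp add: quat_eq_iff)
  qed
  have wd: "\<alpha> (u, v) + J * \<beta> (u, v) = \<alpha> (x, y) + I * \<beta> (x, y)"
    if "I \<in> im_units" "J \<in> im_units" "slice_pt I (x, y) = slice_pt J (u, v)" for I J x y u v
    using slice_pt_eq_cases[OF that] assms \<beta>0 by auto
  define f where "f q = (SOME w. \<exists>I\<in>im_units. \<exists>x y. q = slice_pt I (x, y) \<and> w = \<alpha> (x, y) + I * \<beta> (x, y))" for q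
  have f: "f (slice_pt I (x, y)) = \<alpha> (x, y) + I * \<beta> (x, y)" if I: "I \<in> im_units" for I x y
  proof -
    have "\<exists>w. \<exists>J\<in>im_units. \<exists>u v. slice_pt I (x, y) = slice_pt J (u, v) \<and> w = \<alpha> (u, v) + J * \<beta> (u, v)"
      using I by blast
    from someI_ex[OF this] show ?thesis
      unfolding f_def[symmetric] using wd[OF I] by auto
  qed
  show ?thesis
  proof (rule ex1I[of _ f])
    show "slice_stem \<alpha> \<beta> f" using f assms by (auto simp: slice_stem_def)
    fix g assume g: "slice_stem \<alpha> \<beta> g"
    show "g = f"
    proof
      fix q
      obtain I x y where "I \<in> im_units" "q = slice_pt I (x, y)" using slice_pt_surj by blast
      then show "g q = f q" using g f by (auto simp: slice_stem_def)
    qed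
  qed
qed

lemma slice_stem_slice_star:
  assumes f: "slice_stem \<alpha>1 \<beta>1 f" and g: "slice_stem \<alpha>2 \<beta>2 g"
  shows "slice_stem (\<lambda>z. \<alpha>1 z * \<alpha>2 z - \<beta>1 z * \<beta>2 z) (\<lambda>z. \<alpha>1 z * \<beta>2 z + \<beta>1 z * \<alpha>2 z) (slice_star f g)"
proof -
  let ?A = "\<lambda>z. \<alpha>1 z * \<alpha>2 z - \<beta>1 z * \<beta>2 z" and ?B = "\<lambda>z. \<alpha>1 z * \<beta>2 z + \<beta>1 z * \<alpha>2 z"
  have ex1: "\<exists>!h. slice_stem ?A ?B h"
    by (rule slice_stem_ex1) (use f g in \<open>auto simp: slice_stem_def\<close>)
  have eq: "(\<exists>\<alpha>1 \<beta>1 \<alpha>2 \<beta>2. slice_stem \<alpha>1 \<beta>1 f \<and> slice_stem \<alpha>2 \<beta>2 g \<and>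
     slice_stem (\<lambda>z. \<alpha>1 z * \<alpha>2 z - \<beta>1 z * \<beta>2 z) (\<lambda>z. \<alpha>1 z * \<beta>2 z + \<beta>1 z * \<alpha>2 z) h)
     \<longleftrightarrow> slice_stem ?A ?B h" for h
  proof
    assume "\<exists>\<alpha>1 \<beta>1 \<alpha>2 \<beta>2. slice_stem \<alpha>1 \<beta>1 f \<and> slice_stem \<alpha>2 \<beta>2 g \<and>
     slice_stem (\<lambda>z. \<alpha>1 z * \<alpha>2 z - \<beta>1 z * \<beta>2 z) (\<lambda>z. \<alpha>1 z * \<beta>2 z + \<beta>1 z * \<alpha>2 z) h"
    then obtain a1 b1 a2 b2 where *: "slice_stem a1 b1 f" "slice_stem a2 b2 g"
      "slice_stem (\<lambda>z. a1 z * a2 z - b1 z * b2 z) (\<lambda>z. a1 z * b2 z + b1 z * a2 z) h"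
      by blast
    then show "slice_stem ?A ?B h"
      using slice_stem_unique[OF f *(1)] slice_stem_unique[OF g *(2)] by simp
  next
    assume "slice_stem ?A ?B h"
    with f g show "\<exists>\<alpha>1 \<beta>1 \<alpha>2 \<beta>2. slice_stem \<alpha>1 \<beta>1 f \<and> slice_stem \<alpha>2 \<beta>2 g \<and>
     slice_stem (\<lambda>z. \<alpha>1 z * \<alpha>2 z - \<beta>1 z * \<beta>2 z) (\<lambda>z. \<alpha>1 z * \<beta>2 z + \<beta>1 z * \<alpha>2 z) h"
      by blast
  qed
  show ?thesis
    unfolding slice_star_def eq using theI'[OF ex1] .
qed

definition partial_x :: "(real \<times> real \<Rightarrow> quat) \<Rightarrow> real \<times> real \<Rightarrow> quat" where
  "partial_x h z = vector_derivative (\<lambda>t. h (t, snd z)) (at (fst z))"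

definition partial_y :: "(real \<times> real \<Rightarrow> quat) \<Rightarrow> real \<times> real \<Rightarrow> quat" where
  "partial_y h z = vector_derivative (\<lambda>t. h (fst z, t)) (at (snd z))"

text \<open>All partial derivatives up to order \<open>k\<close> exist everywhere and are continuous.\<close>

primrec C_class :: "nat \<Rightarrow> (real \<times> real \<Rightarrow> quat) \<Rightarrow> bool" where
  "C_class 0 h \<longleftrightarrow> continuous_on UNIV h"
| "C_class (Suc k) h \<longleftrightarrow> continuous_on UNIV h \<and>
     (\<forall>x y. (\<lambda>t. h (t, y)) differentiable (at x) \<and> (\<lambda>t. h (x, t)) differentiable (at y)) \<and>
     C_class k (partial_x h) \<and> C_class k (partial_y h)"

definition slice_dbar :: "quat \<Rightarrow> (real \<times> real \<Rightarrow> quat) \<Rightarrow> real \<times> real \<Rightarrow> quat" where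
  "slice_dbar I h z = partial_x h z + I * partial_y h z"

definition slice_polyanalytic :: "nat \<Rightarrow> (quat \<Rightarrow> quat) \<Rightarrow> bool" where
  "slice_polyanalytic N f \<longleftrightarrow> (\<exists>\<alpha> \<beta>. slice_stem \<alpha> \<beta> f \<and> C_class N \<alpha> \<and> C_class N \<beta> \<and>
     (\<forall>I\<in>im_units. \<forall>z. (1 / 2 ^ N) *\<^sub>R (slice_dbar I ^^ N) (\<lambda>w. \<alpha> w + I * \<beta> w) z = 0))"

text \<open>
  Spaces of quaternion-valued functions with pointwise addition and right scalar multiplication;
  the inner product is right linear in its first argument.
\<close>

locale right_quat_inner_space =
  fixes V :: "('a \<Rightarrow> quat) set"
    and ip :: "('a \<Rightarrow> quat) \<Rightarrow> ('a \<Rightarrow> quat) \<Rightarrow> quat"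
  assumes zero_closed: "(\<lambda>_. 0) \<in> V"
    and add_closed: "\<lbrakk>f \<in> V; g \<in> V\<rbrakk> \<Longrightarrow> (\<lambda>q. f q + g q) \<in> V"
    and scale_closed: "f \<in> V \<Longrightarrow> (\<lambda>q. f q * a) \<in> V"
    and ip_add: "\<lbrakk>f \<in> V; g \<in> V; h \<in> V\<rbrakk> \<Longrightarrow> ip (\<lambda>q. f q + g q) h = ip f h + ip g h"
    and ip_scale: "\<lbrakk>f \<in> V; g \<in> V\<rbrakk> \<Longrightarrow> ip (\<lambda>q. f q * a) g = ip f g * a"
    and ip_cnj: "\<lbrakk>f \<in> V; g \<in> V\<rbrakk> \<Longrightarrow> ip g f = qcnj (ip f g)"
    and ip_nonneg: "f \<in> V \<Longrightarrow> ip f f \<in> \<real> \<and> 0 \<le> qRe (ip f f)"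
    and ip_definite: "\<lbrakk>f \<in> V; ip f f = 0\<rbrakk> \<Longrightarrow> f = (\<lambda>_. 0)"

definition ip_norm :: "(('a \<Rightarrow> quat) \<Rightarrow> ('a \<Rightarrow> quat) \<Rightarrow> quat) \<Rightarrow> ('a \<Rightarrow> quat) \<Rightarrow> real" where
  "ip_norm ip f = sqrt (qRe (ip f f))"

locale right_quat_hilbert_space = right_quat_inner_space +
  assumes complete:
    "\<lbrakk>\<And>n. F n \<in> V; \<And>e. e > 0 \<Longrightarrow> \<exists>M. \<forall>m\<ge>M. \<forall>n\<ge>M. ip_norm ip (\<lambda>q. F m q - F n q) < e\<rbrakk>
      \<Longrightarrow> \<exists>f\<in>V. (\<lambda>n. ip_norm ip (\<lambda>q. F n q - f q)) \<longlonglongrightarrow> 0"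

locale right_quat_rkhs = right_quat_hilbert_space +
  assumes evaluation_bounded: "\<exists>C. \<forall>f\<in>V. norm (f r) \<le> C * ip_norm ip f"

definition reproducing_kernel ::
  "('a \<Rightarrow> quat) set \<Rightarrow> (('a \<Rightarrow> quat) \<Rightarrow> ('a \<Rightarrow> quat) \<Rightarrow> quat) \<Rightarrow> ('a \<Rightarrow> 'a \<Rightarrow> quat) \<Rightarrow> bool" where
  "reproducing_kernel V ip K \<longleftrightarrow>
     (\<forall>r. (\<lambda>q. K q r) \<in> V \<and> (\<forall>f\<in>V. f r = ip f (\<lambda>q. K q r)))"

text \<open>
  The unit \<open>I\<close> whose slice is integrated over is an explicit parameter; the area measure on the slice is
  \<open>lborel\<close> on the plane, transported by \<open>slice_pt I\<close>.
\<close>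

definition slice_fock :: "nat \<Rightarrow> quat \<Rightarrow> (quat \<Rightarrow> quat) set" where
  "slice_fock N I = {f. slice_polyanalytic N f \<and>
     integrable lborel (\<lambda>z. (norm (f (slice_pt I z)))\<^sup>2 * exp (- (norm (slice_pt I z))\<^sup>2))}"

definition slice_fock_inner :: "quat \<Rightarrow> (quat \<Rightarrow> quat) \<Rightarrow> (quat \<Rightarrow> quat) \<Rightarrow> quat" where
  "slice_fock_inner I f g = (1 / pi) *\<^sub>R
     (LINT z|lborel. exp (- (norm (slice_pt I z))\<^sup>2) *\<^sub>R (qcnj (g (slice_pt I z)) * f (slice_pt I z)))"

definition exp_star :: "quat \<Rightarrow> quat \<Rightarrow> quat" where
  "exp_star q r = (\<Sum>n. (q ^ n * qcnj r ^ n) /\<^sub>R fact n)"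

definition fock_phi :: "nat \<Rightarrow> quat \<Rightarrow> quat \<Rightarrow> quat" where
  "fock_phi N q r = (\<Sum>k<N. ((-1) ^ k * real (N choose (k + 1)) * (1 / fact k)) *\<^sub>R
     slice_star_power (\<lambda>p. qcnj p * p - p * qcnj r - qcnj p * r + qcnj r * r) k q)"

text \<open>Star powers and the star product are taken with respect to the first variable.\<close>

definition fock_kernel :: "nat \<Rightarrow> quat \<Rightarrow> quat \<Rightarrow> quat" where
  "fock_kernel N q r = slice_star (\<lambda>p. exp_star p r) (\<lambda>p. fock_phi N p r) q"

end

theory Submission
  imports Defs "HOL-Complex_Analysis.Complex_Analysis" "HOL-Probability.Distributions"
begin

text \<open>
  Everything is decided on the single slice over which the inner product integrates. Identify it with the
  complex plane by \<open>slice_emb I\<close> and read a quaternion through the functionals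
  \<open>slice_coord I b\<close>, which turn left multiplication by \<open>I\<close> into multiplication by \<open>\<i>\<close>. A slice function
  is determined by its restriction to the slice (\<open>slice_representation\<close>), and it is slice polyanalytic of order
  \<open>N\<close> iff all coordinates of the restriction are sums of \<open>cnj z ^ j * h j z\<close> with \<open>j < N\<close> and
  \<open>h j\<close> entire (\<open>slice_polyanalytic_iff\<close>). One direction solves the equation for the iterated operator
  \<open>\<partial>\<^sub>x + I \<partial>\<^sub>y\<close> one step at a time (\<open>polyentire_of_dbar\<close>); for the other, the factors \<open>1 - J * I\<close> and
  \<open>1 + J * I\<close> of the representation formula carry polyanalyticity to every other slice (\<open>unit_intertwine\<close>).

  This leaves the classical polyanalytic Fock space. There \<open>F (w + u) * exp (- cnj w * u)\<close> moves the
  evaluation point \<open>w\<close> to the origin, so that the reproducing formula says that the integral of \<open>F\<close> against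
  \<open>L (|u|\<^sup>2) * exp (- |u|\<^sup>2)\<close>, with \<open>L\<close> the Laguerre polynomial of degree \<open>N - 1\<close> and parameter 1, is
  \<open>pi * F 0\<close>. The weight is radial, hence \<open>F\<close> may be replaced by its means over circles about 0
  (\<open>integral_circle_mean\<close>); by Cauchy's formula these are a polynomial of degree below \<open>N\<close> in \<open>|u|\<^sup>2\<close> with
  constant term \<open>F 0\<close> (\<open>polyentire_circle_mean\<close>), and the Gaussian moments \<open>pi * m!\<close> together with the
  vanishing of high finite differences of polynomials leave only the constant term
  (\<open>laguerre_orthogonality\<close>). The result is \<open>polyanalytic_reproducing\<close>.

  On a slice that contains \<open>r\<close> the factors of the quaternionic kernel have values in that slice, star products
  are pointwise products, and the kernel is the complex one (\<open>fock_kernel_on_slice\<close>). For \<open>r\<close> outside the slice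
  of integration the kernel is a right linear combination of two kernels with parameters in it
  (\<open>fock_kernel_representation\<close>); in the inner product its coefficients turn into those of the representation
  formula for \<open>f r\<close>, so the reproducing property extends to all \<open>r\<close>. Bounded evaluation follows from the
  Cauchy-Schwarz inequality. It makes a Cauchy sequence converge pointwise; the limit is a norm limit by
  Fatou's lemma, satisfies the reproducing formula, and is polyanalytic because every function given by that
  integral is (\<open>polyentire_gauss_integral\<close>).
\<close>

section \<open>Rotations and radial integrals in the plane\<close>

text \<open>
  Fubini's theorem reduces this to translation invariance on each horizontal line. Shears are needed because
  rotations are products of them.
\<close>

lemma lborel_shear_fst: "distr lborel borel (\<lambda>z::real \<times> real. (fst z + a * snd z, snd z)) = lborel"
proof (rule measure_eqI)
  fix A assume "A \<in> sets (distr lborel borel (\<lambda>z::real \<times> real. (fst z + a * snd z, snd z)))"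
  then have A[measurable]: "A \<in> sets borel" by simp
  have ind[measurable]: "(indicator A :: real \<times> real \<Rightarrow> ennreal) \<in> borel_measurable (borel \<Otimes>\<^sub>M borel)"
    unfolding borel_prod by measurable
  have m: "(\<lambda>z::real \<times> real. (fst z + a * snd z, snd z)) \<in> borel_measurable borel"
    unfolding borel_prod[symmetric] by measurable
  have "emeasure (distr lborel borel (\<lambda>z::real \<times> real. (fst z + a * snd z, snd z))) A
      = (\<integral>\<^sup>+z. indicator A (fst z + a * snd z, snd z) \<partial>(lborel :: (real \<times> real) measure))"
    by (subst nn_integral_indicator[symmetric], simp, subst nn_integral_distr) (use m in auto)
  also have "\<dots> = (\<integral>\<^sup>+y. \<integral>\<^sup>+x. indicator A (x + a * y, y) \<partial>lborel \<partial>lborel)"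
    unfolding lborel_prod[symmetric]
    by (subst lborel_pair.nn_integral_snd[symmetric]) (auto simp: case_prod_beta')
  also have "\<dots> = (\<integral>\<^sup>+y. \<integral>\<^sup>+x. indicator A (x, y) \<partial>lborel \<partial>lborel)"
  proof (rule nn_integral_cong)
    fix y :: real
    show "(\<integral>\<^sup>+x. indicator A (x + a * y, y) \<partial>lborel) = (\<integral>\<^sup>+x. indicator A (x, y) \<partial>lborel)"
      using nn_integral_real_affine[of "\<lambda>x. indicator A (x, y)" 1 "a * y"] by (simp add: add.commute)
  qed
  also have "\<dots> = (\<integral>\<^sup>+z. indicator A z \<partial>(lborel :: (real \<times> real) measure))"
    unfolding lborel_prod[symmetric]
    by (subst lborel_pair.nn_integral_snd[symmetric]) (auto simp: case_prod_beta')
  finally show "emeasure (distr lborel borel (\<lambda>z::real \<times> real. (fst z + a * snd z, snd z))) A = emeasure lborel A"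
    by simp
qed simp

lemma lborel_shear_snd: "distr lborel borel (\<lambda>z::real \<times> real. (fst z, snd z + a * fst z)) = lborel"
proof (rule measure_eqI)
  fix A assume "A \<in> sets (distr lborel borel (\<lambda>z::real \<times> real. (fst z, snd z + a * fst z)))"
  then have A[measurable]: "A \<in> sets borel" by simp
  have ind[measurable]: "(indicator A :: real \<times> real \<Rightarrow> ennreal) \<in> borel_measurable (borel \<Otimes>\<^sub>M borel)"
    unfolding borel_prod by measurable
  have m: "(\<lambda>z::real \<times> real. (fst z, snd z + a * fst z)) \<in> borel_measurable borel"
    unfolding borel_prod[symmetric] by measurable
  have "emeasure (distr lborel borel (\<lambda>z::real \<times> real. (fst z, snd z + a * fst z))) A
      = (\<integral>\<^sup>+z. indicator A (fst z, snd z + a * fst z) \<partial>(lborel :: (real \<times> real) measure))"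
    by (subst nn_integral_indicator[symmetric], simp, subst nn_integral_distr) (use m in auto)
  also have "\<dots> = (\<integral>\<^sup>+x. \<integral>\<^sup>+y. indicator A (x, y + a * x) \<partial>lborel \<partial>lborel)"
    unfolding lborel_prod[symmetric]
    by (subst lborel.nn_integral_fst[symmetric]) (auto simp: case_prod_beta')
  also have "\<dots> = (\<integral>\<^sup>+x. \<integral>\<^sup>+y. indicator A (x, y) \<partial>lborel \<partial>lborel)"
  proof (rule nn_integral_cong)
    fix x :: real
    show "(\<integral>\<^sup>+y. indicator A (x, y + a * x) \<partial>lborel) = (\<integral>\<^sup>+y. indicator A (x, y) \<partial>lborel)"
      using nn_integral_real_affine[of "\<lambda>y. indicator A (x, y)" 1 "a * x"] by (simp add: add.commute)
  qed
  also have "\<dots> = (\<integral>\<^sup>+z. indicator A z \<partial>(lborel :: (real \<times> real) measure))"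
    unfolding lborel_prod[symmetric]
    by (subst lborel.nn_integral_fst[symmetric]) (auto simp: case_prod_beta')
  finally show "emeasure (distr lborel borel (\<lambda>z::real \<times> real. (fst z, snd z + a * fst z))) A = emeasure lborel A"
    by simp
qed simp

definition to_complex :: "real \<times> real \<Rightarrow> complex" where
  "to_complex z = Complex (fst z) (snd z)"

definition plane_rot :: "complex \<Rightarrow> real \<times> real \<Rightarrow> real \<times> real" where
  "plane_rot c z = (Re (c * to_complex z), Im (c * to_complex z))"

lemma to_complex_simps [simp]: "Re (to_complex z) = fst z" "Im (to_complex z) = snd z" "norm (to_complex z) = norm z"
  "to_complex (x, y) = Complex x y" "to_complex (z + w) = to_complex z + to_complex w" "to_complex (Re c, Im c) = c"
  by (simp_all add: to_complex_def norm_prod_def cmod_def complex_eq_iff)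

lemma to_complex_plane_rot [simp]: "to_complex (plane_rot c z) = c * to_complex z"
  by (simp add: plane_rot_def complex_eq_iff)

lemma to_complex_altdef: "to_complex z = of_real (fst z) + \<i> * of_real (snd z)"
  by (simp add: complex_eq_iff)

lemma continuous_on_to_complex [continuous_intros]: "continuous_on A f \<Longrightarrow> continuous_on A (\<lambda>x. to_complex (f x))"
  unfolding to_complex_altdef by (intro continuous_intros)

lemma borel_measurable_to_complex [measurable]: "to_complex \<in> borel_measurable borel"
  by (intro borel_measurable_continuous_onI continuous_intros)

lemma borel_measurable_plane_rot [measurable]: "plane_rot c \<in> borel_measurable borel"
  unfolding plane_rot_def[abs_def] by (intro borel_measurable_continuous_onI continuous_intros)

text \<open>
  A rotation by an angle \<open>t\<close> other than the half turn is the product of a vertical shear between two equal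
  horizontal ones with factor \<open>- tan (t / 2)\<close>; the half turn is the square of a quarter turn.
\<close>

lemma lborel_plane_rot:
  assumes "norm c = 1"
  shows "distr lborel borel (plane_rot c) = lborel"
proof -
  have main: "distr lborel borel (plane_rot c) = lborel" if c: "norm c = 1" "c \<noteq> -1" for c
  proof -
    define u v where "u = Re c" and "v = Im c"
    \<comment> \<open>For \<open>c = cis t\<close> this is \<open>- tan (t / 2)\<close>.\<close>
    define a where "a = - v / (1 + u)"
    have uv: "u * u + v * v = 1"
      using c by (simp add: u_def v_def cmod_def power2_eq_square)
    have "u \<noteq> -1"
    proof
      assume "u = -1"
      with uv have "v = 0" by simp
      with \<open>u = -1\<close> c show False by (simp add: u_def v_def complex_eq_iff)
    qed
    then have u: "1 + u \<noteq> 0" by linarith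
    have a: "a * (1 + u) = - v" using u by (simp add: a_def)
    have av: "v * a = u - 1"
    proof -
      have "(1 + u) * (v * a) = v * (a * (1 + u))" by (simp only: mult_ac)
      also have "\<dots> = - v * v" unfolding a by simp
      also have "\<dots> = (1 + u) * (u - 1)" using uv by (simp add: algebra_simps)
      finally show ?thesis using u by simp
    qed
    let ?S = "\<lambda>z::real \<times> real. (fst z + a * snd z, snd z)"
    let ?T = "\<lambda>z::real \<times> real. (fst z, snd z + v * fst z)"
    have mS: "?S \<in> measurable borel borel" and mT: "?T \<in> measurable borel borel"
      unfolding borel_prod[symmetric] by measurable
    have eq: "plane_rot c = (\<lambda>z. ?S (?T (?S z)))"
    proof
      fix z :: "real \<times> real"
      obtain x y where z: "z = (x, y)" by fastforce
      have y: "y + v * (x + a * y) = v * x + u * y"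
        using av by (simp add: algebra_simps) (metis distrib_right mult.commute diff_add_cancel mult.left_commute mult_1)
      have "x + a * y + a * (v * x + u * y) = x * (1 + v * a) + y * (a * (1 + u))"
        by (simp add: algebra_simps)
      then have x: "x + a * y + a * (v * x + u * y) = u * x - v * y"
        by (simp add: a av)
      show "plane_rot c z = ?S (?T (?S z))"
        unfolding z fst_conv snd_conv y x by (simp add: plane_rot_def u_def v_def algebra_simps)
    qed
    have "distr lborel borel (plane_rot c) = distr (distr (distr lborel borel ?S) borel ?T) borel ?S"
      unfolding eq using mS mT by (subst distr_distr, simp_all)+ (simp add: comp_def)
    also have "\<dots> = lborel"
      by (simp only: lborel_shear_fst lborel_shear_snd)
    finally show ?thesis .
  qed
  show ?thesis
  proof (cases "c = -1")
    case True
    have "plane_rot c = plane_rot \<i> \<circ> plane_rot \<i>"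
      using True by (auto simp: fun_eq_iff plane_rot_def)
    then have "distr lborel borel (plane_rot c) = distr (distr lborel borel (plane_rot \<i>)) borel (plane_rot \<i>)"
      by (subst distr_distr) simp_all
    also have "\<dots> = lborel"
      using main[of \<i>] by (simp add: complex_eq_iff)
    finally show ?thesis .
  qed (use main assms in blast)
qed

text \<open>
  Polar coordinates for radial functions: a disc of radius \<open>sqrt t\<close> has area \<open>pi * t\<close>, so the squared norm
  maps the area measure to \<open>pi\<close> times the length on the half line.
\<close>

lemma nn_integral_radial:
  fixes f :: "real \<Rightarrow> ennreal"
  assumes [measurable]: "f \<in> borel_measurable borel"
  shows "(\<integral>\<^sup>+z. f ((norm z)\<^sup>2) \<partial>(lborel :: (real \<times> real) measure))
       = ennreal pi * (\<integral>\<^sup>+t. f t * indicator {0..} t \<partial>lborel)"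
proof -
  \<comment> \<open>The sign makes the rays \<open>{x<..}\<close> pull back to discs, which have finite measure.\<close>
  have eq: "distr lborel borel (\<lambda>z::real \<times> real. - (norm z)\<^sup>2) = density lborel (\<lambda>t. ennreal pi * indicator {..0} t)"
    (is "?M = ?N")
  proof (rule measure_eqI_lessThan)
    fix x :: real
    have M: "emeasure ?M {x<..} = emeasure lborel (ball (0 :: real \<times> real) (sqrt (max 0 (- x))))"
    proof -
      have "(\<lambda>z::real \<times> real. - (norm z)\<^sup>2) -` {x<..} = ball (0 :: real \<times> real) (sqrt (max 0 (- x)))"
      proof (intro set_eqI iffI; clarsimp)
        fix a b :: real assume "x < - (norm (a, b))\<^sup>2"
        then have "(norm (a, b))\<^sup>2 < max 0 (-x)" by auto
        then show "norm (a, b) < sqrt (max 0 (-x))" by (rule real_less_rsqrt)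
      next
        fix a b :: real assume *: "norm (a, b) < sqrt (max 0 (-x))"
        then have "(norm (a, b))\<^sup>2 < (sqrt (max 0 (-x)))\<^sup>2" by (intro power_strict_mono) auto
        also have "\<dots> = max 0 (-x)" by simp
        finally have "(norm (a, b))\<^sup>2 < max 0 (-x)" .
        moreover have "0 \<le> (norm (a, b))\<^sup>2" by (rule zero_le_power2)
        ultimately show "x < - (norm (a, b))\<^sup>2"
          by (auto simp: max_def split: if_splits)
      qed
      then show ?thesis by (simp add: emeasure_distr)
    qed
    also have "\<dots> = ennreal (pi * max 0 (- x))"
      by (subst emeasure_ball) (auto simp: unit_ball_vol_2)
    finally have M': "emeasure ?M {x<..} = ennreal (pi * max 0 (- x))" .
    then show "emeasure ?M {x<..} < \<infinity>" by simp
    have "emeasure ?N {x<..} = (\<integral>\<^sup>+t. ennreal pi * indicator {x<..0} t \<partial>lborel)"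
      by (subst emeasure_density) (auto intro!: nn_integral_cong split: split_indicator)
    also have "\<dots> = ennreal (pi * max 0 (- x))"
      by (subst nn_integral_cmult_indicator) (auto simp: max_def ennreal_mult)
    finally show "emeasure ?M {x<..} = emeasure ?N {x<..}" using M' by simp
  qed auto
  have "(\<integral>\<^sup>+z. f ((norm z)\<^sup>2) \<partial>(lborel :: (real \<times> real) measure)) = (\<integral>\<^sup>+t. f (- t) \<partial>?M)"
    by (subst nn_integral_distr) auto
  also have "\<dots> = (\<integral>\<^sup>+t. ennreal pi * (indicator {..0} t * f (- t)) \<partial>lborel)"
    unfolding eq by (subst nn_integral_density) (auto simp: mult.assoc)
  also have "\<dots> = ennreal pi * (\<integral>\<^sup>+t. indicator {..0} t * f (- t) \<partial>lborel)"
    by (subst nn_integral_cmult) auto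
  also have "(\<integral>\<^sup>+t. indicator {..0} t * f (- t) \<partial>lborel) = (\<integral>\<^sup>+t. f t * indicator {0..} t \<partial>lborel)"
    by (subst nn_integral_real_affine[where c="-1" and t=0])
       (auto intro!: nn_integral_cong split: split_indicator)
  finally show ?thesis .
qed

text \<open>
  In the variable \<open>t = |z|\<^sup>2\<close> these are Euler's integrals for the factorial.
\<close>

lemma gaussian_moment:
  shows integrable_gaussian_moment:
      "integrable lborel (\<lambda>z::real \<times> real. (norm z) ^ (2 * m) * exp (- (norm z)\<^sup>2))"
    and integral_gaussian_moment:
      "(LINT z|lborel. (norm (z::real \<times> real)) ^ (2 * m) * exp (- (norm z)\<^sup>2)) = pi * fact m"
proof -
  have "(\<integral>\<^sup>+z. ennreal ((norm z) ^ (2 * m) * exp (- (norm z)\<^sup>2)) \<partial>(lborel :: (real \<times> real) measure))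
      = ennreal pi * (\<integral>\<^sup>+t. ennreal (t ^ m * exp (- t)) * indicator {0..} t \<partial>lborel)"
    by (subst nn_integral_radial[symmetric]) (auto simp: power_mult)
  also have "\<dots> = ennreal (pi * fact m)"
    by (subst nn_intergal_power_times_exp_Ici) (auto simp: ennreal_mult)
  finally have "(\<integral>\<^sup>+z. ennreal ((norm z) ^ (2 * m) * exp (- (norm z)\<^sup>2)) \<partial>(lborel :: (real \<times> real) measure))
      = ennreal (pi * fact m)" .
  then have "has_bochner_integral lborel (\<lambda>z::real \<times> real. (norm z) ^ (2 * m) * exp (- (norm z)\<^sup>2)) (pi * fact m)"
    by (intro has_bochner_integral_nn_integral) (auto simp: less_top)
  then show "integrable lborel (\<lambda>z::real \<times> real. (norm z) ^ (2 * m) * exp (- (norm z)\<^sup>2))"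
    "(LINT z|lborel. (norm (z::real \<times> real)) ^ (2 * m) * exp (- (norm z)\<^sup>2)) = pi * fact m"
    by (auto simp: has_bochner_integral_iff)
qed

text \<open>
  Completing the square dominates the integrand by a wider Gaussian.
\<close>

lemma integrable_exp_norm_gaussian:
  "integrable lborel (\<lambda>z::real \<times> real. exp (c * norm z) * exp (- (norm z)\<^sup>2))"
proof -
  have "(\<integral>\<^sup>+z. ennreal (exp (- ((norm z)\<^sup>2 / 2))) \<partial>(lborel :: (real \<times> real) measure))
      = ennreal pi * (\<integral>\<^sup>+t. ennreal (exp (- (t / 2))) * indicator {0..} t \<partial>lborel)"
    by (subst nn_integral_radial[symmetric]) auto
  also have "(\<integral>\<^sup>+t. ennreal (exp (- (t / 2))) * indicator {0..} t \<partial>lborel)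
     = 2 * (\<integral>\<^sup>+t. ennreal (t ^ 0 * exp (- t)) * indicator {0..} t \<partial>lborel)"
    by (subst nn_integral_real_affine[where c=2 and t=0])
       (auto intro!: arg_cong2[where f="(*)"] nn_integral_cong split: split_indicator)
  also have "ennreal pi * (2 * (\<integral>\<^sup>+t. ennreal (t ^ 0 * exp (- t)) * indicator {0..} t \<partial>lborel)) < \<infinity>"
    by (subst nn_intergal_power_times_exp_Ici) (auto simp: ennreal_mult_less_top)
  finally have "integrable lborel (\<lambda>z::real \<times> real. exp (- ((norm z)\<^sup>2 / 2)))"
    by (intro integrableI_bounded) (auto simp: less_top)
  then have i: "integrable lborel (\<lambda>z::real \<times> real. exp (c\<^sup>2 / 2) * exp (- ((norm z)\<^sup>2 / 2)))"
    by simp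
  show ?thesis
  proof (rule Bochner_Integration.integrable_bound[OF i])
    show "AE z in lborel. norm (exp (c * norm z) * exp (- (norm (z :: real \<times> real))\<^sup>2))
        \<le> norm (exp (c\<^sup>2 / 2) * exp (- ((norm z)\<^sup>2 / 2)))"
    proof (rule AE_I2)
      fix z :: "real \<times> real"
      have "0 \<le> (c - norm z)\<^sup>2" by simp
      then have "c * norm z - (norm z)\<^sup>2 \<le> c\<^sup>2 / 2 - (norm z)\<^sup>2 / 2"
        by (simp add: power2_diff field_simps)
      then show "norm (exp (c * norm z) * exp (- (norm z)\<^sup>2)) \<le> norm (exp (c\<^sup>2 / 2) * exp (- ((norm z)\<^sup>2 / 2)))"
        by (simp flip: exp_add)
    qed
  qed auto
qed

section \<open>Square integrability with Gaussian weight\<close>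

definition gauss_L2 :: "(real \<times> real \<Rightarrow> 'a::{real_normed_vector, second_countable_topology}) \<Rightarrow> bool" where
  "gauss_L2 f \<longleftrightarrow> f \<in> borel_measurable borel \<and>
     integrable lborel (\<lambda>z. (norm (f z))\<^sup>2 * exp (- (norm z)\<^sup>2))"

definition gauss_norm :: "(real \<times> real \<Rightarrow> 'a::{real_normed_vector, second_countable_topology}) \<Rightarrow> real" where
  "gauss_norm f = sqrt (LINT z|lborel. (norm (f z))\<^sup>2 * exp (- (norm z)\<^sup>2))"

lemma gauss_L2_measurable: "gauss_L2 f \<Longrightarrow> f \<in> borel_measurable borel"
  by (simp add: gauss_L2_def)

lemma gauss_norm_nonneg [simp]: "0 \<le> gauss_norm f"
  by (simp add: gauss_norm_def)

lemma gauss_norm_power2: "(gauss_norm f)\<^sup>2 = (LINT z|lborel. (norm (f z))\<^sup>2 * exp (- (norm z)\<^sup>2))"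
  by (simp add: gauss_norm_def)

lemma gauss_L2_bound:
  assumes f: "gauss_L2 f" and g: "g \<in> borel_measurable borel" and le: "\<And>z. norm (g z) \<le> C * norm (f z)"
  shows "gauss_L2 g"
proof -
  have i: "integrable lborel (\<lambda>z. C\<^sup>2 * ((norm (f z))\<^sup>2 * exp (- (norm z)\<^sup>2)))"
    using f by (simp add: gauss_L2_def)
  have "integrable lborel (\<lambda>z. (norm (g z))\<^sup>2 * exp (- (norm z)\<^sup>2))"
  proof (rule Bochner_Integration.integrable_bound[OF i])
    show "AE z in lborel. norm ((norm (g z))\<^sup>2 * exp (- (norm z)\<^sup>2)) \<le> norm (C\<^sup>2 * ((norm (f z))\<^sup>2 * exp (- (norm z)\<^sup>2)))"
    proof (rule AE_I2)
      fix z :: "real \<times> real"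
      have "(norm (g z))\<^sup>2 \<le> (C * norm (f z))\<^sup>2" using le[of z] by (intro power_mono) auto
      then show "norm ((norm (g z))\<^sup>2 * exp (- (norm z)\<^sup>2)) \<le> norm (C\<^sup>2 * ((norm (f z))\<^sup>2 * exp (- (norm z)\<^sup>2)))"
        by (simp add: power_mult_distrib abs_mult mult.assoc[symmetric])
    qed
  qed (use g in measurable)
  then show ?thesis using g by (simp add: gauss_L2_def)
qed

lemma gauss_L2_integrable_mult:
  assumes f: "gauss_L2 f" and g: "gauss_L2 g"
  shows "integrable lborel (\<lambda>z. norm (f z) * norm (g z) * exp (- (norm z)\<^sup>2))"
proof -
  note [measurable] = gauss_L2_measurable[OF f] gauss_L2_measurable[OF g]
  have i: "integrable lborel (\<lambda>z. (norm (f z))\<^sup>2 * exp (- (norm z)\<^sup>2) + (norm (g z))\<^sup>2 * exp (- (norm z)\<^sup>2))"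
    using f g by (simp add: gauss_L2_def)
  show ?thesis
  proof (rule Bochner_Integration.integrable_bound[OF i])
    show "AE z in lborel. norm (norm (f z) * norm (g z) * exp (- (norm z)\<^sup>2))
       \<le> norm ((norm (f z))\<^sup>2 * exp (- (norm z)\<^sup>2) + (norm (g z))\<^sup>2 * exp (- (norm z)\<^sup>2))"
    proof (rule AE_I2)
      fix z :: "real \<times> real"
      have "2 * (norm (f z) * norm (g z)) \<le> (norm (f z))\<^sup>2 + (norm (g z))\<^sup>2"
        using sum_squares_bound[of "norm (f z)" "norm (g z)"] by (simp add: mult.assoc)
      then have "norm (f z) * norm (g z) \<le> (norm (f z))\<^sup>2 + (norm (g z))\<^sup>2"
        by (smt (verit) mult_nonneg_nonneg norm_ge_zero)
      then have "norm (f z) * norm (g z) * exp (- (norm z)\<^sup>2) \<le> ((norm (f z))\<^sup>2 + (norm (g z))\<^sup>2) * exp (- (norm z)\<^sup>2)"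
        by (intro mult_right_mono) auto
      then show "norm (norm (f z) * norm (g z) * exp (- (norm z)\<^sup>2))
       \<le> norm ((norm (f z))\<^sup>2 * exp (- (norm z)\<^sup>2) + (norm (g z))\<^sup>2 * exp (- (norm z)\<^sup>2))"
        by (simp add: abs_mult distrib_right)
    qed
  qed measurable
qed

lemma gauss_L2_add:
  assumes f: "gauss_L2 f" and g: "gauss_L2 g"
  shows "gauss_L2 (\<lambda>z. f z + g z)"
proof -
  note [measurable] = gauss_L2_measurable[OF f] gauss_L2_measurable[OF g]
  have "gauss_L2 (\<lambda>z. norm (f z) + norm (g z))"
  proof -
    have "integrable lborel (\<lambda>z. (norm (f z))\<^sup>2 * exp (- (norm z)\<^sup>2) + (norm (g z))\<^sup>2 * exp (- (norm z)\<^sup>2)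
        + 2 * (norm (f z) * norm (g z) * exp (- (norm z)\<^sup>2)))"
      using f g gauss_L2_integrable_mult[OF f g] unfolding gauss_L2_def
      by (intro Bochner_Integration.integrable_add integrable_mult_right) auto
    then show ?thesis
      unfolding gauss_L2_def by (auto simp: power2_sum algebra_simps)
  qed
  then show ?thesis
    by (rule gauss_L2_bound[where C=1]) (auto simp: norm_triangle_ineq)
qed

text \<open>
  The squared norm of \<open>t * norm f - norm g\<close> is a nonnegative quadratic polynomial in the real number \<open>t\<close>.
\<close>

lemma gauss_Cauchy_Schwarz:
  assumes f: "gauss_L2 f" and g: "gauss_L2 g"
  shows "(LINT z|lborel. norm (f z) * norm (g z) * exp (- (norm z)\<^sup>2)) \<le> gauss_norm f * gauss_norm g"
proof -
  define A B P where "A = (gauss_norm f)\<^sup>2" and "B = (gauss_norm g)\<^sup>2"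
    and "P = (LINT z|lborel. norm (f z) * norm (g z) * exp (- (norm z)\<^sup>2))"
  have quad: "0 \<le> A * t\<^sup>2 - 2 * t * P + B" for t
  proof -
    have "0 \<le> (LINT z|lborel. (t * norm (f z) - norm (g z))\<^sup>2 * exp (- (norm z)\<^sup>2))"
      by (intro integral_nonneg_AE) auto
    also have "\<dots> = (LINT z|lborel. t\<^sup>2 * ((norm (f z))\<^sup>2 * exp (- (norm z)\<^sup>2))
        + (norm (g z))\<^sup>2 * exp (- (norm z)\<^sup>2) - (2 * t) * (norm (f z) * norm (g z) * exp (- (norm z)\<^sup>2)))"
      by (intro Bochner_Integration.integral_cong) (auto simp: power2_eq_square algebra_simps)
    also have "\<dots> = t\<^sup>2 * A + B - (2 * t) * P"
      unfolding A_def B_def P_def gauss_norm_power2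
      using f g gauss_L2_integrable_mult[OF f g] unfolding gauss_L2_def
      by (subst Bochner_Integration.integral_diff, simp, simp, subst Bochner_Integration.integral_add) auto
    finally show ?thesis by (simp add: mult_ac)
  qed
  have "P\<^sup>2 \<le> A * B"
  proof (cases "A = 0")
    case True
    have "P = 0"
    proof (rule ccontr)
      assume "P \<noteq> 0"
      then show False using quad[of "(B + 1) / (2 * P)"] True by simp
    qed
    then show ?thesis using True by simp
  next
    case False
    then have "A > 0" by (simp add: A_def)
    have "0 \<le> A * (A * (P / A)\<^sup>2 - 2 * (P / A) * P + B)"
      using quad[of "P / A"] \<open>A > 0\<close> by simp
    also have "\<dots> = A * B - P\<^sup>2"
      using \<open>A > 0\<close> by (simp add: field_simps power2_eq_square)
    finally show ?thesis by simp
  qed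
  also have "\<dots> = (gauss_norm f * gauss_norm g)\<^sup>2"
    by (simp add: A_def B_def power_mult_distrib)
  finally show ?thesis
    unfolding P_def by (rule power2_le_imp_le) simp
qed

lemma power_le_fact_exp:
  fixes x :: real
  assumes "0 \<le> x"
  shows "x ^ n \<le> fact n * exp x"
proof -
  have "x ^ n / fact n \<le> exp x"
  proof -
    have s: "(\<lambda>n. x ^ n / fact n) sums exp x"
      using exp_converges[of x] by (simp add: divide_inverse mult.commute)
    have "sum (\<lambda>n. x ^ n / fact n) {n} \<le> (\<Sum>n. x ^ n / fact n)"
      using s assms by (intro sum_le_suminf) (auto simp: sums_iff)
    then show ?thesis using s by (simp add: sums_iff)
  qed
  then show ?thesis by (simp add: field_simps)
qed

text \<open>
  A Gaussian absorbs exponential growth; this makes the kernel square integrable in its first variable.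
\<close>

lemma gauss_L2_exp_growth:
  assumes [measurable]: "f \<in> borel_measurable borel" and le: "\<And>z. norm (f z) \<le> C * exp (c * norm z)"
  shows "gauss_L2 f"
proof (rule gauss_L2_bound[OF _ assms(1)])
  have "integrable lborel (\<lambda>z::real \<times> real. (exp (c * norm z))\<^sup>2 * exp (- (norm z)\<^sup>2))"
    using integrable_exp_norm_gaussian[of "2 * c"] by (simp add: mult.assoc flip: exp_double)
  then show "gauss_L2 (\<lambda>z. exp (c * norm z))"
    by (simp add: gauss_L2_def)
  show "norm (f z) \<le> C * norm (exp (c * norm z))" for z using le by simp
qed

section \<open>Polyentire functions\<close>

text \<open>
  The explicit form of the solutions of the \<open>N\<close>-fold iterated Cauchy-Riemann equation on the whole plane. Working
  with the coefficients instead of the equation avoids all regularity questions in the complex part of the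
  argument.
\<close>

definition polyentire :: "nat \<Rightarrow> (complex \<Rightarrow> complex) \<Rightarrow> bool" where
  "polyentire N F \<longleftrightarrow> (\<exists>h. (\<forall>j<N. h j holomorphic_on UNIV) \<and> F = (\<lambda>z. \<Sum>j<N. cnj z ^ j * h j z))"

lemma polyentire_monom:
  assumes "j < N" "h holomorphic_on UNIV"
  shows "polyentire N (\<lambda>z. cnj z ^ j * h z)"
  unfolding polyentire_def
proof (intro exI conjI)
  show "\<forall>i<N. (\<lambda>z. if i = j then h z else 0) holomorphic_on UNIV"
  proof (intro allI impI)
    fix i show "(\<lambda>z. if i = j then h z else 0) holomorphic_on UNIV"
      using assms by (cases "i = j") auto
  qed
  show "(\<lambda>z. cnj z ^ j * h z) = (\<lambda>z. \<Sum>i<N. cnj z ^ i * (if i = j then h z else 0))"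
    using assms by (auto simp: fun_eq_iff if_distrib cong: if_cong)
qed

lemma polyentire_zero: "polyentire N (\<lambda>_. 0)"
  unfolding polyentire_def by (intro exI[of _ "\<lambda>_ _. 0"]) auto

lemma polyentire_add:
  assumes "polyentire N F" "polyentire N G"
  shows "polyentire N (\<lambda>z. F z + G z)"
proof -
  obtain h k where "\<forall>j<N. h j holomorphic_on UNIV" "F = (\<lambda>z. \<Sum>j<N. cnj z ^ j * h j z)"
    "\<forall>j<N. k j holomorphic_on UNIV" "G = (\<lambda>z. \<Sum>j<N. cnj z ^ j * k j z)"
    using assms unfolding polyentire_def by blast
  then show ?thesis
    unfolding polyentire_def
    by (intro exI[of _ "\<lambda>j z. h j z + k j z"]) (auto simp: sum.distrib algebra_simps intro!: holomorphic_intros)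
qed

lemma polyentire_sum: "(\<And>i. i \<in> A \<Longrightarrow> polyentire N (F i)) \<Longrightarrow> polyentire N (\<lambda>z. \<Sum>i\<in>A. F i z)"
  by (induction A rule: infinite_finite_induct) (auto intro: polyentire_zero polyentire_add)

lemma polyentire_mult:
  assumes "k holomorphic_on UNIV" "polyentire N F"
  shows "polyentire N (\<lambda>z. k z * F z)"
proof -
  obtain h where "\<forall>j<N. h j holomorphic_on UNIV" "F = (\<lambda>z. \<Sum>j<N. cnj z ^ j * h j z)"
    using assms unfolding polyentire_def by blast
  then show ?thesis
    unfolding polyentire_def using assms
    by (intro exI[of _ "\<lambda>j z. k z * h j z"]) (auto simp: sum_distrib_left mult_ac intro!: holomorphic_intros)
qed

lemma polyentire_cmult: "polyentire N F \<Longrightarrow> polyentire N (\<lambda>z. c * F z)"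
  by (rule polyentire_mult) auto

text \<open>
  By the binomial theorem a shift of \<open>cnj z\<close> creates only lower powers of it, so the order does not grow.
\<close>

lemma polyentire_monom_shift:
  assumes "j < N" "h holomorphic_on UNIV"
  shows "polyentire N (\<lambda>z. (cnj z + c) ^ j * h z)"
proof -
  have eq: "(\<lambda>z. (cnj z + c) ^ j * h z) = (\<lambda>z. \<Sum>i\<le>j. cnj z ^ i * (of_nat (j choose i) * c ^ (j - i) * h z))"
    by (rule ext, simp only: binomial_ring sum_distrib_right, rule sum.cong) (simp_all add: mult_ac)
  show ?thesis
    unfolding eq using assms by (intro polyentire_sum polyentire_monom holomorphic_intros) auto
qed

lemma polyentire_shift:
  assumes "polyentire N F"
  shows "polyentire N (\<lambda>z. F (w + z))"
proof -
  obtain h where h: "\<forall>j<N. h j holomorphic_on UNIV" and F: "F = (\<lambda>z. \<Sum>j<N. cnj z ^ j * h j z)"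
    using assms unfolding polyentire_def by blast
  have "(\<lambda>z. h j (w + z)) holomorphic_on UNIV" if "j < N" for j
  proof -
    have "(\<lambda>z. w + z) holomorphic_on UNIV" by (intro holomorphic_intros)
    from holomorphic_on_compose_gen[OF this, of "h j" UNIV] h that show ?thesis
      by (simp add: comp_def)
  qed
  then have "polyentire N (\<lambda>z. \<Sum>j<N. (cnj z + cnj w) ^ j * h j (w + z))"
    by (intro polyentire_sum polyentire_monom_shift) auto
  then show ?thesis unfolding F by (simp add: add.commute)
qed

lemma polyentire_cnj_cnj:
  assumes "polyentire N F"
  shows "polyentire N (\<lambda>z. cnj (F (cnj z)))"
proof -
  obtain h where h: "\<forall>j<N. h j holomorphic_on UNIV" and F: "F = (\<lambda>z. \<Sum>j<N. cnj z ^ j * h j z)"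
    using assms unfolding polyentire_def by blast
  have "polyentire N (\<lambda>z. \<Sum>j<N. cnj z ^ j * (cnj \<circ> h j \<circ> cnj) z)"
    using h by (intro polyentire_sum polyentire_monom holomorphic_on_compose_cnj_cnj) (auto intro: holomorphic_on_subset)
  then show ?thesis unfolding F by simp
qed

lemma polyentire_continuous: "polyentire N F \<Longrightarrow> continuous_on A F"
  unfolding polyentire_def
  by (auto intro!: continuous_intros elim!: holomorphic_on_imp_continuous_on[OF holomorphic_on_subset])

section \<open>The reproducing property of the complex kernel\<close>

definition circ :: "real \<Rightarrow> complex" where
  "circ t = exp (2 * of_real pi * \<i> * of_real t)"

lemma norm_circ [simp]: "norm (circ t) = 1"
  by (simp add: circ_def)

lemma continuous_on_circ [continuous_intros]: "continuous_on A f \<Longrightarrow> continuous_on A (\<lambda>x. circ (f x))"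
  unfolding circ_def by (intro continuous_intros)

text \<open>
  On the unit circle \<open>cnj \<zeta> = 1 / \<zeta>\<close>, which makes the mean Cauchy's integral for the \<open>j\<close>-th derivative at 0
  of \<open>\<lambda>\<zeta>. h (u * \<zeta>)\<close>.
\<close>

lemma circle_mean_monom:
  assumes h: "h holomorphic_on UNIV"
  shows "((\<lambda>t. cnj (circ t * u) ^ j * h (circ t * u)) has_integral
           (of_real ((norm u)\<^sup>2) ^ j * ((deriv ^^ j) h 0 / fact j))) {0..1}"
proof -
  let ?f = "\<lambda>\<zeta>. h (u * \<zeta>)"
  have f: "?f holomorphic_on UNIV"
  proof -
    have "(\<lambda>\<zeta>. u * \<zeta>) holomorphic_on UNIV" by (intro holomorphic_intros)
    from holomorphic_on_compose_gen[OF this h] show ?thesis by (simp add: comp_def)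
  qed
  have "(deriv ^^ j) ?f 0 = u ^ j * (deriv ^^ j) h (u * 0)"
    by (rule higher_deriv_compose_linear[OF h, of UNIV]) auto
  moreover have "((\<lambda>\<zeta>. ?f \<zeta> / (\<zeta> - 0) ^ Suc j) has_contour_integral ((2 * pi * \<i>) / fact j * (deriv ^^ j) ?f 0)) (circlepath 0 1)"
    by (rule Cauchy_has_contour_integral_higher_derivative_circlepath)
       (auto intro: holomorphic_on_subset[OF f] holomorphic_on_imp_continuous_on)
  ultimately have "((\<lambda>t. ?f (circ t) / circ t ^ Suc j * (2 * pi * \<i> * circ t)) has_integral
      ((2 * pi * \<i>) / fact j * (u ^ j * (deriv ^^ j) h 0))) {0..1}"
    unfolding has_contour_integral vector_derivative_circlepath by (simp add: circlepath circ_def)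
  from has_integral_mult_right[OF this, of "cnj u ^ j / (2 * pi * \<i>)"]
  have "((\<lambda>t. cnj u ^ j / (2 * pi * \<i>) * (?f (circ t) / circ t ^ Suc j * (2 * pi * \<i> * circ t))) has_integral
      (cnj u ^ j / (2 * pi * \<i>) * ((2 * pi * \<i>) / fact j * (u ^ j * (deriv ^^ j) h 0)))) {0..1}" .
  moreover have "cnj u ^ j / (2 * pi * \<i>) * (?f (circ t) / circ t ^ Suc j * (2 * pi * \<i> * circ t))
      = cnj (circ t * u) ^ j * h (circ t * u)" for t
  proof -
    have nz: "circ t \<noteq> 0" by (simp add: circ_def)
    have "circ t * cnj (circ t) = 1" by (subst complex_norm_square[symmetric]) simp
    then have "1 / circ t ^ j = cnj (circ t) ^ j"
      using nz by (simp add: field_simps flip: power_mult_distrib)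
    then show ?thesis using nz
      by (simp add: power_mult_distrib field_simps)
  qed
  moreover have *: "a / p * (p / f * (b * d)) = b * a * (d / f)" if "p \<noteq> 0" for a p f b d :: complex
    using that by simp
  have "cnj u ^ j / (2 * pi * \<i>) * ((2 * pi * \<i>) / fact j * (u ^ j * (deriv ^^ j) h 0))
      = of_real ((norm u)\<^sup>2) ^ j * ((deriv ^^ j) h 0 / fact j)"
    using * [of "2 * pi * \<i>" "cnj u ^ j" "fact j" "u ^ j"]
    unfolding complex_norm_square by (simp add: power_mult_distrib)
  ultimately show ?thesis by simp
qed

text \<open>
  Circle means cannot distinguish a polyentire function from a polynomial in the squared radius: this is where
  the order \<open>N\<close> enters the reproducing formula, as a bound on the degree.
\<close>

lemma polyentire_circle_mean:
  assumes "polyentire N F" "N \<ge> 1"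
  shows "\<exists>c. c 0 = F 0 \<and> (\<forall>u. ((\<lambda>t. F (circ t * u)) has_integral (\<Sum>j<N. of_real ((norm u)\<^sup>2) ^ j * c j)) {0..1})"
proof -
  obtain h where h: "\<forall>j<N. h j holomorphic_on UNIV" and F: "F = (\<lambda>z. \<Sum>j<N. cnj z ^ j * h j z)"
    using assms unfolding polyentire_def by blast
  have "F 0 = h 0 0"
  proof -
    have "F 0 = (\<Sum>j<N. if j = 0 then h 0 0 else 0)"
      unfolding F by (intro sum.cong) auto
    then show ?thesis using assms(2) by simp
  qed
  then show ?thesis
    unfolding F using h
    by (intro exI[of _ "\<lambda>j. (deriv ^^ j) (h j) 0 / fact j"] conjI allI has_integral_sum circle_mean_monom) auto
qed

text \<open>
  An integral with radial weight does not change if the integrand is rotated; averaging over all rotations and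
  exchanging the integrals replaces the function by its circle means.
\<close>

lemma integral_circle_mean:
  fixes F :: "complex \<Rightarrow> complex" and \<phi> :: "real \<Rightarrow> real"
  assumes F: "continuous_on UNIV F" and \<phi>: "continuous_on UNIV \<phi>"
    and int: "integrable lborel (\<lambda>z. \<phi> (norm z) *\<^sub>R F (to_complex z))"
  shows "(LINT z|lborel. \<phi> (norm z) *\<^sub>R F (to_complex z))
       = (LINT z|lborel. \<phi> (norm z) *\<^sub>R integral {0..1} (\<lambda>t. F (circ t * to_complex z)))"
proof -
  let ?g = "\<lambda>z. \<phi> (norm z) *\<^sub>R F (to_complex z)"
  have gm: "?g \<in> borel_measurable borel"
    by (intro borel_measurable_continuous_onI continuous_intros continuous_on_compose2[OF F] continuous_on_compose2[OF \<phi>]) auto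
  have rot: "integrable lborel (\<lambda>z. ?g (plane_rot c z))" "(LINT z|lborel. ?g (plane_rot c z)) = integral\<^sup>L lborel ?g"
      "(LINT z|lborel. norm (?g (plane_rot c z))) = (LINT z|lborel. norm (?g z))" if "norm c = 1" for c
  proof -
    have "integrable (distr lborel borel (plane_rot c)) ?g"
      using int that by (simp add: lborel_plane_rot)
    then show "integrable lborel (\<lambda>z. ?g (plane_rot c z))"
      by (subst (asm) integrable_distr_eq) (use gm in auto)
    show "(LINT z|lborel. ?g (plane_rot c z)) = integral\<^sup>L lborel ?g"
      using integral_distr[of "plane_rot c" lborel borel ?g] gm that by (simp add: lborel_plane_rot)
    show "(LINT z|lborel. norm (?g (plane_rot c z))) = (LINT z|lborel. norm (?g z))"
      using integral_distr[of "plane_rot c" lborel borel "\<lambda>z. norm (?g z)"] measurable_compose[OF gm borel_measurable_norm] that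
      by (simp add: lborel_plane_rot del: norm_scaleR)
  qed
  have norm_rot: "norm (plane_rot (circ t) z) = norm z" for t z
    by (metis to_complex_simps(3) to_complex_plane_rot norm_circ norm_mult mult_1)
  \<comment> \<open>The integrand on \<open>[0, 1]\<close> times the plane to which Fubini's theorem is applied.\<close>
  define k where "k t z = indicator {0..1} t *\<^sub>R (\<phi> (norm z) *\<^sub>R F (circ t * to_complex z))" for t :: real and z
  have k: "k t z = indicator {0..1} t *\<^sub>R ?g (plane_rot (circ t) z)" for t z
    by (simp add: k_def norm_rot)
  have km: "case_prod k \<in> borel_measurable (lborel \<Otimes>\<^sub>M lborel)"
  proof -
    have "(\<lambda>p. \<phi> (norm (snd p)) *\<^sub>R F (circ (fst p) * to_complex (snd p))) \<in> borel_measurable (borel :: (real \<times> real \<times> real) measure)"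
      by (intro borel_measurable_continuous_onI continuous_intros continuous_on_compose2[OF F] continuous_on_compose2[OF \<phi>]) auto
    then have [measurable]: "(\<lambda>p. \<phi> (norm (snd p)) *\<^sub>R F (circ (fst p) * to_complex (snd p))) \<in> borel_measurable (lborel \<Otimes>\<^sub>M lborel)"
      unfolding lborel_prod by simp
    show ?thesis unfolding k_def case_prod_beta' by measurable
  qed
  have ki: "integrable (lborel \<Otimes>\<^sub>M lborel) (case_prod k)"
  proof (rule lborel_pair.Fubini_integrable[OF km])
    show "integrable lborel (\<lambda>x. LINT y|lborel. norm (case_prod k (x, y)))"
    proof -
      have "(\<lambda>x. LINT y|lborel. norm (case_prod k (x, y))) = (\<lambda>x. indicator {0..1} x * (LINT z|lborel. norm (?g z)))"
      proof
        fix x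
        have "norm (case_prod k (x, y)) = indicator {0..1} x * norm (?g (plane_rot (circ x) y))" for y
          unfolding prod.case k by (subst norm_scaleR) simp
        then show "(LINT y|lborel. norm (case_prod k (x, y))) = indicator {0..1} x * (LINT z|lborel. norm (?g z))"
          by (simp only: integral_mult_right_zero rot(3)[OF norm_circ])
      qed
      then show ?thesis by simp
    qed
    show "AE x in lborel. integrable lborel (\<lambda>y. case_prod k (x, y))"
      unfolding prod.case k by (intro AE_I2 integrable_scaleR_right rot(1) norm_circ)
  qed
  have "(LINT z|lborel. \<phi> (norm z) *\<^sub>R integral {0..1} (\<lambda>t. F (circ t * to_complex z))) = (LINT z|lborel. LINT t|lborel. k t z)"
  proof (intro Bochner_Integration.integral_cong refl)
    fix z :: "real \<times> real"
    have "continuous_on {0..1} (\<lambda>t. F (circ t * to_complex z))"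
      by (intro continuous_on_compose2[OF F] continuous_intros) auto
    then have "set_integrable lborel {0..1} (\<lambda>t. F (circ t * to_complex z))"
      by (rule borel_integrable_atLeastAtMost')
    then have "integral {0..1} (\<lambda>t. F (circ t * to_complex z)) = (LINT t|lborel. indicator {0..1} t *\<^sub>R F (circ t * to_complex z))"
      by (subst set_borel_integral_eq_integral(2)[symmetric]) (auto simp: set_lebesgue_integral_def)
    moreover have "k t z = \<phi> (norm z) *\<^sub>R (indicator {0..1} t *\<^sub>R F (circ t * to_complex z))" for t
      by (simp add: k_def mult.commute)
    ultimately show "\<phi> (norm z) *\<^sub>R integral {0..1} (\<lambda>t. F (circ t * to_complex z)) = (LINT t|lborel. k t z)"
      by (simp only: integral_scaleR_right)
  qed
  also have "\<dots> = (LINT t|lborel. LINT z|lborel. k t z)"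
    by (rule lborel_pair.Fubini_integral[OF ki])
  also have "\<dots> = (LINT t|lborel. indicator {0..1::real} t *\<^sub>R integral\<^sup>L lborel ?g)"
  proof (intro Bochner_Integration.integral_cong refl)
    fix t
    have "k t = (\<lambda>z. indicator {0..1} t *\<^sub>R ?g (plane_rot (circ t) z))"
      by (rule ext) (rule k)
    then show "integral\<^sup>L lborel (k t) = indicator {0..1} t *\<^sub>R integral\<^sup>L lborel ?g"
      by (simp only: integral_scaleR_right rot(2)[OF norm_circ])
  qed
  also have "\<dots> = integral\<^sup>L lborel ?g"
    by simp
  finally show ?thesis by simp
qed

text \<open>
  An \<open>N\<close>-th finite difference kills polynomials of degree below \<open>N\<close>. Rising factorials are a convenient basis,
  since a difference of them is again one, of degree one less and with shifted argument; hence the parameter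
  \<open>a\<close>, which the induction needs.
\<close>

lemma pochhammer_alternating_sum:
  "j < N \<Longrightarrow> (\<Sum>k\<le>N. (-1) ^ k * real (N choose k) * pochhammer (real k + a) j) = 0"
proof (induction N arbitrary: j a)
  case (Suc N)
  show ?case
  proof (cases j)
    case 0
    then show ?thesis using choose_alternating_sum[of "Suc N", where 'a=real] by simp
  next
    case (Suc i)
    let ?p = "\<lambda>k. pochhammer (real k + a) j"
    have diff: "?p k - ?p (Suc k) = - real j * pochhammer (real k + (a + 1)) i" for k
    proof -
      have "?p k = (real k + a) * pochhammer (real k + (a + 1)) i"
        unfolding Suc by (simp add: pochhammer_rec add_ac)
      moreover have "?p (Suc k) = (real k + a + real j) * pochhammer (real k + (a + 1)) i"
        unfolding Suc by (simp add: pochhammer_rec' add_ac)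
      ultimately show ?thesis by (simp add: algebra_simps)
    qed
    have "(\<Sum>k\<le>Suc N. (-1) ^ k * real (Suc N choose k) * ?p k)
        = ?p 0 + (\<Sum>k\<le>N. (-1) ^ Suc k * real (Suc N choose Suc k) * ?p (Suc k))"
      by (subst sum.atMost_Suc_shift) simp
    also have "\<dots> = ?p 0 + (\<Sum>k\<le>N. (-1) ^ Suc k * real (N choose Suc k) * ?p (Suc k))
         + (\<Sum>k\<le>N. (-1) ^ Suc k * real (N choose k) * ?p (Suc k))"
      by (simp add: algebra_simps sum.distrib sum_subtractf sum_negf)
    also have "?p 0 + (\<Sum>k\<le>N. (-1) ^ Suc k * real (N choose Suc k) * ?p (Suc k))
        = (\<Sum>k\<le>Suc N. (-1) ^ k * real (N choose k) * ?p k)"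
      by (subst sum.atMost_Suc_shift) simp
    also have "\<dots> = (\<Sum>k\<le>N. (-1) ^ k * real (N choose k) * ?p k)"
      by simp
    also have "\<dots> + (\<Sum>k\<le>N. (-1) ^ Suc k * real (N choose k) * ?p (Suc k))
        = (\<Sum>k\<le>N. (-1) ^ k * real (N choose k) * (?p k - ?p (Suc k)))"
      by (simp add: algebra_simps sum_subtractf sum_negf)
    also have "\<dots> = - real j * (\<Sum>k\<le>N. (-1) ^ k * real (N choose k) * pochhammer (real k + (a + 1)) i)"
      unfolding diff by (simp add: sum_distrib_left mult_ac)
    also have "\<dots> = 0"
      using Suc.IH[of i "a + 1"] Suc.prems Suc by simp
    finally show ?thesis .
  qed
qed simp

definition laguerre_coeff :: "nat \<Rightarrow> nat \<Rightarrow> real" where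
  "laguerre_coeff N k = (-1) ^ k * real (N choose (k + 1)) * (1 / fact k)"

text \<open>
  As \<open>fact (k + j)\<close> is the integral of \<open>t ^ (k + j) * exp (- t)\<close> over the half line, this says that integration
  against \<open>\<lambda>t. laguerre N t * exp (- t)\<close> picks the constant term of a polynomial of degree below \<open>N\<close>.
\<close>

lemma laguerre_orthogonality:
  assumes "j < N"
  shows "(\<Sum>k<N. laguerre_coeff N k * fact (k + j)) = (if j = 0 then 1 else 0)"
proof -
  have poch: "fact (k + j) / fact k = pochhammer (real (Suc k)) j" for k
  proof -
    have "pochhammer (1::real) (k + j) = pochhammer 1 k * pochhammer (1 + real k) j"
      by (rule pochhammer_product')
    then show ?thesis by (simp add: pochhammer_fact[symmetric] field_simps)
  qed
  have "(\<Sum>k<N. laguerre_coeff N k * fact (k + j)) = (\<Sum>k<N. (-1) ^ k * real (N choose Suc k) * pochhammer (real (Suc k)) j)"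
    unfolding poch[symmetric] laguerre_coeff_def by (intro sum.cong) simp_all
  also have "\<dots> = pochhammer 0 j - (\<Sum>k\<le>N. (-1) ^ k * real (N choose k) * pochhammer (real k + 0) j)"
    unfolding lessThan_Suc_atMost[symmetric] by (subst sum.lessThan_Suc_shift) (simp add: sum_negf)
  also have "\<dots> = pochhammer 0 j"
    by (subst pochhammer_alternating_sum[OF assms]) simp
  finally show ?thesis by (simp add: pochhammer_0_left)
qed

text \<open>
  The generalized Laguerre polynomial with parameter 1 and degree \<open>N - 1\<close>.
\<close>

definition laguerre :: "nat \<Rightarrow> real \<Rightarrow> real" where
  "laguerre N t = (\<Sum>k<N. laguerre_coeff N k * t ^ k)"

lemma laguerre_exp_bound: "\<exists>C. \<forall>x\<ge>0. \<bar>laguerre N (x\<^sup>2)\<bar> \<le> C * exp x"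
proof (intro exI allI impI)
  fix x :: real assume x: "x \<ge> 0"
  have "\<bar>laguerre N (x\<^sup>2)\<bar> \<le> (\<Sum>k<N. \<bar>laguerre_coeff N k\<bar> * x ^ (2 * k))"
    unfolding laguerre_def by (rule order.trans[OF sum_abs]) (simp add: abs_mult power_mult)
  also have "\<dots> \<le> (\<Sum>k<N. \<bar>laguerre_coeff N k\<bar> * (fact (2 * k) * exp x))"
    using x by (intro sum_mono mult_left_mono power_le_fact_exp) auto
  finally show "\<bar>laguerre N (x\<^sup>2)\<bar> \<le> (\<Sum>k<N. \<bar>laguerre_coeff N k\<bar> * fact (2 * k)) * exp x"
    by (simp add: sum_distrib_right mult.assoc)
qed

lemma continuous_on_laguerre [continuous_intros]: "continuous_on A f \<Longrightarrow> continuous_on A (\<lambda>x. laguerre N (f x))"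
  unfolding laguerre_def by (intro continuous_intros)

lemma gauss_L2_laguerre: "gauss_L2 (\<lambda>z. laguerre N ((norm z)\<^sup>2))"
proof -
  obtain C where "\<forall>x\<ge>0. \<bar>laguerre N (x\<^sup>2)\<bar> \<le> C * exp x" using laguerre_exp_bound by blast
  then show ?thesis
    by (intro gauss_L2_exp_growth[of _ C 1] borel_measurable_continuous_onI continuous_intros) auto
qed

text \<open>
  After passing to circle means only Gaussian moments remain, and orthogonality leaves the constant term
  \<open>F 0\<close>.
\<close>

lemma reproducing_at_0:
  assumes F: "polyentire N F" and N: "N \<ge> 1" and L2: "gauss_L2 (\<lambda>z. F (to_complex z))"
  shows "(LINT z|lborel. (laguerre N ((norm z)\<^sup>2) * exp (- (norm z)\<^sup>2)) *\<^sub>R F (to_complex z)) = of_real pi * F 0"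
proof -
  obtain c where c0: "c 0 = F 0"
    and c: "\<And>u. ((\<lambda>t. F (circ t * u)) has_integral (\<Sum>j<N. of_real ((norm u)\<^sup>2) ^ j * c j)) {0..1}"
    using polyentire_circle_mean[OF F N] by blast
  note [measurable] = gauss_L2_measurable[OF L2] gauss_L2_measurable[OF gauss_L2_laguerre]
  have int: "integrable lborel (\<lambda>z. (laguerre N ((norm z)\<^sup>2) * exp (- (norm z)\<^sup>2)) *\<^sub>R F (to_complex z))"
    by (rule Bochner_Integration.integrable_bound[OF gauss_L2_integrable_mult[OF gauss_L2_laguerre L2]])
       (auto simp: abs_mult)
  have "(LINT z|lborel. (laguerre N ((norm z)\<^sup>2) * exp (- (norm z)\<^sup>2)) *\<^sub>R F (to_complex z))
      = (LINT z|lborel. (laguerre N ((norm z)\<^sup>2) * exp (- (norm (z :: real \<times> real))\<^sup>2)) *\<^sub>R (\<Sum>j<N. of_real ((norm z)\<^sup>2) ^ j * c j))"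
  proof -
    have "integral {0..1} (\<lambda>t. F (circ t * to_complex z)) = (\<Sum>j<N. of_real ((norm z)\<^sup>2) ^ j * c j)" for z
      using integral_unique[OF c[of "to_complex z"]] by (simp only: to_complex_simps)
    moreover have "continuous_on UNIV (\<lambda>x. laguerre N (x\<^sup>2) * exp (- x\<^sup>2))"
      by (intro continuous_intros)
    ultimately show ?thesis
      using integral_circle_mean[OF polyentire_continuous[OF F] _ int] by simp
  qed
  also have "\<dots> = (LINT z|lborel. (\<Sum>j<N. \<Sum>k<N. (norm (z :: real \<times> real) ^ (2 * (k + j)) * exp (- (norm z)\<^sup>2)) *\<^sub>R (laguerre_coeff N k *\<^sub>R c j)))"
  proof (intro Bochner_Integration.integral_cong refl)
    fix z :: "real \<times> real"
    have p: "norm z ^ (2 * (k + j)) = ((norm z)\<^sup>2) ^ k * ((norm z)\<^sup>2) ^ j" for k j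
      by (simp flip: power_mult power_add)
    show "(laguerre N ((norm z)\<^sup>2) * exp (- (norm z)\<^sup>2)) *\<^sub>R (\<Sum>j<N. of_real ((norm z)\<^sup>2) ^ j * c j)
        = (\<Sum>j<N. \<Sum>k<N. (norm z ^ (2 * (k + j)) * exp (- (norm z)\<^sup>2)) *\<^sub>R (laguerre_coeff N k *\<^sub>R c j))"
      unfolding laguerre_def scaleR_sum_right sum_distrib_right scaleR_sum_left p
      by (intro sum.cong refl) (simp only: scaleR_conv_of_real of_real_mult of_real_power mult_ac)
  qed
  also have "\<dots> = (\<Sum>j<N. \<Sum>k<N. (pi * fact (k + j)) *\<^sub>R (laguerre_coeff N k *\<^sub>R c j))"
    by (subst Bochner_Integration.integral_sum, (intro Bochner_Integration.integrable_sum integrable_scaleR_left integrable_gaussian_moment)+,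
        intro sum.cong refl, subst Bochner_Integration.integral_sum, (intro integrable_scaleR_left integrable_gaussian_moment)+)
       (simp only: integral_scaleR_left integrable_gaussian_moment integral_gaussian_moment)
  also have "\<dots> = (\<Sum>j<N. (pi * (\<Sum>k<N. laguerre_coeff N k * fact (k + j))) *\<^sub>R c j)"
    by (simp add: scaleR_sum_left[symmetric] sum_distrib_left mult_ac)
  also have "\<dots> = (\<Sum>j<N. if j = 0 then pi *\<^sub>R c 0 else 0)"
    by (intro sum.cong) (auto simp: laguerre_orthogonality)
  also have "\<dots> = of_real pi * F 0"
    using N c0 by (simp add: scaleR_conv_of_real)
  finally show ?thesis .
qed

definition complex_kernel :: "nat \<Rightarrow> complex \<Rightarrow> complex \<Rightarrow> complex" where
  "complex_kernel N z w = exp (z * cnj w) * of_real (laguerre N ((norm (z - w))\<^sup>2))"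

text \<open>
  The substitution \<open>z = w + u\<close> turns \<open>F\<close> into \<open>G u = exp (- cnj w * u) * F (w + u)\<close>, which is again polyentire
  and, up to a constant factor, has the same Gaussian norm. Under it the kernel times the weight becomes
  the Laguerre weight at the origin.
\<close>

theorem polyanalytic_reproducing:
  assumes F: "polyentire N F" and N: "N \<ge> 1" and L2: "gauss_L2 (\<lambda>z. F (to_complex z))"
  shows "(LINT z|lborel. exp (- (norm z)\<^sup>2) *\<^sub>R (cnj (complex_kernel N (to_complex z) w) * F (to_complex z))) = of_real pi * F w"
proof -
  define W where "W = (Re w, Im w)"
  have W: "to_complex W = w" by (simp add: W_def)
  define G where "G u = exp (- cnj w * u) * F (w + u)" for u
  have FG: "norm (F (w + to_complex u)) ^ 2 * exp (- (norm (W + u))\<^sup>2) = exp (- (norm W)\<^sup>2) * (norm (G (to_complex u)) ^ 2 * exp (- (norm u)\<^sup>2))" for u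
  proof -
    have "(norm (w + to_complex u))\<^sup>2 = (norm w)\<^sup>2 + (norm (to_complex u))\<^sup>2 + 2 * Re (cnj w * to_complex u)"
      unfolding cmod_power2 by (simp add: power2_eq_square algebra_simps)
    then have n: "(norm (W + u))\<^sup>2 = (norm W)\<^sup>2 + (norm u)\<^sup>2 + 2 * Re (cnj w * to_complex u)"
      using W by (metis to_complex_simps(3,5))
    have e: "exp (- (a + b + c)) = exp (- a) * (exp (- c) * exp (- b))" for a b c :: real
      by (simp flip: exp_add)
    have g: "norm (G (to_complex u)) ^ 2 = exp (- (2 * Re (cnj w * to_complex u))) * norm (F (w + to_complex u)) ^ 2"
      by (simp add: G_def norm_mult power_mult_distrib flip: exp_double)
    show ?thesis unfolding n e g by (simp only: mult_ac)
  qed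
  have Gp: "polyentire N G"
    unfolding G_def[abs_def] by (intro polyentire_mult polyentire_shift F holomorphic_intros)
  have tr: "lborel = distr lborel borel ((+) W)"
    by (simp add: lborel_distr_plus)
  have GL2: "gauss_L2 (\<lambda>u. G (to_complex u))"
  proof -
    have "integrable (distr lborel borel ((+) W)) (\<lambda>z. norm (F (to_complex z)) ^ 2 * exp (- (norm z)\<^sup>2))"
      using L2 by (simp add: gauss_L2_def lborel_distr_plus)
    then have "integrable lborel (\<lambda>u. norm (F (to_complex (W + u))) ^ 2 * exp (- (norm (W + u))\<^sup>2))"
      by (subst (asm) integrable_distr_eq) (use gauss_L2_measurable[OF L2] in measurable)
    then have "integrable lborel (\<lambda>u. exp (- (norm W)\<^sup>2) * (norm (G (to_complex u)) ^ 2 * exp (- (norm u)\<^sup>2)))"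
      by (simp only: to_complex_simps(5) W FG)
    then have "integrable lborel (\<lambda>u. norm (G (to_complex u)) ^ 2 * exp (- (norm u)\<^sup>2))"
      by simp
    moreover have "(\<lambda>u. G (to_complex u)) \<in> borel_measurable borel"
      by (intro borel_measurable_continuous_onI continuous_on_compose2[OF polyentire_continuous[OF Gp]] continuous_intros) auto
    ultimately show ?thesis by (simp add: gauss_L2_def)
  qed
  have ker: "exp (- (norm (W + u))\<^sup>2) *\<^sub>R (cnj (complex_kernel N (to_complex (W + u)) w) * F (to_complex (W + u)))
      = (laguerre N ((norm u)\<^sup>2) * exp (- (norm u)\<^sup>2)) *\<^sub>R G (to_complex u)" for u
  proof -
    have "exp (of_real (- (norm (W + u))\<^sup>2)) * exp (cnj (w + to_complex u) * w)
        = exp (of_real (- (norm u)\<^sup>2)) * exp (- cnj w * to_complex u)"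
    proof -
      have "complex_of_real ((norm (W + u))\<^sup>2) = (w + to_complex u) * cnj (w + to_complex u)"
        by (metis W complex_norm_square to_complex_simps(3,5))
      moreover have "complex_of_real ((norm u)\<^sup>2) = to_complex u * cnj (to_complex u)"
        by (metis complex_norm_square to_complex_simps(3))
      ultimately show ?thesis
        by (simp add: exp_add[symmetric] algebra_simps)
    qed
    then have "exp (- (norm (W + u))\<^sup>2) *\<^sub>R exp (cnj (w + to_complex u) * w) = exp (- (norm u)\<^sup>2) *\<^sub>R exp (- cnj w * to_complex u)"
      by (simp add: scaleR_conv_of_real flip: exp_of_real)
    then show ?thesis
      by (simp add: complex_kernel_def W G_def exp_cnj scaleR_conv_of_real mult_ac)
  qed
  have "(LINT z|lborel. exp (- (norm z)\<^sup>2) *\<^sub>R (cnj (complex_kernel N (to_complex z) w) * F (to_complex z)))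
      = (LINT u|lborel. exp (- (norm (W + u))\<^sup>2) *\<^sub>R (cnj (complex_kernel N (to_complex (W + u)) w) * F (to_complex (W + u))))"
  proof (subst tr, subst integral_distr)
    show "(\<lambda>z. exp (- (norm z)\<^sup>2) *\<^sub>R (cnj (complex_kernel N (to_complex z) w) * F (to_complex z))) \<in> borel_measurable borel"
      unfolding complex_kernel_def
      by (intro borel_measurable_continuous_onI continuous_on_compose2[OF polyentire_continuous[OF F]] continuous_intros) auto
  qed auto
  also have "\<dots> = (LINT u|lborel. (laguerre N ((norm u)\<^sup>2) * exp (- (norm u)\<^sup>2)) *\<^sub>R G (to_complex u))"
    unfolding ker ..
  also have "\<dots> = of_real pi * G 0"
    by (rule reproducing_at_0[OF Gp N GL2])
  also have "G 0 = F w" by (simp add: G_def)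
  finally show ?thesis .
qed

text \<open>
  Expanding the exponential and integrating term by term gives a power series in \<open>w\<close> that converges
  everywhere.
\<close>

lemma entire_exp_integral:
  fixes \<psi> :: "real \<times> real \<Rightarrow> complex"
  assumes [measurable]: "\<psi> \<in> borel_measurable borel"
    and int: "\<And>R. integrable lborel (\<lambda>z. norm (\<psi> z) * exp (R * norm z))"
  shows "(\<lambda>w. LINT z|lborel. exp (cnj (to_complex z) * w) * \<psi> z) holomorphic_on UNIV"
proof -
  let ?f = "\<lambda>w. LINT z|lborel. exp (cnj (to_complex z) * w) * \<psi> z"
  define a where "a n = (LINT z|lborel. cnj (to_complex z) ^ n / fact n * \<psi> z)" for n
  have to_complex_m[measurable]: "(\<lambda>z. cnj (to_complex z)) \<in> borel_measurable borel"
    by (intro borel_measurable_continuous_onI continuous_intros)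
  have sums: "(\<lambda>n. a n * (w - 0) ^ n) sums ?f w" for w
  proof -
    define t where "t n z = (cnj (to_complex z) * w) ^ n / fact n * \<psi> z" for n z
    have tm[measurable]: "t n \<in> borel_measurable borel" for n
      unfolding t_def[abs_def] by measurable
    have nt: "norm (t n z) = (norm z * norm w) ^ n / fact n * norm (\<psi> z)" for n z
      by (simp add: t_def norm_mult norm_divide norm_power)
    have exps: "(\<lambda>n. x ^ n / fact n) sums exp x" for x :: real
      using exp_converges[of x] by (simp add: divide_inverse mult.commute)
    have partial: "(\<Sum>n\<in>A. norm (t n z)) \<le> norm (\<psi> z) * exp (norm w * norm z)" if "finite A" for A z
    proof -
      have "(\<Sum>n\<in>A. (norm z * norm w) ^ n / fact n) \<le> (\<Sum>n. (norm z * norm w) ^ n / fact n)"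
        using exps[of "norm z * norm w"] that by (intro sum_le_suminf) (auto simp: sums_iff)
      also have "\<dots> = exp (norm w * norm z)"
        using exps[of "norm z * norm w"] by (simp add: sums_iff mult.commute)
      finally have "(\<Sum>n\<in>A. (norm z * norm w) ^ n / fact n) * norm (\<psi> z) \<le> exp (norm w * norm z) * norm (\<psi> z)"
        by (intro mult_right_mono) auto
      then show ?thesis unfolding nt sum_distrib_right[symmetric] by (simp only: mult.commute)
    qed
    have ti: "integrable lborel (t n)" for n
      by (rule Bochner_Integration.integrable_bound[OF int[of "norm w"]])
         (use partial[of "{n}"] in auto)
    have texp: "(\<lambda>n. t n z) sums (exp (cnj (to_complex z) * w) * \<psi> z)" for z
      using sums_mult2[OF exp_converges[of "cnj (to_complex z) * w"], of "\<psi> z"]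
      by (simp add: t_def scaleR_conv_of_real divide_inverse mult_ac)
    have "(\<lambda>n. integral\<^sup>L lborel (t n)) sums (LINT z|lborel. (\<Sum>n. t n z))"
    proof (rule sums_integral[OF ti])
      show "AE z in lborel. summable (\<lambda>n. norm (t n z))"
        using sums_mult2[OF exps] by (intro AE_I2) (auto simp: nt sums_iff)
      show "summable (\<lambda>n. LINT z|lborel. norm (t n z))"
      proof (rule bounded_imp_summable)
        show "(\<Sum>n\<le>m. LINT z|lborel. norm (t n z)) \<le> (LINT z|lborel. norm (\<psi> z) * exp (norm w * norm z))" for m
        proof -
          have "(\<Sum>n\<le>m. LINT z|lborel. norm (t n z)) = (LINT z|lborel. (\<Sum>n\<le>m. norm (t n z)))"
            using ti by (subst Bochner_Integration.integral_sum) auto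
          also have "\<dots> \<le> (LINT z|lborel. norm (\<psi> z) * exp (norm w * norm z))"
            by (intro integral_mono partial int Bochner_Integration.integrable_sum integrable_norm ti) auto
          finally show ?thesis .
        qed
      qed auto
    qed
    moreover have "integral\<^sup>L lborel (t n) = a n * (w - 0) ^ n" for n
    proof -
      have "t n = (\<lambda>z. w ^ n * (cnj (to_complex z) ^ n / fact n * \<psi> z))"
        by (auto simp: t_def power_mult_distrib)
      then show ?thesis by (simp add: a_def mult.commute)
    qed
    moreover have "(\<Sum>n. t n z) = exp (cnj (to_complex z) * w) * \<psi> z" for z
      using texp by (simp add: sums_iff)
    ultimately show ?thesis by simp
  qed
  have "?f holomorphic_on ball 0 r" for r
    by (rule power_series_holomorphic[of 0 _ a]) (rule sums)
  then have "?f holomorphic_on (\<Union>r. ball 0 r)"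
    by (intro holomorphic_on_UN_open) auto
  moreover have "(\<Union>r. ball 0 r) = (UNIV :: complex set)"
  proof (rule set_eqI)
    fix x :: complex
    have "x \<in> ball 0 (norm x + 1)" by simp
    then show "x \<in> (\<Union>r. ball 0 r) \<longleftrightarrow> x \<in> UNIV" by blast
  qed
  ultimately show ?thesis by simp
qed

lemma complex_kernel_cnj: "cnj (complex_kernel N \<zeta> w) = exp (cnj \<zeta> * w) *
    (\<Sum>k<N. of_real (laguerre_coeff N k) * ((cnj \<zeta> - cnj w) ^ k * (\<zeta> - w) ^ k))"
proof -
  have "complex_of_real ((norm (\<zeta> - w))\<^sup>2) = (cnj \<zeta> - cnj w) * (\<zeta> - w)"
    by (subst complex_norm_square) (simp add: mult.commute)
  then show ?thesis
    unfolding complex_kernel_def laguerre_def complex_cnj_mult exp_cnj complex_cnj_cnj complex_cnj_complex_of_real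
    by (simp only: of_real_sum of_real_mult of_real_power power_mult_distrib)
qed

text \<open>
  The integral produces a polyentire function from any square integrable \<open>g\<close>, polyanalytic or not. The space
  is closed under limits for this reason. Multiplying out the kernel gives powers of \<open>cnj w\<close> with exponents
  below \<open>N\<close>, and the other factors depend holomorphically on \<open>w\<close>.
\<close>

lemma polyentire_gauss_integral:
  fixes g :: "real \<times> real \<Rightarrow> complex"
  assumes g: "gauss_L2 g"
  shows "polyentire N (\<lambda>w. LINT z|lborel. exp (- (norm z)\<^sup>2) *\<^sub>R (cnj (complex_kernel N (to_complex z) w) * g z))"
proof -
  note [measurable] = gauss_L2_measurable[OF g]
  have to_complex_m[measurable]: "(\<lambda>z. cnj (to_complex z)) \<in> borel_measurable borel"
    by (intro borel_measurable_continuous_onI continuous_intros)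
  define \<psi> where "\<psi> p q z = cnj (to_complex z) ^ p * to_complex z ^ q * (exp (- (norm z)\<^sup>2) *\<^sub>R g z)" for p q z
  have \<psi>m[measurable]: "\<psi> p q \<in> borel_measurable borel" for p q
    unfolding \<psi>_def[abs_def] by measurable
  define E where "E p q w = (LINT z|lborel. exp (cnj (to_complex z) * w) * \<psi> p q z)" for p q w
  have int: "integrable lborel (\<lambda>z. norm (\<psi> p q z) * exp (R * norm z))" for p q R
  proof -
    let ?m = "\<lambda>z::real \<times> real. norm z ^ (p + q) * exp (R * norm z)"
    have "gauss_L2 ?m"
    proof (rule gauss_L2_exp_growth[of _ "fact (p + q)" "1 + R"])
      fix z :: "real \<times> real"
      have "norm z ^ (p + q) * exp (R * norm z) \<le> (fact (p + q) * exp (norm z)) * exp (R * norm z)"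
        by (intro mult_right_mono power_le_fact_exp) auto
      then show "norm (?m z) \<le> fact (p + q) * exp ((1 + R) * norm z)"
        by (simp add: abs_mult exp_add distrib_right mult.assoc)
    qed measurable
    from gauss_L2_integrable_mult[OF this g] show ?thesis
      by (simp add: \<psi>_def norm_mult norm_power abs_mult power_add mult_ac)
  qed
  have E: "E p q holomorphic_on UNIV" for p q
    unfolding E_def[abs_def] by (rule entire_exp_integral[OF \<psi>m int])
  have Ei: "integrable lborel (\<lambda>z. exp (cnj (to_complex z) * w) * \<psi> p q z)" for p q w
  proof (rule Bochner_Integration.integrable_bound[OF int[of p q "norm w"]])
    show "AE z in lborel. norm (exp (cnj (to_complex z) * w) * \<psi> p q z) \<le> norm (norm (\<psi> p q z) * exp (norm w * norm z))"
    proof (rule AE_I2)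
      fix z
      have "norm (exp (cnj (to_complex z) * w)) \<le> exp (norm w * norm z)"
        using norm_exp[of "cnj (to_complex z) * w"] by (simp add: norm_mult mult.commute)
      then show "norm (exp (cnj (to_complex z) * w) * \<psi> p q z) \<le> norm (norm (\<psi> p q z) * exp (norm w * norm z))"
        by (simp add: norm_mult mult.commute mult_left_mono)
    qed
  qed measurable
  define c :: "nat \<Rightarrow> nat \<Rightarrow> nat \<Rightarrow> complex" where "c k a b = of_real (laguerre_coeff N k) * (of_nat (k choose a) * (-1) ^ a * (of_nat (k choose b) * (-1) ^ b))" for k a b :: nat
  have "(LINT z|lborel. exp (- (norm z)\<^sup>2) *\<^sub>R (cnj (complex_kernel N (to_complex z) w) * g z))
      = (\<Sum>k<N. \<Sum>a\<le>k. \<Sum>b\<le>k. cnj w ^ a * (c k a b * w ^ b * E (k - a) (k - b) w))" for w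
  proof -
    have "exp (- (norm z)\<^sup>2) *\<^sub>R (cnj (complex_kernel N (to_complex z) w) * g z)
       = (\<Sum>k<N. \<Sum>a\<le>k. \<Sum>b\<le>k. (cnj w ^ a * (c k a b * w ^ b)) * (exp (cnj (to_complex z) * w) * \<psi> (k - a) (k - b) z))" for z
    proof -
      let ?\<zeta> = "to_complex z"
      have e: "(x - y) ^ k = (\<Sum>a\<le>k. of_nat (k choose a) * (-1) ^ a * y ^ a * x ^ (k - a))" for x y :: complex and k
      proof -
        have "(x - y) ^ k = (- y + x) ^ k" by simp
        then show ?thesis by (simp only: binomial_ring power_minus[of y]) (simp only: mult_ac)
      qed
      have p: "(cnj ?\<zeta> - cnj w) ^ k * (?\<zeta> - w) ^ k = (\<Sum>a\<le>k. \<Sum>b\<le>k.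
          (of_nat (k choose a) * (-1) ^ a * cnj w ^ a * cnj ?\<zeta> ^ (k - a)) *
          (of_nat (k choose b) * (-1) ^ b * w ^ b * ?\<zeta> ^ (k - b)))" for k
        unfolding e[of "cnj ?\<zeta>"] e[of ?\<zeta>] by (rule sum_product)
      show ?thesis
        unfolding complex_kernel_cnj p sum_distrib_left sum_distrib_right scaleR_sum_right
        by (intro sum.cong refl) (simp add: c_def \<psi>_def scaleR_conv_of_real mult_ac)
    qed
    then have "(LINT z|lborel. exp (- (norm z)\<^sup>2) *\<^sub>R (cnj (complex_kernel N (to_complex z) w) * g z))
       = (LINT z|lborel. (\<Sum>k<N. \<Sum>a\<le>k. \<Sum>b\<le>k. (cnj w ^ a * (c k a b * w ^ b)) * (exp (cnj (to_complex z) * w) * \<psi> (k - a) (k - b) z)))"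
      by simp
    also have "\<dots> = (\<Sum>k<N. LINT z|lborel. (\<Sum>a\<le>k. \<Sum>b\<le>k. (cnj w ^ a * (c k a b * w ^ b)) * (exp (cnj (to_complex z) * w) * \<psi> (k - a) (k - b) z)))"
      by (intro Bochner_Integration.integral_sum Bochner_Integration.integrable_sum integrable_mult_right Ei)
    also have "\<dots> = (\<Sum>k<N. \<Sum>a\<le>k. LINT z|lborel. (\<Sum>b\<le>k. (cnj w ^ a * (c k a b * w ^ b)) * (exp (cnj (to_complex z) * w) * \<psi> (k - a) (k - b) z)))"
      by (intro sum.cong refl Bochner_Integration.integral_sum Bochner_Integration.integrable_sum integrable_mult_right Ei)
    also have "\<dots> = (\<Sum>k<N. \<Sum>a\<le>k. \<Sum>b\<le>k. LINT z|lborel. (cnj w ^ a * (c k a b * w ^ b)) * (exp (cnj (to_complex z) * w) * \<psi> (k - a) (k - b) z))"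
      by (intro sum.cong refl Bochner_Integration.integral_sum Bochner_Integration.integrable_sum integrable_mult_right Ei)
    finally show ?thesis
      by (simp only: integral_mult_right_zero E_def mult.assoc)
  qed
  moreover have "polyentire N (\<lambda>w. \<Sum>k<N. \<Sum>a\<le>k. \<Sum>b\<le>k. cnj w ^ a * (c k a b * w ^ b * E (k - a) (k - b) w))"
    by (intro polyentire_sum polyentire_monom holomorphic_intros E) auto
  ultimately show ?thesis by simp
qed

lemma complex_kernel_swap: "complex_kernel N w z = cnj (complex_kernel N z w)"
  by (simp add: complex_kernel_def exp_cnj norm_minus_commute mult.commute)

lemma polyentire_complex_kernel: "polyentire N (\<lambda>z. complex_kernel N z w)"
proof -
  have "complex_kernel N z w = (\<Sum>k<N. (cnj z + - cnj w) ^ k * (of_real (laguerre_coeff N k) * (exp (z * cnj w) * (z - w) ^ k)))" for z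
  proof -
    have p: "(cnj w - cnj z) ^ k * (w - z) ^ k = (cnj z + - cnj w) ^ k * (z - w) ^ k" for k
      by (simp flip: power_mult_distrib) (simp add: algebra_simps)
    show ?thesis
      unfolding complex_kernel_swap[of N z w] complex_kernel_cnj p by (simp add: sum_distrib_left mult_ac)
  qed
  moreover have "polyentire N (\<lambda>z. \<Sum>k<N. (cnj z + - cnj w) ^ k * (of_real (laguerre_coeff N k) * (exp (z * cnj w) * (z - w) ^ k)))"
    by (intro polyentire_sum polyentire_monom_shift holomorphic_intros) auto
  ultimately show ?thesis by simp
qed

lemma gauss_L2_complex_kernel: "gauss_L2 (\<lambda>z. complex_kernel N (to_complex z) w)"
proof -
  obtain C where C: "\<forall>x\<ge>0. \<bar>laguerre N (x\<^sup>2)\<bar> \<le> C * exp x" using laguerre_exp_bound by blast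
  have C0: "C \<ge> 0" using C[rule_format, of 0] by simp
  show ?thesis
  proof (rule gauss_L2_exp_growth[of _ "C * exp (norm w)" "norm w + 1"])
    show "(\<lambda>z. complex_kernel N (to_complex z) w) \<in> borel_measurable borel"
      by (intro borel_measurable_continuous_onI continuous_on_compose2[OF polyentire_continuous[OF polyentire_complex_kernel]] continuous_intros) auto
    fix z
    have "norm (exp (to_complex z * cnj w)) \<le> exp (norm w * norm z)"
      using norm_exp[of "to_complex z * cnj w"] by (simp add: norm_mult mult.commute)
    moreover have "\<bar>laguerre N ((norm (to_complex z - w))\<^sup>2)\<bar> \<le> C * exp (norm z + norm w)"
    proof -
      have "\<bar>laguerre N ((norm (to_complex z - w))\<^sup>2)\<bar> \<le> C * exp (norm (to_complex z - w))"
        using C by simp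
      also have "\<dots> \<le> C * exp (norm z + norm w)"
        using norm_triangle_ineq4[of "to_complex z" w] C0 by (intro mult_left_mono) auto
      finally show ?thesis .
    qed
    ultimately have "norm (exp (to_complex z * cnj w)) * \<bar>laguerre N ((norm (to_complex z - w))\<^sup>2)\<bar> \<le> exp (norm w * norm z) * (C * exp (norm z + norm w))"
      by (intro mult_mono) auto
    moreover have "exp (norm w * norm z) * (C * exp (norm z + norm w)) = C * exp (norm w) * exp ((norm w + 1) * norm z)"
      by (simp add: exp_add algebra_simps)
    ultimately show "norm (complex_kernel N (to_complex z) w) \<le> C * exp (norm w) * exp ((norm w + 1) * norm z)"
      by (simp only: complex_kernel_def norm_mult norm_of_real)
  qed
qed

section \<open>Slices of the quaternions as copies of the complex plane\<close>

definition slice_emb :: "quat \<Rightarrow> complex \<Rightarrow> quat" where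
  "slice_emb J c = Re c *\<^sub>R 1 + Im c *\<^sub>R J"

lemma slice_pt_emb: "slice_pt J z = slice_emb J (to_complex z)"
  by (simp add: slice_pt_def slice_emb_def quat_eq_iff)

lemma im_unit_sq: "J \<in> im_units \<Longrightarrow> J * J = -1"
  by (simp add: im_units_def power2_eq_square)

lemma bounded_linear_slice_emb: "bounded_linear (slice_emb J)"
  unfolding slice_emb_def[abs_def]
  by (intro bounded_linear_add bounded_linear_compose[OF bounded_linear_scaleR_left] bounded_linear_Re bounded_linear_Im)

lemma slice_emb_simps [simp]:
  "slice_emb J 0 = 0" "slice_emb J 1 = 1" "slice_emb J \<i> = J" "slice_emb J (of_real x) = of_real x"
  "slice_emb J (c + d) = slice_emb J c + slice_emb J d" "slice_emb J (c - d) = slice_emb J c - slice_emb J d" "slice_emb J (- c) = - slice_emb J c"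
  by (simp_all add: slice_emb_def algebra_simps of_real_def)

lemma slice_emb_scaleR: "slice_emb J (r *\<^sub>R c) = r *\<^sub>R slice_emb J c"
  by (simp add: slice_emb_def algebra_simps)

lemma slice_emb_mult: "J \<in> im_units \<Longrightarrow> slice_emb J (x * y) = slice_emb J x * slice_emb J y"
  using im_unit_sq[of J] by (simp add: slice_emb_def algebra_simps)

lemma slice_emb_power: "J \<in> im_units \<Longrightarrow> slice_emb J (x ^ n) = slice_emb J x ^ n"
  by (induction n) (simp_all add: slice_emb_mult)

lemma slice_emb_cnj: "J \<in> im_units \<Longrightarrow> slice_emb J (cnj c) = qcnj (slice_emb J c)"
  by (simp add: slice_emb_def quat_eq_iff im_units_iff)

lemma slice_emb_commute: "J \<in> im_units \<Longrightarrow> slice_emb J x * slice_emb J y = slice_emb J y * slice_emb J x"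
  by (simp flip: slice_emb_mult add: mult.commute)

lemma norm_slice_emb: "J \<in> im_units \<Longrightarrow> norm (slice_emb J c) = norm c"
proof -
  assume J: "J \<in> im_units"
  then have 1: "qRe J = 0" "(qIm1 J)\<^sup>2 + (qIm2 J)\<^sup>2 + (qIm3 J)\<^sup>2 = 1"
    by (simp_all add: im_units_iff)
  have "(Im c * qIm1 J)\<^sup>2 + (Im c * qIm2 J)\<^sup>2 + (Im c * qIm3 J)\<^sup>2 = (Im c)\<^sup>2"
    using 1 by (simp add: power_mult_distrib flip: distrib_left)
  then show ?thesis
    using 1 by (simp add: slice_emb_def norm_quat_def cmod_def)
qed

lemma norm_slice_pt: "J \<in> im_units \<Longrightarrow> norm (slice_pt J z) = norm z"
  by (simp add: slice_pt_emb norm_slice_emb)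

lemma inner_mult_left_quat: "inner (a * q) b = inner q (qcnj a * b)" for a q b :: quat
  by (simp add: inner_quat_def algebra_simps)

lemma inner_mult_right_quat: "inner (q * a) b = inner q (b * qcnj a)" for a q b :: quat
  by (simp add: inner_quat_def algebra_simps)

lemma qcnj_im_unit: "J \<in> im_units \<Longrightarrow> qcnj J = - J"
  by (simp add: quat_eq_iff im_units_iff)

text \<open>
  A complex-valued coordinate of a quaternion for which left multiplication by \<open>J\<close> becomes multiplication by
  \<open>\<i>\<close>. The vector \<open>b\<close> is arbitrary so that no second unit orthogonal to \<open>J\<close> has to be chosen.
\<close>

definition slice_coord :: "quat \<Rightarrow> quat \<Rightarrow> quat \<Rightarrow> complex" where
  "slice_coord J b q = Complex (inner q b) (inner q (J * b))"

lemma slice_coord_altdef: "slice_coord J b q = of_real (inner q b) + \<i> * of_real (inner q (J * b))"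
  by (simp add: slice_coord_def complex_eq_iff)

lemma bounded_linear_slice_coord: "bounded_linear (slice_coord J b)"
  unfolding slice_coord_altdef[abs_def]
  by (intro bounded_linear_add bounded_linear_compose[OF bounded_linear_of_real bounded_linear_inner_left]
        bounded_linear_compose[OF bounded_linear_mult_right] bounded_linear_compose[OF bounded_linear_of_real bounded_linear_inner_left])

lemmas slice_coord_add = linear_add[OF bounded_linear.linear[OF bounded_linear_slice_coord]]
  and slice_coord_scaleR = linear_cmul[OF bounded_linear.linear[OF bounded_linear_slice_coord]]
  and slice_coord_zero = linear_0[OF bounded_linear.linear[OF bounded_linear_slice_coord]]

lemma slice_coord_unit_mult: "J \<in> im_units \<Longrightarrow> slice_coord J b (J * q) = \<i> * slice_coord J b q"
proof -
  assume J: "J \<in> im_units"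
  have "inner (J * q) (J * b) = inner q b"
    using im_units_mult_self[OF J, of b] by (simp add: inner_mult_left_quat qcnj_im_unit[OF J])
  then show ?thesis
    by (simp add: slice_coord_def inner_mult_left_quat[of J q b] qcnj_im_unit[OF J] complex_eq_iff)
qed

lemma slice_coord_emb_mult: "J \<in> im_units \<Longrightarrow> slice_coord J b (slice_emb J c * q) = c * slice_coord J b q"
  by (simp add: slice_emb_def distrib_right slice_coord_add slice_coord_scaleR slice_coord_unit_mult complex_eq_iff)

lemma slice_coord_mult_right: "slice_coord J b (q * a) = slice_coord J (b * qcnj a) q"
  by (simp add: slice_coord_def inner_mult_right_quat mult.assoc)

lemma norm_slice_coord_le: "norm (slice_coord J b q) \<le> (norm b + norm (J * b)) * norm q"
proof -
  have "norm (slice_coord J b q) \<le> \<bar>inner q b\<bar> + \<bar>inner q (J * b)\<bar>"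
    using cmod_le[of "slice_coord J b q"] by (simp add: slice_coord_def)
  also have "\<dots> \<le> norm q * norm b + norm q * norm (J * b)"
    by (intro add_mono Cauchy_Schwarz_ineq2)
  finally show ?thesis by (simp add: algebra_simps)
qed

text \<open>
  Expansion in the orthonormal basis gives \<open>q\<close> from the real parts of the coordinates, and \<open>J * (- J * q)\<close>,
  again \<open>q\<close>, from the imaginary parts.
\<close>

lemma slice_emb_slice_coord_sum:
  assumes J: "J \<in> im_units"
  shows "(\<Sum>b\<in>Basis. slice_emb J (slice_coord J b q) * b) = 2 *\<^sub>R q"
proof -
  have "(\<Sum>b\<in>Basis. slice_emb J (slice_coord J b q) * b) = (\<Sum>b\<in>Basis. inner q b *\<^sub>R b) + J * (\<Sum>b\<in>Basis. inner (- J * q) b *\<^sub>R b)"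
    unfolding inner_mult_left_quat[of "- J"]
    by (simp add: slice_emb_def slice_coord_def distrib_right sum.distrib sum_distrib_left qcnj_im_unit[OF im_units_uminus[OF J]])
  also have "\<dots> = 2 *\<^sub>R q"
    unfolding euclidean_representation by (simp add: im_units_mult_self[OF J] scaleR_2)
  finally show ?thesis .
qed

lemma slice_coord_eqI:
  assumes "\<And>b. slice_coord J b p = slice_coord J b q"
  shows "p = q"
proof (rule euclidean_eqI)
  show "inner p b = inner q b" for b using assms[of b] by (simp add: slice_coord_def)
qed

section \<open>Polyanalytic functions on one slice\<close>

lemma has_partial_x: "(\<lambda>t. h (t, y)) differentiable (at x) \<Longrightarrow> ((\<lambda>t. h (t, y)) has_vector_derivative partial_x h (x, y)) (at x)"
  by (simp add: partial_x_def vector_derivative_works)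

lemma has_partial_y: "(\<lambda>t. h (x, t)) differentiable (at y) \<Longrightarrow> ((\<lambda>t. h (x, t)) has_vector_derivative partial_y h (x, y)) (at y)"
  by (simp add: partial_y_def vector_derivative_works)

lemma partial_xI: "(\<And>x y. ((\<lambda>t. h (t, y)) has_vector_derivative d (x, y)) (at x)) \<Longrightarrow> partial_x h = d"
  by (auto simp: partial_x_def fun_eq_iff intro: vector_derivative_at)

lemma partial_yI: "(\<And>x y. ((\<lambda>t. h (x, t)) has_vector_derivative d (x, y)) (at y)) \<Longrightarrow> partial_y h = d"
  by (auto simp: partial_y_def fun_eq_iff intro: vector_derivative_at)

lemma differentiableI_hvd: "(f has_vector_derivative d) (at x) \<Longrightarrow> f differentiable (at x)"
  by (auto simp: has_vector_derivative_def differentiable_def)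

lemma C_class_SucI:
  assumes "continuous_on UNIV h"
    and "\<And>x y. ((\<lambda>t. h (t, y)) has_vector_derivative dx (x, y)) (at x)"
    and "\<And>x y. ((\<lambda>t. h (x, t)) has_vector_derivative dy (x, y)) (at y)"
    and "C_class k dx" "C_class k dy"
  shows "C_class (Suc k) h"
proof -
  have "(\<lambda>t. h (t, y)) differentiable (at x)" "(\<lambda>t. h (x, t)) differentiable (at y)" for x y
    using differentiableI_hvd[OF assms(2)] differentiableI_hvd[OF assms(3)] by blast+
  then show ?thesis
    using assms partial_xI[of h dx] partial_yI[of h dy] by simp
qed

lemma C_class_continuous: "C_class k h \<Longrightarrow> continuous_on UNIV h"
  by (cases k) auto

lemma C_class_SucD:
  assumes "C_class (Suc k) h"
  shows "((\<lambda>t. h (t, y)) has_vector_derivative partial_x h (x, y)) (at x)"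
    and "((\<lambda>t. h (x, t)) has_vector_derivative partial_y h (x, y)) (at y)"
    and "C_class k (partial_x h)" "C_class k (partial_y h)"
  using assms by (auto intro: has_partial_x has_partial_y)

lemma C_class_add: "C_class k f \<Longrightarrow> C_class k g \<Longrightarrow> C_class k (\<lambda>z. f z + g z)"
proof (induction k arbitrary: f g)
  case (Suc k)
  note f = C_class_SucD[OF Suc.prems(1)] and g = C_class_SucD[OF Suc.prems(2)]
  show ?case
    by (rule C_class_SucI[of _ "\<lambda>z. partial_x f z + partial_x g z" "\<lambda>z. partial_y f z + partial_y g z"])
       (intro continuous_on_add C_class_continuous[OF Suc.prems(1)] C_class_continuous[OF Suc.prems(2)]
          has_vector_derivative_add f g Suc.IH)+
qed (simp add: continuous_on_add)

lemma C_class_bounded_linear: "bounded_linear A \<Longrightarrow> C_class k f \<Longrightarrow> C_class k (\<lambda>z. A (f z))"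
proof (induction k arbitrary: f)
  case (Suc k)
  note A = Suc.prems(1) and f = C_class_SucD[OF Suc.prems(2)]
  show ?case
    by (rule C_class_SucI[of _ "\<lambda>z. A (partial_x f z)" "\<lambda>z. A (partial_y f z)"])
       (intro bounded_linear.continuous_on[OF A] C_class_continuous[OF Suc.prems(2)]
          bounded_linear.has_vector_derivative[OF A] f Suc.IH[OF A])+
qed (simp add: bounded_linear.continuous_on)

lemma slice_dbar_C_class: "C_class (Suc k) f \<Longrightarrow> C_class k (slice_dbar J f)"
  unfolding slice_dbar_def[abs_def]
  by (intro C_class_add C_class_bounded_linear[of "\<lambda>q. J * q"] bounded_linear_mult_right C_class_SucD)

lemma slice_dbar_add: "C_class (Suc k) f \<Longrightarrow> C_class (Suc k) g \<Longrightarrow>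
    slice_dbar J (\<lambda>z. f z + g z) = (\<lambda>z. slice_dbar J f z + slice_dbar J g z)"
  unfolding slice_dbar_def[abs_def]
  by (subst partial_xI[of _ "\<lambda>z. partial_x f z + partial_x g z"], intro has_vector_derivative_add C_class_SucD(1), assumption+,
      subst partial_yI[of _ "\<lambda>z. partial_y f z + partial_y g z"], intro has_vector_derivative_add C_class_SucD(2), assumption+)
     (simp add: algebra_simps)

lemma slice_dbar_mult_right: "C_class (Suc k) f \<Longrightarrow> slice_dbar J (\<lambda>z. f z * a) = (\<lambda>z. slice_dbar J f z * a)"
  unfolding slice_dbar_def[abs_def]
  by (subst partial_xI[of _ "\<lambda>z. partial_x f z * a"], rule bounded_linear.has_vector_derivative[OF bounded_linear_mult_left], erule C_class_SucD(1),
      subst partial_yI[of _ "\<lambda>z. partial_y f z * a"], rule bounded_linear.has_vector_derivative[OF bounded_linear_mult_left], erule C_class_SucD(2))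
     (simp add: algebra_simps)

definition quat_polyanalytic :: "quat \<Rightarrow> nat \<Rightarrow> (real \<times> real \<Rightarrow> quat) \<Rightarrow> bool" where
  "quat_polyanalytic J N g \<longleftrightarrow> C_class N g \<and> (\<forall>z. (slice_dbar J ^^ N) g z = 0)"

lemma slice_dbar_zero: "slice_dbar J (\<lambda>_. 0) = (\<lambda>_. 0)"
  by (simp add: slice_dbar_def[abs_def] partial_x_def partial_y_def)

lemma funpow_slice_dbar_zero: "(slice_dbar J ^^ N) (\<lambda>_. 0) = (\<lambda>_. 0)"
  by (induction N) (simp_all add: slice_dbar_zero)

lemma C_class_zero: "C_class k (\<lambda>_. 0)"
proof (induction k)
  case (Suc k)
  show ?case by (rule C_class_SucI[OF _ _ _ Suc Suc]) auto
qed auto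

lemma quat_polyanalytic_zero: "quat_polyanalytic J N (\<lambda>_. 0)"
  by (simp add: quat_polyanalytic_def C_class_zero funpow_slice_dbar_zero)

lemma quat_polyanalytic_Suc: "quat_polyanalytic J (Suc N) g \<Longrightarrow> quat_polyanalytic J N (slice_dbar J g)"
  by (auto simp: quat_polyanalytic_def funpow_Suc_right slice_dbar_C_class simp del: funpow.simps C_class.simps)

lemma quat_polyanalytic_SucI: "C_class (Suc N) g \<Longrightarrow> quat_polyanalytic J N (slice_dbar J g) \<Longrightarrow> quat_polyanalytic J (Suc N) g"
  by (auto simp: quat_polyanalytic_def funpow_Suc_right simp del: funpow.simps C_class.simps)

lemma quat_polyanalytic_add:
  "quat_polyanalytic J N f \<Longrightarrow> quat_polyanalytic J N g \<Longrightarrow> quat_polyanalytic J N (\<lambda>z. f z + g z)"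
proof (induction N arbitrary: f g)
  case 0
  then show ?case by (auto simp: quat_polyanalytic_def intro: continuous_intros)
next
  case (Suc N)
  then have C: "C_class (Suc N) f" "C_class (Suc N) g" by (auto simp: quat_polyanalytic_def)
  show ?case
    by (rule quat_polyanalytic_SucI) (use Suc C in \<open>auto simp: slice_dbar_add[OF C] simp del: C_class.simps intro: C_class_add quat_polyanalytic_Suc\<close>)
qed

lemma quat_polyanalytic_mult_right:
  "quat_polyanalytic J N f \<Longrightarrow> quat_polyanalytic J N (\<lambda>z. f z * a)"
proof (induction N arbitrary: f)
  case 0
  then show ?case by (auto simp: quat_polyanalytic_def intro: continuous_intros)
next
  case (Suc N)
  then have C: "C_class (Suc N) f" by (auto simp: quat_polyanalytic_def)
  show ?case
    by (rule quat_polyanalytic_SucI)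
       (use Suc C in \<open>auto simp: slice_dbar_mult_right[OF C] simp del: C_class.simps
          intro: C_class_bounded_linear[OF bounded_linear_mult_left] quat_polyanalytic_Suc\<close>)
qed

lemma quat_polyanalytic_sum:
  "(\<And>i. i \<in> A \<Longrightarrow> quat_polyanalytic J N (f i)) \<Longrightarrow> quat_polyanalytic J N (\<lambda>z. \<Sum>i\<in>A. f i z)"
  by (induction A rule: infinite_finite_induct) (auto intro: quat_polyanalytic_zero quat_polyanalytic_add)

lemma entire_has_field_derivative:
  "h holomorphic_on UNIV \<Longrightarrow> (h has_field_derivative deriv h z) (at z)"
  by (auto intro: holomorphic_derivI)

text \<open>
  The Wirtinger derivatives of \<open>G\<close> with respect to \<open>cnj z\<close> and \<open>z\<close> are \<open>P\<close> and \<open>Q\<close>.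
\<close>

lemma monom_partials:
  fixes h :: "complex \<Rightarrow> complex" and j :: nat
  assumes h: "h holomorphic_on UNIV"
  defines "G \<equiv> \<lambda>z. cnj (to_complex z) ^ j * h (to_complex z)"
    and "P \<equiv> \<lambda>z. of_nat j * cnj (to_complex z) ^ (j - 1) * h (to_complex z)"
    and "Q \<equiv> \<lambda>z. cnj (to_complex z) ^ j * deriv h (to_complex z)"
  shows "((\<lambda>t. G (t, y)) has_vector_derivative P (x, y) + Q (x, y)) (at x)"
    and "((\<lambda>t. G (x, t)) has_vector_derivative \<i> * (Q (x, y) - P (x, y))) (at y)"
proof -
  have d: "((\<lambda>t. cnj (c t) ^ j * h (c t)) has_vector_derivative
       (of_nat j * cnj d * cnj (c s) ^ (j - 1) * h (c s) + cnj (c s) ^ j * (d * deriv h (c s)))) (at s)"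
    if c: "(c has_vector_derivative d) (at s)" for c :: "real \<Rightarrow> complex" and d s
  proof -
    have 1: "((\<lambda>t. cnj (c t)) has_vector_derivative cnj d) (at s)"
      by (rule bounded_linear.has_vector_derivative[OF bounded_linear_cnj c])
    have 2: "((\<lambda>t. cnj (c t) ^ j) has_vector_derivative (cnj d * (of_nat j * cnj (c s) ^ (j - 1)))) (at s)"
    proof -
      have "((\<lambda>z. z ^ j) has_field_derivative (of_nat j * cnj (c s) ^ (j - 1))) (at (cnj (c s)))"
        by (auto intro!: derivative_eq_intros)
      from field_vector_diff_chain_at[OF 1 this] show ?thesis by (simp add: comp_def)
    qed
    have 3: "((\<lambda>t. h (c t)) has_vector_derivative (d * deriv h (c s))) (at s)"
      using field_vector_diff_chain_at[OF c entire_has_field_derivative[OF h]] by (simp add: comp_def)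
    show ?thesis
      using has_vector_derivative_mult[OF 2 3] by (simp add: algebra_simps)
  qed
  have x: "((\<lambda>t. to_complex (t, y)) has_vector_derivative 1) (at x)"
    unfolding to_complex_altdef by (auto intro!: derivative_eq_intros)
  have y: "((\<lambda>t. to_complex (x, t)) has_vector_derivative \<i>) (at y)"
    unfolding to_complex_altdef by (auto intro!: derivative_eq_intros)
  show "((\<lambda>t. G (t, y)) has_vector_derivative P (x, y) + Q (x, y)) (at x)"
    using d[OF x] by (simp add: G_def P_def Q_def)
  show "((\<lambda>t. G (x, t)) has_vector_derivative \<i> * (Q (x, y) - P (x, y))) (at y)"
    using d[OF y] by (simp add: G_def P_def Q_def algebra_simps)
qed

lemma C_class_monom:
  assumes "h holomorphic_on UNIV"
  shows "C_class k (\<lambda>z. slice_emb J (cnj (to_complex z) ^ j * h (to_complex z)))"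
  using assms
proof (induction k arbitrary: j h)
  case 0
  have "continuous_on UNIV h" using 0 by (rule holomorphic_on_imp_continuous_on)
  then show ?case
    by (auto intro!: bounded_linear.continuous_on[OF bounded_linear_slice_emb] continuous_intros continuous_on_compose2[OF \<open>continuous_on UNIV h\<close>])
next
  case (Suc k)
  note p = monom_partials[OF Suc.prems, where j=j]
  have C: "C_class k (\<lambda>z. slice_emb J (cnj (to_complex z) ^ i * g (to_complex z)))" if "g holomorphic_on UNIV" for g i
    using Suc.IH that by blast
  have d: "deriv h holomorphic_on UNIV" using Suc.prems by (intro holomorphic_deriv) auto
  have h: "continuous_on UNIV h" using Suc.prems by (rule holomorphic_on_imp_continuous_on)
  show ?case
  proof (rule C_class_SucI[OF _ bounded_linear.has_vector_derivative[OF bounded_linear_slice_emb p(1)]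
        bounded_linear.has_vector_derivative[OF bounded_linear_slice_emb p(2)]])
    show "continuous_on UNIV (\<lambda>z. slice_emb J (cnj (to_complex z) ^ j * h (to_complex z)))"
      by (auto intro!: bounded_linear.continuous_on[OF bounded_linear_slice_emb] continuous_intros continuous_on_compose2[OF h])
    have hol: "(\<lambda>z. of_nat j * h z) holomorphic_on UNIV" "(\<lambda>z. - \<i> * of_nat j * h z) holomorphic_on UNIV"
      "(\<lambda>z. \<i> * deriv h z) holomorphic_on UNIV"
      using Suc.prems d by (auto intro!: holomorphic_on_mult holomorphic_on_minus)
    have "C_class k (\<lambda>z. slice_emb J (cnj (to_complex z) ^ (j - 1) * (of_nat j * h (to_complex z))) + slice_emb J (cnj (to_complex z) ^ j * deriv h (to_complex z)))"
      by (intro C_class_add C[OF hol(1)] C[OF d])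
    then show "C_class k (\<lambda>z. slice_emb J (of_nat j * cnj (to_complex z) ^ (j - 1) * h (to_complex z) + cnj (to_complex z) ^ j * deriv h (to_complex z)))"
      by (simp only: slice_emb_simps mult_ac)
    have "C_class k (\<lambda>z. slice_emb J (cnj (to_complex z) ^ (j - 1) * (- \<i> * of_nat j * h (to_complex z))) + slice_emb J (cnj (to_complex z) ^ j * (\<i> * deriv h (to_complex z))))"
      by (intro C_class_add C[OF hol(2)] C[OF hol(3)])
    moreover have "\<i> * (a * d - n * b * c) = b * (- \<i> * n * c) + a * (\<i> * d)" for a b c d n :: complex
      by (simp add: algebra_simps)
    ultimately show "C_class k (\<lambda>z. slice_emb J (\<i> * (cnj (to_complex z) ^ j * deriv h (to_complex z) - of_nat j * cnj (to_complex z) ^ (j - 1) * h (to_complex z))))"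
      by (simp only: slice_emb_simps)
  qed
qed

text \<open>
  The operator lowers the exponent of \<open>cnj z\<close> by one and multiplies by \<open>2 * j\<close>, so \<open>j + 1 \<le> N\<close> applications
  annihilate the function.
\<close>

lemma quat_polyanalytic_monom:
  assumes J: "J \<in> im_units" and "j < N" and "h holomorphic_on UNIV"
  shows "quat_polyanalytic J N (\<lambda>z. slice_emb J (cnj (to_complex z) ^ j * h (to_complex z)))"
  using assms(2,3)
proof (induction N arbitrary: j h)
  case (Suc N)
  let ?g = "\<lambda>z. slice_emb J (cnj (to_complex z) ^ j * h (to_complex z))"
  note p = monom_partials[OF Suc.prems(2), where j=j]
  have px: "partial_x ?g = (\<lambda>z. slice_emb J (of_nat j * cnj (to_complex z) ^ (j - 1) * h (to_complex z) + cnj (to_complex z) ^ j * deriv h (to_complex z)))"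
    by (rule partial_xI) (rule bounded_linear.has_vector_derivative[OF bounded_linear_slice_emb p(1)])
  have py: "partial_y ?g = (\<lambda>z. slice_emb J (\<i> * (cnj (to_complex z) ^ j * deriv h (to_complex z) - of_nat j * cnj (to_complex z) ^ (j - 1) * h (to_complex z))))"
    by (rule partial_yI) (rule bounded_linear.has_vector_derivative[OF bounded_linear_slice_emb p(2)])
  have e: "slice_emb J (p + q) + J * slice_emb J (\<i> * (q - p)) = slice_emb J (2 * p)" for p q
    by (simp only: slice_emb_mult[OF J, of \<i>] slice_emb_simps im_units_mult_self[OF J] mult_2) simp
  have "slice_dbar J ?g = (\<lambda>z. slice_emb J (cnj (to_complex z) ^ (j - 1) * (2 * of_nat j * h (to_complex z))))"
    unfolding slice_dbar_def[abs_def] px py e by (simp add: mult_ac)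
  moreover have "quat_polyanalytic J N (\<lambda>z. slice_emb J (cnj (to_complex z) ^ (j - 1) * (2 * of_nat j * h (to_complex z))))"
  proof (cases "j = 0")
    case True
    then show ?thesis by (simp add: quat_polyanalytic_zero)
  next
    case False
    then show ?thesis
      using Suc.prems by (intro Suc.IH[of "j - 1" "\<lambda>z. 2 * of_nat j * h z"] holomorphic_intros) auto
  qed
  ultimately show ?case
    using C_class_monom[OF Suc.prems(2)] by (intro quat_polyanalytic_SucI) auto
qed simp

lemma quat_polyanalytic_slice_emb:
  assumes J: "J \<in> im_units" and F: "polyentire N F"
  shows "quat_polyanalytic J N (\<lambda>z. slice_emb J (F (to_complex z)) * b)"
proof -
  obtain h where h: "\<forall>j<N. h j holomorphic_on UNIV" and F: "F = (\<lambda>z. \<Sum>j<N. cnj z ^ j * h j z)"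
    using F unfolding polyentire_def by blast
  have "quat_polyanalytic J N (\<lambda>z. \<Sum>j<N. slice_emb J (cnj (to_complex z) ^ j * h j (to_complex z)))"
    using h J by (intro quat_polyanalytic_sum quat_polyanalytic_monom) auto
  then have "quat_polyanalytic J N (\<lambda>z. slice_emb J (F (to_complex z)))"
    unfolding F by (simp only: linear_sum[OF bounded_linear.linear[OF bounded_linear_slice_emb]])
  then show ?thesis by (rule quat_polyanalytic_mult_right)
qed

text \<open>
  Raising each exponent of \<open>cnj z\<close> by one and dividing by twice the new exponent yields a polyentire solution
  \<open>S\<close> of the same inhomogeneous equation. The difference \<open>f - S\<close> then satisfies the Cauchy-Riemann equations,
  hence is entire.
\<close>

lemma polyentire_of_dbar:
  fixes f a b :: "real \<times> real \<Rightarrow> complex"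
  assumes fx: "\<And>x y. ((\<lambda>t. f (t, y)) has_vector_derivative a (x, y)) (at x)"
    and fy: "\<And>x y. ((\<lambda>t. f (x, t)) has_vector_derivative b (x, y)) (at y)"
    and b: "continuous_on UNIV b"
    and dbar: "polyentire N (\<lambda>\<zeta>. a (Re \<zeta>, Im \<zeta>) + \<i> * b (Re \<zeta>, Im \<zeta>))"
  shows "polyentire (Suc N) (\<lambda>\<zeta>. f (Re \<zeta>, Im \<zeta>))"
proof -
  obtain h where h: "\<forall>j<N. h j holomorphic_on UNIV"
    and eq: "(\<lambda>\<zeta>. a (Re \<zeta>, Im \<zeta>) + \<i> * b (Re \<zeta>, Im \<zeta>)) = (\<lambda>z. \<Sum>j<N. cnj z ^ j * h j z)"
    using dbar unfolding polyentire_def by blast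
  have der_f: "((\<lambda>p. f p) has_derivative (\<lambda>v. fst v *\<^sub>R a (x, y) + snd v *\<^sub>R b (x, y))) (at (x, y))" for x y
  proof -
    have "((\<lambda>(x, y). f (x, y)) has_derivative (\<lambda>(tx, ty). tx *\<^sub>R a (x, y) + blinfun_apply (blinfun_scaleR_left (b (x, y))) ty))
       (at (x, y) within UNIV \<times> UNIV)"
    proof (rule has_derivative_partialsI)
      show "((\<lambda>x. f (x, y)) has_derivative (\<lambda>tx. tx *\<^sub>R a (x, y))) (at x within UNIV)"
        using fx[of y x] by (simp add: has_vector_derivative_def)
      show "((\<lambda>y. f (x, y)) has_derivative blinfun_apply (blinfun_scaleR_left (b (x, y)))) (at y within UNIV)" for x y
        using fy[of x y] by (simp add: has_vector_derivative_def)
      have "continuous_on UNIV (\<lambda>p. blinfun_scaleR_left (b p))"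
        by (rule bounded_linear.continuous_on[OF bounded_linear_blinfun_scaleR_left b])
      then show "continuous (at (x, y) within UNIV \<times> UNIV) (\<lambda>(x, y). blinfun_scaleR_left (b (x, y)))"
        by (simp add: continuous_on_eq_continuous_within case_prod_beta')
    qed auto
    then show ?thesis by (simp add: case_prod_beta')
  qed
  let ?F = "\<lambda>\<zeta>. f (Re \<zeta>, Im \<zeta>)"
  define S where "S \<zeta> = (\<Sum>j<N. cnj \<zeta> ^ Suc j * (h j \<zeta> / (2 * of_nat (Suc j))))" for \<zeta>
  have "(\<lambda>\<zeta>. ?F \<zeta> - S \<zeta>) holomorphic_on UNIV"
  proof (rule holomorphic_onI)
    fix \<zeta> :: complex
    let ?a = "a (Re \<zeta>, Im \<zeta>)" and ?b = "b (Re \<zeta>, Im \<zeta>)"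
    \<comment> \<open>The holomorphic Wirtinger derivative of \<open>S\<close> at \<open>\<zeta>\<close>.\<close>
    define d where "d = (\<Sum>j<N. cnj \<zeta> ^ Suc j * (deriv (h j) \<zeta> / (2 * of_nat (Suc j))))"
    have F: "(?F has_derivative (\<lambda>v. Re v *\<^sub>R ?a + Im v *\<^sub>R ?b)) (at \<zeta>)"
    proof -
      have "((\<lambda>\<zeta>. (Re \<zeta>, Im \<zeta>)) has_derivative (\<lambda>v. (Re v, Im v))) (at \<zeta>)"
        by (intro has_derivative_Pair bounded_linear.has_derivative[OF bounded_linear_Re]
              bounded_linear.has_derivative[OF bounded_linear_Im] has_derivative_ident)
      from has_derivative_compose[OF this der_f] show ?thesis by simp
    qed
    have S: "(S has_derivative (\<lambda>v. d * v + (?a + \<i> * ?b) / 2 * cnj v)) (at \<zeta>)"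
    proof -
      have mono: "((\<lambda>\<zeta>. cnj \<zeta> ^ Suc j * (h j \<zeta> / (2 * of_nat (Suc j)))) has_derivative
          (\<lambda>v. cnj \<zeta> ^ Suc j * (deriv (h j) \<zeta> / (2 * of_nat (Suc j))) * v + cnj \<zeta> ^ j * h j \<zeta> / 2 * cnj v)) (at \<zeta>)"
        if "j < N" for j
      proof -
        have 1: "(h j has_derivative (\<lambda>v. deriv (h j) \<zeta> * v)) (at \<zeta>)"
          using entire_has_field_derivative[of "h j" \<zeta>] h that by (simp add: has_field_derivative_def)
        have 2: "((\<lambda>\<zeta>. cnj \<zeta>) has_derivative (\<lambda>v. cnj v)) (at \<zeta>)"
          by (rule bounded_linear_imp_has_derivative[OF bounded_linear_cnj])
        have 3: "((\<lambda>\<zeta>. cnj \<zeta> ^ Suc j) has_derivative (\<lambda>v. of_nat (Suc j) * cnj v * cnj \<zeta> ^ j)) (at \<zeta>)"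
          using has_derivative_power[OF 2, of "Suc j"] by (simp only: diff_Suc_1)
        have 4: "((\<lambda>\<zeta>. h j \<zeta> / (2 * of_nat (Suc j))) has_derivative (\<lambda>v. deriv (h j) \<zeta> * v / (2 * of_nat (Suc j)))) (at \<zeta>)"
          using bounded_linear.has_derivative[OF bounded_linear_divide 1] .
        have n: "of_nat (Suc j) \<noteq> (0 :: complex)" by (simp del: of_nat_Suc)
        have e: "A * (D * v / (2 * m)) + m * w * B * (H / (2 * m)) = A * (D / (2 * m)) * v + B * H / 2 * w"
          if "m \<noteq> 0" for A B D H v w m :: complex
          using that by (simp add: field_simps)
        show ?thesis
          using has_derivative_mult[OF 3 4] unfolding e[OF n] .
      qed
      have "(S has_derivative (\<lambda>v. \<Sum>j<N. cnj \<zeta> ^ Suc j * (deriv (h j) \<zeta> / (2 * of_nat (Suc j))) * v + cnj \<zeta> ^ j * h j \<zeta> / 2 * cnj v)) (at \<zeta>)"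
        unfolding S_def[abs_def] by (rule has_derivative_sum) (rule mono, simp)
      moreover have "(\<Sum>j<N. cnj \<zeta> ^ Suc j * (deriv (h j) \<zeta> / (2 * of_nat (Suc j))) * v + cnj \<zeta> ^ j * h j \<zeta> / 2 * cnj v)
          = d * v + (?a + \<i> * ?b) / 2 * cnj v" for v
        using fun_cong[OF eq, of \<zeta>]
        by (simp only: sum.distrib d_def sum_distrib_right sum_divide_distrib)
      ultimately show ?thesis by simp
    qed
    have "(\<lambda>v. (Re v *\<^sub>R ?a + Im v *\<^sub>R ?b) - (d * v + (?a + \<i> * ?b) / 2 * cnj v)) = (*) ((?a - \<i> * ?b) / 2 - d)"
    proof
      fix v :: complex
      \<comment> \<open>A real linear map of the plane split into its complex linear and antilinear parts; the
        antilinear parts of \<open>f\<close> and \<open>S\<close> cancel.\<close>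
      have "Re v *\<^sub>R ?a + Im v *\<^sub>R ?b = (?a - \<i> * ?b) / 2 * v + (?a + \<i> * ?b) / 2 * cnj v"
        by (simp add: complex_eq_iff field_simps)
      then show "(Re v *\<^sub>R ?a + Im v *\<^sub>R ?b) - (d * v + (?a + \<i> * ?b) / 2 * cnj v) = ((?a - \<i> * ?b) / 2 - d) * v"
        by (simp add: algebra_simps)
    qed
    then have "((\<lambda>\<zeta>. ?F \<zeta> - S \<zeta>) has_field_derivative ((?a - \<i> * ?b) / 2 - d)) (at \<zeta>)"
      using has_derivative_diff[OF F S] by (simp add: has_field_derivative_def)
    then show "(\<lambda>\<zeta>. ?F \<zeta> - S \<zeta>) field_differentiable (at \<zeta> within UNIV)"
      by (auto simp: field_differentiable_def)
  qed
  then have "polyentire (Suc N) (\<lambda>\<zeta>. cnj \<zeta> ^ 0 * (?F \<zeta> - S \<zeta>))"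
    by (intro polyentire_monom) auto
  moreover have "polyentire (Suc N) S"
    unfolding S_def[abs_def] using h by (intro polyentire_sum polyentire_monom holomorphic_intros) auto
  ultimately have "polyentire (Suc N) (\<lambda>\<zeta>. cnj \<zeta> ^ 0 * (?F \<zeta> - S \<zeta>) + S \<zeta>)"
    by (rule polyentire_add)
  then show ?thesis by simp
qed

text \<open>
  Applying the operator to \<open>g\<close> once lowers the order, and \<open>polyentire_of_dbar\<close> undoes this step for the coordinates
  of \<open>g\<close>. Peeling off the innermost operator, rather than the outermost, lets the order of differentiability drop
  together with the order of the equation.
\<close>

lemma quat_polyanalytic_imp_polyentire:
  assumes J: "J \<in> im_units"
  shows "quat_polyanalytic J N g \<Longrightarrow> polyentire N (\<lambda>\<zeta>. slice_coord J b (g (Re \<zeta>, Im \<zeta>)))"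
proof (induction N arbitrary: g)
  case 0
  then show ?case by (simp add: quat_polyanalytic_def slice_coord_zero polyentire_zero)
next
  case (Suc N)
  then have C: "C_class (Suc N) g" by (auto simp: quat_polyanalytic_def)
  have "polyentire N (\<lambda>\<zeta>. slice_coord J b (slice_dbar J g (Re \<zeta>, Im \<zeta>)))"
    using Suc.prems by (intro Suc.IH quat_polyanalytic_Suc)
  then have "polyentire N (\<lambda>\<zeta>. slice_coord J b (partial_x g (Re \<zeta>, Im \<zeta>)) + \<i> * slice_coord J b (partial_y g (Re \<zeta>, Im \<zeta>)))"
    by (simp add: slice_dbar_def slice_coord_add slice_coord_unit_mult[OF J])
  moreover have "continuous_on UNIV (\<lambda>z. slice_coord J b (partial_y g z))"
    by (rule bounded_linear.continuous_on[OF bounded_linear_slice_coord C_class_continuous[OF C_class_SucD(4)[OF C]]])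
  ultimately show ?case
    by (intro polyentire_of_dbar[of "\<lambda>z. slice_coord J b (g z)" "\<lambda>z. slice_coord J b (partial_x g z)" "\<lambda>z. slice_coord J b (partial_y g z)"]
          bounded_linear.has_vector_derivative[OF bounded_linear_slice_coord] C_class_SucD[OF C]) auto
qed

section \<open>Slice functions and their restrictions to a slice\<close>

definition is_slice :: "(quat \<Rightarrow> quat) \<Rightarrow> bool" where
  "is_slice f \<longleftrightarrow> (\<exists>\<alpha> \<beta>. slice_stem \<alpha> \<beta> f)"

lemma slice_stem_slice_emb:
  assumes "slice_stem \<alpha> \<beta> f" "J \<in> im_units"
  shows "f (slice_emb J c) = \<alpha> (Re c, Im c) + J * \<beta> (Re c, Im c)"
    and "f (slice_emb J (cnj c)) = \<alpha> (Re c, Im c) - J * \<beta> (Re c, Im c)"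
proof -
  have 1: "slice_emb J c = slice_pt J (Re c, Im c)"
    by (simp add: slice_pt_emb)
  have 2: "slice_emb J (cnj c) = slice_pt J (Re c, - Im c)"
    by (simp add: slice_pt_def slice_emb_def of_real_def)
  show "f (slice_emb J c) = \<alpha> (Re c, Im c) + J * \<beta> (Re c, Im c)"
    unfolding 1 using assms by (auto simp: slice_stem_def)
  show "f (slice_emb J (cnj c)) = \<alpha> (Re c, Im c) - J * \<beta> (Re c, Im c)"
    unfolding 2 using assms by (auto simp: slice_stem_def)
qed

text \<open>
  Solving the two equations on the slice of \<open>I\<close> for the stem gives the formula, and conversely the formula
  exhibits a stem. As a characterization it is linear and stable under pointwise limits, so that stems need not
  be mentioned again in those arguments.
\<close>

lemma slice_representation:
  assumes I: "I \<in> im_units"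
  shows "is_slice f \<longleftrightarrow> (\<forall>J\<in>im_units. \<forall>c. f (slice_emb J c)
     = (1 / 2) *\<^sub>R ((1 - J * I) * f (slice_emb I c) + (1 + J * I) * f (slice_emb I (cnj c))))"
proof
  assume "is_slice f"
  then obtain \<alpha> \<beta> where s: "slice_stem \<alpha> \<beta> f" by (auto simp: is_slice_def)
  have e: "(1 - J * I) * (p + I * q) + (1 + J * I) * (p - I * q) = 2 *\<^sub>R (p + J * q)" for J p q
  proof -
    have "(1 - J * I) * (p + I * q) + (1 + J * I) * (p - I * q) = p + p - J * (I * (I * q)) - J * (I * (I * q))"
      by (simp add: algebra_simps)
    then show ?thesis by (simp add: im_units_mult_self[OF I] scaleR_2)
  qed
  show "\<forall>J\<in>im_units. \<forall>c. f (slice_emb J c) = (1 / 2) *\<^sub>R ((1 - J * I) * f (slice_emb I c) + (1 + J * I) * f (slice_emb I (cnj c)))"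
  proof (intro ballI allI)
    fix J c assume J: "J \<in> im_units"
    show "f (slice_emb J c) = (1 / 2) *\<^sub>R ((1 - J * I) * f (slice_emb I c) + (1 + J * I) * f (slice_emb I (cnj c)))"
      unfolding slice_stem_slice_emb(2)[OF s I, of c] slice_stem_slice_emb(1)[OF s I, of c] slice_stem_slice_emb(1)[OF s J] e by simp
  qed
next
  assume rep: "\<forall>J\<in>im_units. \<forall>c. f (slice_emb J c) = (1 / 2) *\<^sub>R ((1 - J * I) * f (slice_emb I c) + (1 + J * I) * f (slice_emb I (cnj c)))"
  define \<alpha> where "\<alpha> z = (1 / 2) *\<^sub>R (f (slice_emb I (to_complex z)) + f (slice_emb I (cnj (to_complex z))))" for z
  define \<beta> where "\<beta> z = (1 / 2) *\<^sub>R (I * (f (slice_emb I (cnj (to_complex z))) - f (slice_emb I (to_complex z))))" for z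
  have "slice_stem \<alpha> \<beta> f"
    unfolding slice_stem_def
  proof (intro conjI allI ballI)
    fix x y
    have c: "Complex x (- y) = cnj (Complex x y)" by (simp add: complex_eq_iff)
    show "\<alpha> (x, - y) = \<alpha> (x, y)"
      unfolding \<alpha>_def to_complex_simps c complex_cnj_cnj by (simp only: add.commute)
    show "\<beta> (x, - y) = - \<beta> (x, y)"
      unfolding \<beta>_def to_complex_simps c complex_cnj_cnj by (simp add: algebra_simps)
    fix J assume "J \<in> im_units"
    then show "f (slice_pt J (x, y)) = \<alpha> (x, y) + J * \<beta> (x, y)"
      unfolding slice_pt_emb using rep by (simp add: \<alpha>_def \<beta>_def algebra_simps)
  qed
  then show "is_slice f" by (auto simp: is_slice_def)
qed

lemma slice_emb_surj: "\<exists>J\<in>im_units. \<exists>c. q = slice_emb J c"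
  using slice_pt_surj[of q] by (auto simp: slice_pt_emb)

lemma slice_identity:
  assumes "I \<in> im_units" "is_slice f" "is_slice g" "\<And>c. f (slice_emb I c) = g (slice_emb I c)"
  shows "f = g"
proof
  fix q
  obtain J c where "J \<in> im_units" "q = slice_emb J c" using slice_emb_surj by blast
  then show "f q = g q"
    using assms(2,3) assms(4)[of c] assms(4)[of "cnj c"] unfolding slice_representation[OF assms(1)] by simp
qed

lemma is_slice_add: "is_slice f \<Longrightarrow> is_slice g \<Longrightarrow> is_slice (\<lambda>q. f q + g q)"
  unfolding slice_representation[OF im_units_nonempty]
  by (auto simp: distrib_left scaleR_add_right)

lemma is_slice_mult_right: "is_slice f \<Longrightarrow> is_slice (\<lambda>q. f q * a)"
  unfolding slice_representation[OF im_units_nonempty]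
  by (auto simp: distrib_right mult.assoc)

lemma is_slice_const: "is_slice (\<lambda>_. a)"
  unfolding is_slice_def slice_stem_def by (intro exI[of _ "\<lambda>_. a"] exI[of _ "\<lambda>_. 0"]) auto

lemma is_slice_sum: "(\<And>i. i \<in> A \<Longrightarrow> is_slice (f i)) \<Longrightarrow> is_slice (\<lambda>q. \<Sum>i\<in>A. f i q)"
  by (induction A rule: infinite_finite_induct) (auto intro: is_slice_const is_slice_add)

lemma is_slice_scaleR: "is_slice f \<Longrightarrow> is_slice (\<lambda>q. r *\<^sub>R f q)"
  using is_slice_mult_right[of f "of_real r"] by (simp add: of_real_def)

text \<open>
  The factors of the representation formula map one slice into another: \<open>1 - J * I\<close> replaces \<open>I\<close> by \<open>J\<close>, and
  \<open>1 + J * I\<close> replaces \<open>I\<close> by \<open>- J\<close>, which amounts to a conjugation.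
\<close>

lemma unit_intertwine:
  assumes I: "I \<in> im_units" and J: "J \<in> im_units"
  shows "(1 - J * I) * slice_emb I c = slice_emb J c * (1 - J * I)"
    and "(1 + J * I) * slice_emb I c = slice_emb J (cnj c) * (1 + J * I)"
  using im_unit_sq[OF I] im_units_mult_self[OF J]
  by (simp_all add: slice_emb_def algebra_simps)

text \<open>
  The definition asks for the differential equation on every slice and for smoothness of the stem. Both follow
  from one slice: by the representation formula and \<open>unit_intertwine\<close>, the restriction to the slice of \<open>J\<close> is
  a sum of polyentire functions with values in that slice, multiplied by constants from the right.
\<close>

lemma slice_polyanalytic_iff:
  assumes I: "I \<in> im_units"
  shows "slice_polyanalytic N f \<longleftrightarrow> is_slice f \<and> (\<forall>b. polyentire N (\<lambda>c. slice_coord I b (f (slice_emb I c))))"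
proof
  assume "slice_polyanalytic N f"
  then obtain \<alpha> \<beta> where s: "slice_stem \<alpha> \<beta> f" and C: "C_class N \<alpha>" "C_class N \<beta>"
    and d: "\<And>z. (1 / 2 ^ N) *\<^sub>R (slice_dbar I ^^ N) (\<lambda>w. \<alpha> w + I * \<beta> w) z = 0"
    using I unfolding slice_polyanalytic_def by blast
  have "quat_polyanalytic I N (\<lambda>w. \<alpha> w + I * \<beta> w)"
    unfolding quat_polyanalytic_def
    using d C by (intro conjI C_class_add C_class_bounded_linear[of "\<lambda>q. I * q"] bounded_linear_mult_right) auto
  from quat_polyanalytic_imp_polyentire[OF I this]
  show "is_slice f \<and> (\<forall>b. polyentire N (\<lambda>c. slice_coord I b (f (slice_emb I c))))"
    using s by (auto simp: is_slice_def slice_stem_slice_emb(1)[OF s I])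
next
  assume *: "is_slice f \<and> (\<forall>b. polyentire N (\<lambda>c. slice_coord I b (f (slice_emb I c))))"
  then obtain \<alpha> \<beta> where s: "slice_stem \<alpha> \<beta> f" by (auto simp: is_slice_def)
  have QP: "quat_polyanalytic J N (\<lambda>z. \<alpha> z + J * \<beta> z)" if J: "J \<in> im_units" for J
  proof -
    let ?F = "\<lambda>b c. slice_coord I b (f (slice_emb I c))"
    have f: "f (slice_emb I c) = (1 / 2) *\<^sub>R (\<Sum>b\<in>Basis. slice_emb I (?F b c) * b)" for c
      by (simp add: slice_emb_slice_coord_sum[OF I])
    have "\<alpha> z + J * \<beta> z = (\<Sum>b\<in>Basis. slice_emb J (?F b (to_complex z)) * ((1 / 4) *\<^sub>R ((1 - J * I) * b)))
         + (\<Sum>b\<in>Basis. slice_emb J (cnj (?F b (cnj (to_complex z)))) * ((1 / 4) *\<^sub>R ((1 + J * I) * b)))" for z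
    proof -
      have "\<alpha> z + J * \<beta> z = f (slice_emb J (to_complex z))"
        using slice_stem_slice_emb(1)[OF s J, of "to_complex z"] by simp
      also have "\<dots> = (1 / 2) *\<^sub>R ((1 - J * I) * f (slice_emb I (to_complex z)) + (1 + J * I) * f (slice_emb I (cnj (to_complex z))))"
        using * J slice_representation[OF I] by blast
      also have "(1 - J * I) * f (slice_emb I (to_complex z)) = (\<Sum>b\<in>Basis. slice_emb J (?F b (to_complex z)) * ((1 / 2) *\<^sub>R ((1 - J * I) * b)))"
        by (subst f) (simp only: mult_scaleR_right sum_distrib_left mult.assoc[symmetric] unit_intertwine[OF I J] scaleR_sum_right)
      also have "(1 + J * I) * f (slice_emb I (cnj (to_complex z))) = (\<Sum>b\<in>Basis. slice_emb J (cnj (?F b (cnj (to_complex z)))) * ((1 / 2) *\<^sub>R ((1 + J * I) * b)))"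
        by (subst f) (simp only: mult_scaleR_right sum_distrib_left mult.assoc[symmetric] unit_intertwine[OF I J] scaleR_sum_right)
      finally show ?thesis
        by (simp add: scaleR_add_right scaleR_sum_right)
    qed
    moreover have "quat_polyanalytic J N (\<lambda>z. (\<Sum>b\<in>Basis. slice_emb J (?F b (to_complex z)) * ((1 / 4) *\<^sub>R ((1 - J * I) * b)))
         + (\<Sum>b\<in>Basis. slice_emb J (cnj (?F b (cnj (to_complex z)))) * ((1 / 4) *\<^sub>R ((1 + J * I) * b))))"
      using * by (intro quat_polyanalytic_add quat_polyanalytic_sum quat_polyanalytic_slice_emb[OF J]
          polyentire_cnj_cnj[of N "?F _"]) auto
    ultimately show ?thesis by simp
  qed
  \<comment> \<open>The slices of \<open>I\<close> and \<open>- I\<close> together give back the stem, hence its smoothness.\<close>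
  have C: "C_class N (\<lambda>z. \<alpha> z + I * \<beta> z)" "C_class N (\<lambda>z. \<alpha> z - I * \<beta> z)"
    using QP[OF I] QP[OF im_units_uminus[OF I]] by (auto simp: quat_polyanalytic_def)
  have "C_class N (\<lambda>z. (1 / 2) *\<^sub>R (\<alpha> z + I * \<beta> z) + (1 / 2) *\<^sub>R (\<alpha> z - I * \<beta> z))"
    by (intro C_class_add C_class_bounded_linear[of "\<lambda>q. (1 / 2) *\<^sub>R q"] bounded_linear_scaleR_right C)
  moreover have "(1 / 2) *\<^sub>R (p + q) + (1 / 2) *\<^sub>R (p - q) = p" for p q :: quat
    by (simp add: quat_eq_iff field_simps)
  ultimately have "C_class N \<alpha>" by simp
  moreover have "C_class N (\<lambda>z. (- (1 / 2) *\<^sub>R I) * (\<alpha> z + I * \<beta> z) + ((1 / 2) *\<^sub>R I) * (\<alpha> z - I * \<beta> z))"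
    by (intro C_class_add C_class_bounded_linear[of "\<lambda>q. _ * q"] bounded_linear_mult_right C)
  moreover have "(- (1 / 2) *\<^sub>R I) * (p + I * q) + ((1 / 2) *\<^sub>R I) * (p - I * q) = q" for p q
  proof -
    have "(- (1 / 2) *\<^sub>R I) * (p + I * q) + ((1 / 2) *\<^sub>R I) * (p - I * q) = - (1 / 2) *\<^sub>R (I * (I * q)) - (1 / 2) *\<^sub>R (I * (I * q))"
      by (simp add: algebra_simps)
    then show ?thesis by (simp add: im_units_mult_self[OF I] flip: scaleR_left_distrib)
  qed
  ultimately have "C_class N \<alpha>" "C_class N \<beta>" by simp_all
  then show "slice_polyanalytic N f"
    unfolding slice_polyanalytic_def
    using s QP by (intro exI[of _ \<alpha>] exI[of _ \<beta>]) (auto simp: quat_polyanalytic_def)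
qed

section \<open>The kernel on slices\<close>

lemma is_slice_star: "is_slice f \<Longrightarrow> is_slice g \<Longrightarrow> is_slice (slice_star f g)"
  unfolding is_slice_def using slice_stem_slice_star by blast

text \<open>
  If \<open>f\<close> maps the slice of \<open>J\<close> into itself, then both components of its stem take values in that slice and
  commute with \<open>J\<close>; so the product of the stems becomes the pointwise product.
\<close>

lemma slice_star_on_slice:
  assumes f: "is_slice f" and g: "is_slice g" and J: "J \<in> im_units"
    and F: "\<And>c. f (slice_emb J c) = slice_emb J (F c)"
  shows "slice_star f g (slice_emb J c) = f (slice_emb J c) * g (slice_emb J c)"
proof -
  obtain \<alpha>1 \<beta>1 \<alpha>2 \<beta>2 where s: "slice_stem \<alpha>1 \<beta>1 f" "slice_stem \<alpha>2 \<beta>2 g"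
    using f g by (auto simp: is_slice_def)
  define z where "z = (Re c, Im c)"
  note s3 = slice_stem_slice_emb(1)[OF slice_stem_slice_star[OF s] J, of c, folded z_def]
  have f1: "\<alpha>1 z + J * \<beta>1 z = slice_emb J (F c)" and f2: "\<alpha>1 z - J * \<beta>1 z = slice_emb J (F (cnj c))"
    using slice_stem_slice_emb[OF s(1) J, of c, folded z_def] F by auto
  have a: "2 *\<^sub>R \<alpha>1 z = slice_emb J (F c + F (cnj c))"
    unfolding slice_emb_simps f1[symmetric] f2[symmetric] by (simp add: scaleR_2)
  have "2 *\<^sub>R (\<alpha>1 z * J) = 2 *\<^sub>R (J * \<alpha>1 z)"
    using slice_emb_commute[OF J, of "F c + F (cnj c)" \<i>] by (simp add: a[symmetric] del: slice_emb_simps(5))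
  then have comm: "\<alpha>1 z * J = J * \<alpha>1 z" by simp
  show ?thesis
    unfolding s3 slice_stem_slice_emb(1)[OF s(1) J, of c, folded z_def] slice_stem_slice_emb(1)[OF s(2) J, of c, folded z_def]
  proof -
    have "(\<alpha>1 z + J * \<beta>1 z) * J = J * (\<alpha>1 z + J * \<beta>1 z)"
      using slice_emb_commute[OF J, of "F c" \<i>] by (simp add: f1)
    then have "J * (\<beta>1 z * J) = J * (J * \<beta>1 z)"
      using comm by (simp add: algebra_simps)
    then have b: "\<beta>1 z * J = J * \<beta>1 z"
      using im_units_mult_self[OF J, of "\<beta>1 z * J"] im_units_mult_self[OF J, of "J * \<beta>1 z"] by (metis neg_equal_iff_equal)
    have "(\<alpha>1 z + J * \<beta>1 z) * (\<alpha>2 z + J * \<beta>2 z)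
        = \<alpha>1 z * \<alpha>2 z + (\<alpha>1 z * J) * \<beta>2 z + J * \<beta>1 z * \<alpha>2 z + J * (\<beta>1 z * J) * \<beta>2 z"
      by (simp add: algebra_simps)
    also have "\<dots> = \<alpha>1 z * \<alpha>2 z - \<beta>1 z * \<beta>2 z + J * (\<alpha>1 z * \<beta>2 z + \<beta>1 z * \<alpha>2 z)"
      unfolding comm b using im_units_mult_self[OF J] by (simp add: algebra_simps)
    finally show "\<alpha>1 z * \<alpha>2 z - \<beta>1 z * \<beta>2 z + J * (\<alpha>1 z * \<beta>2 z + \<beta>1 z * \<alpha>2 z)
        = (\<alpha>1 z + J * \<beta>1 z) * (\<alpha>2 z + J * \<beta>2 z)" by simp
  qed
qed

lemma is_slice_star_power: "is_slice f \<Longrightarrow> is_slice (slice_star_power f k)"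
  by (induction k) (auto intro: is_slice_const is_slice_star)

lemma slice_star_power_on_slice:
  assumes f: "is_slice f" and J: "J \<in> im_units" and F: "\<And>c. f (slice_emb J c) = slice_emb J (F c)"
  shows "slice_star_power f k (slice_emb J c) = slice_emb J (F c ^ k)"
proof (induction k)
  case (Suc k)
  have "slice_star_power f (Suc k) (slice_emb J c) = f (slice_emb J c) * slice_star_power f k (slice_emb J c)"
    using slice_star_on_slice[OF f is_slice_star_power[OF f] J F] by simp
  then show ?case by (simp add: Suc F slice_emb_mult[OF J])
qed simp

lemma is_slice_quadratic: "is_slice (\<lambda>p. qcnj p * p - p * qcnj r - qcnj p * r + qcnj r * r)"
proof -
  define \<alpha> :: "real \<times> real \<Rightarrow> quat" where
    "\<alpha> z = of_real ((fst z)\<^sup>2 + (snd z)\<^sup>2) - fst z *\<^sub>R (qcnj r + r) + qcnj r * r" for z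
  define \<beta> :: "real \<times> real \<Rightarrow> quat" where "\<beta> z = snd z *\<^sub>R (r - qcnj r)" for z
  have "slice_stem \<alpha> \<beta> (\<lambda>p. qcnj p * p - p * qcnj r - qcnj p * r + qcnj r * r)"
    unfolding slice_stem_def
  proof (intro conjI allI ballI)
    fix x y
    show "\<alpha> (x, - y) = \<alpha> (x, y)" "\<beta> (x, - y) = - \<beta> (x, y)"
      by (simp_all add: \<alpha>_def \<beta>_def)
    fix J assume J: "J \<in> im_units"
    let ?p = "slice_emb J (Complex x y)"
    have "qcnj ?p * ?p = slice_emb J (cnj (Complex x y) * Complex x y)"
      by (simp add: slice_emb_mult[OF J] slice_emb_cnj[OF J])
    also have "\<dots> = of_real (x\<^sup>2 + y\<^sup>2)"
      by (simp add: slice_emb_def power2_eq_square of_real_def)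
    finally have 1: "qcnj ?p * ?p = of_real (x\<^sup>2 + y\<^sup>2)" .
    have 2: "?p * qcnj r + qcnj ?p * r = x *\<^sub>R (qcnj r + r) - J * (y *\<^sub>R (r - qcnj r))"
      unfolding slice_emb_cnj[OF J, symmetric] by (simp add: slice_emb_def algebra_simps)
    have "qcnj ?p * ?p - ?p * qcnj r - qcnj ?p * r + qcnj r * r = qcnj ?p * ?p - (?p * qcnj r + qcnj ?p * r) + qcnj r * r"
      by simp
    then show "qcnj (slice_pt J (x, y)) * slice_pt J (x, y) - slice_pt J (x, y) * qcnj r
        - qcnj (slice_pt J (x, y)) * r + qcnj r * r = \<alpha> (x, y) + J * \<beta> (x, y)"
      unfolding slice_pt_emb to_complex_simps 1 2 by (simp add: \<alpha>_def \<beta>_def)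
  qed
  then show ?thesis by (auto simp: is_slice_def)
qed

lemma summable_exp_quat:
  fixes a :: "nat \<Rightarrow> quat"
  assumes "\<And>n. norm (a n) \<le> x ^ n"
  shows "summable (\<lambda>n. a n /\<^sub>R fact n)"
proof (rule summable_comparison_test')
  show "summable (\<lambda>n. x ^ n /\<^sub>R fact n)" by (rule summable_exp_generic)
  show "norm (a n /\<^sub>R fact n) \<le> x ^ n /\<^sub>R fact n" if "n \<ge> 0" for n
    using assms[of n] by (simp add: field_simps)
qed

lemma norm_qcnj: "norm (qcnj q) = norm q"
  by (simp add: norm_quat_def)

lemma is_slice_exp_star: "is_slice (\<lambda>p. exp_star p r)"
proof -
  define a where "a z n = Re (to_complex z ^ n) *\<^sub>R qcnj r ^ n" for z :: "real \<times> real" and n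
  define b where "b z n = Im (to_complex z ^ n) *\<^sub>R qcnj r ^ n" for z :: "real \<times> real" and n
  define \<alpha> where "\<alpha> z = (\<Sum>n. a z n /\<^sub>R fact n)" for z
  define \<beta> where "\<beta> z = (\<Sum>n. b z n /\<^sub>R fact n)" for z
  have sa: "summable (\<lambda>n. a z n /\<^sub>R fact n)" and sb: "summable (\<lambda>n. b z n /\<^sub>R fact n)" for z
  proof -
    have "norm (a z n) \<le> (norm z * norm r) ^ n" "norm (b z n) \<le> (norm z * norm r) ^ n" for n
      using abs_Re_le_cmod[of "to_complex z ^ n"] abs_Im_le_cmod[of "to_complex z ^ n"]
      by (auto simp: a_def b_def norm_power norm_qcnj power_mult_distrib intro!: mult_right_mono)
    then show "summable (\<lambda>n. a z n /\<^sub>R fact n)" "summable (\<lambda>n. b z n /\<^sub>R fact n)"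
      by (blast intro: summable_exp_quat)+
  qed
  have "slice_stem \<alpha> \<beta> (\<lambda>p. exp_star p r)"
    unfolding slice_stem_def
  proof (intro conjI allI ballI)
    fix x y
    have c: "to_complex (x, - y) ^ n = cnj (to_complex (x, y) ^ n)" for n
    proof -
      have "to_complex (x, - y) = cnj (to_complex (x, y))" by (simp add: complex_eq_iff)
      then show ?thesis by simp
    qed
    show "\<alpha> (x, - y) = \<alpha> (x, y)"
      unfolding \<alpha>_def a_def c by (simp only: cnj.simps)
    show "\<beta> (x, - y) = - \<beta> (x, y)"
      using suminf_minus[OF sb[of "(x, y)"]] unfolding \<beta>_def b_def c
      by (simp only: cnj.simps scaleR_minus_left scaleR_minus_right)
    fix J assume J: "J \<in> im_units"
    have "(slice_pt J (x, y) ^ n * qcnj r ^ n) /\<^sub>R fact n = a (x, y) n /\<^sub>R fact n + J * (b (x, y) n /\<^sub>R fact n)" for n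
    proof -
      have e: "slice_emb J c ^ n = Re (c ^ n) *\<^sub>R 1 + Im (c ^ n) *\<^sub>R J" for c
        by (subst slice_emb_power[OF J, symmetric]) (rule slice_emb_def)
      show ?thesis
        unfolding slice_pt_emb e a_def b_def by (simp add: algebra_simps)
    qed
    then have "exp_star (slice_pt J (x, y)) r = (\<Sum>n. a (x, y) n /\<^sub>R fact n + J * (b (x, y) n /\<^sub>R fact n))"
      unfolding exp_star_def by (simp only:)
    also have "\<dots> = \<alpha> (x, y) + (\<Sum>n. J * (b (x, y) n /\<^sub>R fact n))"
      unfolding \<alpha>_def by (rule suminf_add[OF sa summable_mult[OF sb], symmetric])
    also have "(\<Sum>n. J * (b (x, y) n /\<^sub>R fact n)) = J * \<beta> (x, y)"
      unfolding \<beta>_def by (rule suminf_mult[OF sb])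
    finally show "exp_star (slice_pt J (x, y)) r = \<alpha> (x, y) + J * \<beta> (x, y)" .
  qed
  then show ?thesis by (auto simp: is_slice_def)
qed

lemma is_slice_fock_phi: "is_slice (\<lambda>p. fock_phi N p r)"
  unfolding fock_phi_def
  by (intro is_slice_sum is_slice_scaleR is_slice_star_power is_slice_quadratic)

lemma is_slice_fock_kernel: "is_slice (\<lambda>q. fock_kernel N q r)"
  unfolding fock_kernel_def
  using is_slice_star[OF is_slice_exp_star is_slice_fock_phi, of r N r] by simp

lemma exp_star_on_slice:
  assumes J: "J \<in> im_units"
  shows "exp_star (slice_emb J z) (slice_emb J w) = slice_emb J (exp (z * cnj w))"
proof -
  have "(\<lambda>n. slice_emb J ((z * cnj w) ^ n /\<^sub>R fact n)) sums slice_emb J (exp (z * cnj w))"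
    by (rule bounded_linear.sums[OF bounded_linear_slice_emb exp_converges])
  moreover have "slice_emb J ((z * cnj w) ^ n /\<^sub>R fact n) = (slice_emb J z ^ n * qcnj (slice_emb J w) ^ n) /\<^sub>R fact n" for n
    by (simp add: slice_emb_scaleR slice_emb_mult[OF J] slice_emb_power[OF J] slice_emb_cnj[OF J] power_mult_distrib)
  ultimately show ?thesis
    by (simp add: exp_star_def sums_iff)
qed

lemma fock_phi_on_slice:
  assumes J: "J \<in> im_units"
  shows "fock_phi N (slice_emb J z) (slice_emb J w) = slice_emb J (of_real (laguerre N ((norm (z - w))\<^sup>2)))"
proof -
  let ?f = "\<lambda>p. qcnj p * p - p * qcnj (slice_emb J w) - qcnj p * slice_emb J w + qcnj (slice_emb J w) * slice_emb J w"
  have f: "?f (slice_emb J c) = slice_emb J (of_real ((norm (c - w))\<^sup>2))" for c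
    unfolding complex_norm_square slice_emb_cnj[OF J, symmetric] slice_emb_mult[OF J, symmetric] slice_emb_simps(5-7)[symmetric]
    by (rule arg_cong[of _ _ "slice_emb J"]) (simp add: algebra_simps)
  have p: "slice_star_power ?f k (slice_emb J z) = of_real (((norm (z - w))\<^sup>2) ^ k)" for k
    using slice_star_power_on_slice[OF is_slice_quadratic J f, of k z]
    by (simp only: of_real_power[symmetric] slice_emb_simps(4))
  show ?thesis
    unfolding fock_phi_def p laguerre_def laguerre_coeff_def slice_emb_simps(4)
    by (subst of_real_sum, intro sum.cong refl) (simp only: scaleR_conv_of_real of_real_mult)
qed

text \<open>
  For parameters in the slice of \<open>J\<close> both factors of the kernel preserve that slice, hence their star product is
  computed pointwise.
\<close>

lemma fock_kernel_on_slice: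
  assumes J: "J \<in> im_units"
  shows "fock_kernel N (slice_emb J z) (slice_emb J w) = slice_emb J (complex_kernel N z w)"
  unfolding fock_kernel_def
  by (subst slice_star_on_slice[OF is_slice_exp_star is_slice_fock_phi J exp_star_on_slice[OF J]])
     (simp add: exp_star_on_slice[OF J] fock_phi_on_slice[OF J] complex_kernel_def slice_emb_mult[OF J] del: slice_emb_simps(4))

lemma complex_kernel_cnj_cnj: "complex_kernel N (cnj z) (cnj w) = cnj (complex_kernel N z w)"
proof -
  have "norm (cnj z - cnj w) = norm (z - w)" by (metis complex_cnj_diff complex_mod_cnj)
  then show ?thesis by (simp add: complex_kernel_def exp_cnj)
qed

text \<open>
  Both sides are slice functions of \<open>q\<close>, so they need to be compared only on the slice of \<open>I\<close>. There the left
  side is obtained by the representation formula from the slice of \<open>J\<close>, which contains the parameter.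
\<close>

lemma fock_kernel_representation:
  assumes I: "I \<in> im_units" and J: "J \<in> im_units"
  shows "fock_kernel N q (slice_emb J w) = fock_kernel N q (slice_emb I w) * ((1 / 2) *\<^sub>R (1 - I * J))
     + fock_kernel N q (slice_emb I (cnj w)) * ((1 / 2) *\<^sub>R (1 + I * J))"
proof -
  have "(\<lambda>q. fock_kernel N q (slice_emb J w)) = (\<lambda>q. fock_kernel N q (slice_emb I w) * ((1 / 2) *\<^sub>R (1 - I * J))
     + fock_kernel N q (slice_emb I (cnj w)) * ((1 / 2) *\<^sub>R (1 + I * J)))"
  proof (rule slice_identity[OF I])
    fix z
    have "fock_kernel N (slice_emb I z) (slice_emb J w) = (1 / 2) *\<^sub>R ((1 - I * J) * fock_kernel N (slice_emb J z) (slice_emb J w)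
        + (1 + I * J) * fock_kernel N (slice_emb J (cnj z)) (slice_emb J w))"
      using is_slice_fock_kernel[of N "slice_emb J w"] I unfolding slice_representation[OF J] by blast
    also have "\<dots> = (1 / 2) *\<^sub>R (slice_emb I (complex_kernel N z w) * (1 - I * J) + slice_emb I (complex_kernel N z (cnj w)) * (1 + I * J))"
      unfolding fock_kernel_on_slice[OF J] unit_intertwine[OF J I]
      using complex_kernel_cnj_cnj[of N "cnj z" w] by simp
    finally show "fock_kernel N (slice_emb I z) (slice_emb J w) = fock_kernel N (slice_emb I z) (slice_emb I w) * ((1 / 2) *\<^sub>R (1 - I * J))
       + fock_kernel N (slice_emb I z) (slice_emb I (cnj w)) * ((1 / 2) *\<^sub>R (1 + I * J))"
      by (simp only: fock_kernel_on_slice[OF I] mult_scaleR_right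
          scaleR_add_right[of _ "slice_emb I a * b" "slice_emb I c * d" for a b c d])
  qed (intro is_slice_add is_slice_mult_right is_slice_fock_kernel)+
  then show ?thesis by (rule fun_cong)
qed

section \<open>The slice polyanalytic Fock space\<close>

lemma bounded_linear_qcnj: "bounded_linear qcnj"
proof (rule bounded_linear_intro[of _ 1])
  show "qcnj (x + y) = qcnj x + qcnj y" "qcnj (r *\<^sub>R x) = r *\<^sub>R qcnj x" "norm (qcnj x) \<le> norm x * 1" for x y r
    by (simp_all add: quat_eq_iff norm_qcnj)
qed

lemma qcnj_linear: "qcnj (p + q) = qcnj p + qcnj q" "qcnj (p - q) = qcnj p - qcnj q"
    "qcnj (r *\<^sub>R q) = r *\<^sub>R qcnj q" "qcnj 1 = 1"
  by (simp_all add: quat_eq_iff)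

lemma qcnj_qcnj: "qcnj (qcnj q) = q"
  by (simp add: quat_eq_iff)

lemma borel_measurable_qcnj [measurable]: "qcnj \<in> borel_measurable borel"
  by (intro borel_measurable_continuous_onI bounded_linear.continuous_on[OF bounded_linear_qcnj] continuous_intros)

definition gauss_inner :: "(real \<times> real \<Rightarrow> quat) \<Rightarrow> (real \<times> real \<Rightarrow> quat) \<Rightarrow> quat" where
  "gauss_inner u v = (1 / pi) *\<^sub>R (LINT z|lborel. exp (- (norm z)\<^sup>2) *\<^sub>R (qcnj (v z) * u z))"

lemma slice_fock_inner_eq:
  "I \<in> im_units \<Longrightarrow> slice_fock_inner I f g = gauss_inner (\<lambda>z. f (slice_pt I z)) (\<lambda>z. g (slice_pt I z))"
  by (simp add: slice_fock_inner_def gauss_inner_def norm_slice_pt)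

lemma gauss_inner_integrable:
  assumes "gauss_L2 u" "gauss_L2 v"
  shows "integrable lborel (\<lambda>z. exp (- (norm z)\<^sup>2) *\<^sub>R (qcnj (v z) * u z))"
proof -
  note [measurable] = assms[THEN gauss_L2_measurable]
  show ?thesis
    by (rule Bochner_Integration.integrable_bound[OF gauss_L2_integrable_mult[OF assms]])
       (auto simp: norm_mult norm_qcnj mult_ac)
qed

lemma norm_gauss_inner_le:
  assumes "gauss_L2 u" "gauss_L2 v"
  shows "norm (gauss_inner u v) \<le> gauss_norm u * gauss_norm v / pi"
proof -
  have "norm (LINT z|lborel. exp (- (norm z)\<^sup>2) *\<^sub>R (qcnj (v z) * u z))
      \<le> (LINT z|lborel. norm (exp (- (norm z)\<^sup>2) *\<^sub>R (qcnj (v z) * u z)))"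
    by (rule integral_norm_bound)
  also have "\<dots> = (LINT z|lborel. norm (u z) * norm (v z) * exp (- (norm z)\<^sup>2))"
    by (intro Bochner_Integration.integral_cong) (auto simp: norm_mult norm_qcnj mult_ac)
  also have "\<dots> \<le> gauss_norm u * gauss_norm v"
    by (rule gauss_Cauchy_Schwarz[OF assms])
  finally show ?thesis
    by (simp add: gauss_inner_def divide_right_mono)
qed

lemma gauss_inner_add:
  assumes "gauss_L2 u" "gauss_L2 v" "gauss_L2 w"
  shows "gauss_inner (\<lambda>z. u z + v z) w = gauss_inner u w + gauss_inner v w"
  unfolding gauss_inner_def distrib_left scaleR_add_right
  by (subst Bochner_Integration.integral_add) (auto intro: gauss_inner_integrable assms simp: scaleR_add_right)

lemma gauss_inner_mult_right:
  assumes "gauss_L2 u" "gauss_L2 w"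
  shows "gauss_inner (\<lambda>z. u z * a) w = gauss_inner u w * a"
proof -
  have e: "exp (- (norm z)\<^sup>2) *\<^sub>R (qcnj (w z) * (u z * a)) = exp (- (norm z)\<^sup>2) *\<^sub>R (qcnj (w z) * u z) * a" for z
    by (simp add: mult.assoc)
  show ?thesis
    unfolding gauss_inner_def e
    by (subst Bochner_Integration.integral_mult_left) (auto intro: gauss_inner_integrable assms)
qed

lemma gauss_inner_qcnj:
  assumes "gauss_L2 u" "gauss_L2 v"
  shows "gauss_inner v u = qcnj (gauss_inner u v)"
proof -
  have "qcnj (LINT z|lborel. exp (- (norm z)\<^sup>2) *\<^sub>R (qcnj (v z) * u z))
      = (LINT z|lborel. qcnj (exp (- (norm z)\<^sup>2) *\<^sub>R (qcnj (v z) * u z)))"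
    by (rule integral_bounded_linear[OF bounded_linear_qcnj gauss_inner_integrable[OF assms], symmetric])
  then show ?thesis
    by (simp add: gauss_inner_def qcnj_linear qcnj_mult qcnj_qcnj)
qed

lemma gauss_inner_self: "gauss_inner u u = of_real ((gauss_norm u)\<^sup>2 / pi)"
proof -
  have "exp (- (norm z)\<^sup>2) *\<^sub>R (qcnj (u z) * u z) = of_real ((norm (u z))\<^sup>2 * exp (- (norm z)\<^sup>2))" for z
    using mult_qcnj[of "qcnj (u z)"] by (simp add: qcnj_qcnj norm_qcnj scaleR_conv_of_real mult.commute flip: of_real_mult of_real_power)
  moreover have "(LINT z|lborel. (of_real (g z) :: quat)) = of_real (LINT z|lborel. g z)"
    for g :: "real \<times> real \<Rightarrow> real"
    by (rule integral_bounded_linear'[OF bounded_linear_of_real bounded_linear_inner_left[of "1 :: quat"]])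
       (simp add: inner_quat_def)
  moreover have "(1 / pi) *\<^sub>R of_real x = (of_real (x / pi) :: quat)" for x
    by (simp add: of_real_def)
  ultimately show ?thesis
    unfolding gauss_inner_def gauss_norm_power2 by (simp only:)
qed

lemma gauss_L2_mult_right:
  fixes u :: "real \<times> real \<Rightarrow> quat"
  assumes "gauss_L2 u"
  shows "gauss_L2 (\<lambda>z. u z * a)"
proof (rule gauss_L2_bound[OF assms])
  note [measurable] = assms[THEN gauss_L2_measurable]
  show "(\<lambda>z. u z * a) \<in> borel_measurable borel" by measurable
  show "norm (u z * a) \<le> norm a * norm (u z)" for z by (simp add: norm_mult)
qed

lemma gauss_L2_diff:
  fixes u :: "real \<times> real \<Rightarrow> quat"
  assumes "gauss_L2 u" "gauss_L2 v"
  shows "gauss_L2 (\<lambda>z. u z - v z)"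
  using gauss_L2_add[OF assms(1) gauss_L2_mult_right[OF assms(2), of "-1"]] by simp

lemma gauss_L2_slice_coord:
  assumes "gauss_L2 u"
  shows "gauss_L2 (\<lambda>z. slice_coord I b (u z))"
proof (rule gauss_L2_bound[OF assms])
  have [measurable]: "slice_coord I b \<in> borel_measurable borel"
    by (intro borel_measurable_continuous_onI bounded_linear.continuous_on[OF bounded_linear_slice_coord] continuous_intros)
  note [measurable] = assms[THEN gauss_L2_measurable]
  show "(\<lambda>z. slice_coord I b (u z)) \<in> borel_measurable borel" by measurable
qed (rule norm_slice_coord_le)

text \<open>
  Fatou's lemma in the form used for completeness: a pointwise limit obeys the norm bounds of its
  sequence.
\<close>

lemma gauss_norm_limit:
  fixes d :: "nat \<Rightarrow> real \<times> real \<Rightarrow> quat"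
  assumes L2: "\<And>m. gauss_L2 (d m)" and lim: "\<And>z. (\<lambda>m. d m z) \<longlonglongrightarrow> d' z"
    and le: "\<And>m. m \<ge> M \<Longrightarrow> gauss_norm (d m) \<le> e"
  shows "gauss_L2 d'" "gauss_norm d' \<le> e"
proof -
  note [measurable] = L2[THEN gauss_L2_measurable]
  have [measurable]: "d' \<in> borel_measurable borel"
    by (rule borel_measurable_LIMSEQ_metric[of d]) (use lim in auto)
  have e: "e \<ge> 0" using le[of M] gauss_norm_nonneg[of "d M"] by linarith
  let ?n = "\<lambda>u z. ennreal ((norm (u z :: quat))\<^sup>2 * exp (- (norm z)\<^sup>2))"
  have nn: "(\<integral>\<^sup>+z. ?n (d m) z \<partial>lborel) = ennreal ((gauss_norm (d m))\<^sup>2)" for m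
    using L2[of m] unfolding gauss_norm_power2 gauss_L2_def by (intro nn_integral_eq_integral) auto
  have "(\<integral>\<^sup>+z. ?n d' z \<partial>lborel) = (\<integral>\<^sup>+z. liminf (\<lambda>m. ?n (d m) z) \<partial>lborel)"
    by (intro nn_integral_cong lim_imp_Liminf[symmetric] tendsto_ennrealI tendsto_intros lim) auto
  also have "\<dots> \<le> liminf (\<lambda>m. \<integral>\<^sup>+z. ?n (d m) z \<partial>lborel)"
    by (rule nn_integral_liminf) measurable
  also have "\<dots> \<le> ennreal (e\<^sup>2)"
    unfolding nn using le
    by (intro Liminf_le eventually_sequentiallyI[of M] ennreal_leI power_mono) auto
  finally have fin: "(\<integral>\<^sup>+z. ?n d' z \<partial>lborel) \<le> ennreal (e\<^sup>2)" .
  have int: "integrable lborel (\<lambda>z. (norm (d' z))\<^sup>2 * exp (- (norm z)\<^sup>2))"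
    by (rule integrableI_bounded) (use fin in \<open>auto simp: abs_mult intro: le_less_trans\<close>)
  then show "gauss_L2 d'" by (simp add: gauss_L2_def)
  have "ennreal ((gauss_norm d')\<^sup>2) \<le> ennreal (e\<^sup>2)"
    using fin int unfolding gauss_norm_power2 by (subst (asm) nn_integral_eq_integral) auto
  then have "(gauss_norm d')\<^sup>2 \<le> e\<^sup>2" by simp
  then show "gauss_norm d' \<le> e" using e by (rule power2_le_imp_le)
qed

lemma slice_fock_iff:
  assumes I: "I \<in> im_units"
  shows "f \<in> slice_fock N I \<longleftrightarrow> is_slice f \<and> (\<forall>b. polyentire N (\<lambda>c. slice_coord I b (f (slice_emb I c)))) \<and> gauss_L2 (\<lambda>z. f (slice_pt I z))"
proof -
  have "(\<lambda>z. f (slice_pt I z)) \<in> borel_measurable borel" if p: "\<forall>b. polyentire N (\<lambda>c. slice_coord I b (f (slice_emb I c)))"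
  proof -
    have "f (slice_pt I z) = (1 / 2) *\<^sub>R (\<Sum>b\<in>Basis. slice_emb I (slice_coord I b (f (slice_emb I (to_complex z)))) * b)" for z
      by (simp add: slice_emb_slice_coord_sum[OF I] slice_pt_emb)
    moreover have "continuous_on UNIV (\<lambda>z. slice_coord I b (f (slice_emb I (to_complex z))))" for b
      by (rule continuous_on_compose2[OF polyentire_continuous[OF p[rule_format]]])
         (auto intro: continuous_intros)
    ultimately show ?thesis
      by (auto intro!: borel_measurable_continuous_onI continuous_intros bounded_linear.continuous_on[OF bounded_linear_slice_emb])
  qed
  then show ?thesis
    by (auto simp: slice_fock_def slice_polyanalytic_iff[OF I] gauss_L2_def norm_slice_pt[OF I])
qed

lemma slice_fock_add: "I \<in> im_units \<Longrightarrow> f \<in> slice_fock N I \<Longrightarrow> g \<in> slice_fock N I \<Longrightarrow> (\<lambda>q. f q + g q) \<in> slice_fock N I"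
  by (auto simp: slice_fock_iff slice_coord_add intro: is_slice_add polyentire_add gauss_L2_add)

lemma slice_fock_mult_right: "I \<in> im_units \<Longrightarrow> f \<in> slice_fock N I \<Longrightarrow> (\<lambda>q. f q * a) \<in> slice_fock N I"
  by (auto simp: slice_fock_iff slice_coord_mult_right intro: is_slice_mult_right gauss_L2_mult_right)

lemma slice_fock_diff: "I \<in> im_units \<Longrightarrow> f \<in> slice_fock N I \<Longrightarrow> g \<in> slice_fock N I \<Longrightarrow> (\<lambda>q. f q - g q) \<in> slice_fock N I"
  using slice_fock_add[of I f N "\<lambda>q. g q * (-1)"] slice_fock_mult_right[of I g N "-1"] by simp

lemma fock_kernel_in_slice_fock:
  assumes I: "I \<in> im_units"
  shows "(\<lambda>q. fock_kernel N q r) \<in> slice_fock N I"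
proof -
  have K: "(\<lambda>q. fock_kernel N q (slice_emb I w)) \<in> slice_fock N I" for w
    unfolding slice_fock_iff[OF I]
  proof (intro conjI allI)
    show "is_slice (\<lambda>q. fock_kernel N q (slice_emb I w))" by (rule is_slice_fock_kernel)
    have "slice_coord I b (slice_emb I (complex_kernel N c w)) = slice_coord I b 1 * complex_kernel N c w" for b c
      using slice_coord_emb_mult[OF I, of b "complex_kernel N c w" 1] by simp
    then show "polyentire N (\<lambda>c. slice_coord I b (fock_kernel N (slice_emb I c) (slice_emb I w)))" for b
      unfolding fock_kernel_on_slice[OF I] by (simp add: polyentire_cmult polyentire_complex_kernel)
    show "gauss_L2 (\<lambda>z. fock_kernel N (slice_pt I z) (slice_emb I w))"
    proof (rule gauss_L2_bound[OF gauss_L2_complex_kernel[of N w]])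
      note [measurable] = gauss_L2_measurable[OF gauss_L2_complex_kernel]
      have [measurable]: "slice_emb I \<in> borel_measurable borel"
        by (intro borel_measurable_continuous_onI bounded_linear.continuous_on[OF bounded_linear_slice_emb] continuous_intros)
      show "(\<lambda>z. fock_kernel N (slice_pt I z) (slice_emb I w)) \<in> borel_measurable borel"
        unfolding slice_pt_emb fock_kernel_on_slice[OF I] by measurable
      show "norm (fock_kernel N (slice_pt I z) (slice_emb I w)) \<le> 1 * norm (complex_kernel N (to_complex z) w)" for z
        by (simp add: slice_pt_emb fock_kernel_on_slice[OF I] norm_slice_emb[OF I])
    qed
  qed
  obtain J w where J: "J \<in> im_units" and r: "r = slice_emb J w" using slice_emb_surj by blast
  show ?thesis
    unfolding r fock_kernel_representation[OF I J]
    by (intro slice_fock_add slice_fock_mult_right I K)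
qed

text \<open>
  Stated for arbitrary square integrable \<open>u\<close>, because completeness needs it for a limit whose polyanalyticity is
  still to be shown.
\<close>

lemma slice_coord_gauss_inner_kernel:
  assumes I: "I \<in> im_units" and u: "gauss_L2 u"
  shows "slice_coord I b (gauss_inner u (\<lambda>z. fock_kernel N (slice_pt I z) (slice_emb I w)))
     = (1 / pi) *\<^sub>R (LINT z|lborel. exp (- (norm z)\<^sup>2) *\<^sub>R (cnj (complex_kernel N (to_complex z) w) * slice_coord I b (u z)))"
proof -
  let ?K = "\<lambda>z. fock_kernel N (slice_pt I z) (slice_emb I w)"
  have K: "gauss_L2 ?K"
    using fock_kernel_in_slice_fock[OF I] by (simp add: slice_fock_iff[OF I])
  have "slice_coord I b (LINT z|lborel. exp (- (norm z)\<^sup>2) *\<^sub>R (qcnj (?K z) * u z))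
      = (LINT z|lborel. slice_coord I b (exp (- (norm z)\<^sup>2) *\<^sub>R (qcnj (?K z) * u z)))"
    by (rule integral_bounded_linear[OF bounded_linear_slice_coord gauss_inner_integrable[OF u K], symmetric])
  also have "\<dots> = (LINT z|lborel. exp (- (norm z)\<^sup>2) *\<^sub>R (cnj (complex_kernel N (to_complex z) w) * slice_coord I b (u z)))"
    by (simp add: slice_pt_emb fock_kernel_on_slice[OF I] slice_coord_scaleR slice_coord_emb_mult[OF I] flip: slice_emb_cnj[OF I])
  finally show ?thesis
    by (simp add: gauss_inner_def slice_coord_scaleR)
qed

lemma slice_reproducing:
  assumes I: "I \<in> im_units" and N: "N \<ge> 1" and f: "f \<in> slice_fock N I"
  shows "slice_fock_inner I f (\<lambda>q. fock_kernel N q (slice_emb I w)) = f (slice_emb I w)"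
proof (rule slice_coord_eqI)
  fix b
  let ?F = "\<lambda>c. slice_coord I b (f (slice_emb I c))"
  have L2: "gauss_L2 (\<lambda>z. f (slice_pt I z))" and p: "polyentire N ?F"
    using f by (auto simp: slice_fock_iff[OF I])
  have "gauss_L2 (\<lambda>z. ?F (to_complex z))"
    using gauss_L2_slice_coord[OF L2] by (simp add: slice_pt_emb)
  from polyanalytic_reproducing[OF p N this, of w]
  show "slice_coord I b (slice_fock_inner I f (\<lambda>q. fock_kernel N q (slice_emb I w))) = slice_coord I b (f (slice_emb I w))"
    unfolding slice_fock_inner_eq[OF I] slice_coord_gauss_inner_kernel[OF I L2]
    by (simp add: slice_pt_emb scaleR_conv_of_real)
qed

text \<open>
  Definiteness is the only axiom with content: if the norm of \<open>f\<close> vanishes, then the reproducing formula and the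
  Cauchy-Schwarz inequality give \<open>f = 0\<close> at every point of the slice.
\<close>

lemma slice_fock_inner_space:
  assumes I: "I \<in> im_units" and N: "N \<ge> 1"
  shows "right_quat_inner_space (slice_fock N I) (slice_fock_inner I)"
proof
  have L2: "gauss_L2 (\<lambda>z. f (slice_pt I z))" if "f \<in> slice_fock N I" for f
    using that by (auto simp: slice_fock_iff[OF I])
  show "(\<lambda>_. 0) \<in> slice_fock N I"
    using slice_fock_mult_right[OF I fock_kernel_in_slice_fock[OF I, of N 0], of 0] by simp
  show "(\<lambda>q. f q + g q) \<in> slice_fock N I" if "f \<in> slice_fock N I" "g \<in> slice_fock N I" for f g
    using that by (rule slice_fock_add[OF I])
  show "(\<lambda>q. f q * a) \<in> slice_fock N I" if "f \<in> slice_fock N I" for f a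
    using that by (rule slice_fock_mult_right[OF I])
  show "slice_fock_inner I (\<lambda>q. f q + g q) h = slice_fock_inner I f h + slice_fock_inner I g h"
    if "f \<in> slice_fock N I" "g \<in> slice_fock N I" "h \<in> slice_fock N I" for f g h
    using that by (simp add: slice_fock_inner_eq[OF I] gauss_inner_add L2)
  show "slice_fock_inner I (\<lambda>q. f q * a) g = slice_fock_inner I f g * a"
    if "f \<in> slice_fock N I" "g \<in> slice_fock N I" for f g a
    using that by (simp add: slice_fock_inner_eq[OF I] gauss_inner_mult_right L2)
  show "slice_fock_inner I g f = qcnj (slice_fock_inner I f g)"
    if "f \<in> slice_fock N I" "g \<in> slice_fock N I" for f g
    unfolding slice_fock_inner_eq[OF I] by (rule gauss_inner_qcnj) (use that L2 in auto)
  show "slice_fock_inner I f f \<in> \<real> \<and> 0 \<le> qRe (slice_fock_inner I f f)" for f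
    by (simp only: slice_fock_inner_eq[OF I] gauss_inner_self quat_of_real_simps Reals_of_real) simp
  show "f = (\<lambda>_. 0)" if f: "f \<in> slice_fock N I" and "slice_fock_inner I f f = 0" for f
  proof (rule slice_identity[OF I])
    show "is_slice f" using f by (simp add: slice_fock_iff[OF I])
    show "is_slice (\<lambda>_. 0)" by (rule is_slice_const)
    fix w
    have "(gauss_norm (\<lambda>z. f (slice_pt I z)))\<^sup>2 / pi = 0"
      using that(2) unfolding slice_fock_inner_eq[OF I] gauss_inner_self of_real_eq_0_iff .
    then have "gauss_norm (\<lambda>z. f (slice_pt I z)) = 0" by simp
    then have "norm (f (slice_emb I w)) \<le> 0"
      using norm_gauss_inner_le[OF L2[OF f] L2[OF fock_kernel_in_slice_fock[OF I, of N "slice_emb I w"]]]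
        slice_reproducing[OF I N f, of w] by (simp add: slice_fock_inner_eq[OF I])
    then show "f (slice_emb I w) = 0" by simp
  qed
qed

text \<open>
  The inner product is conjugate linear in its second argument, so the right coefficients of
  \<open>fock_kernel_representation\<close> come out conjugated on the left. Conjugation turns \<open>I * J\<close> into \<open>J * I\<close>: they
  are the coefficients of the representation formula for \<open>f r\<close>.
\<close>

lemma slice_fock_reproducing:
  assumes I: "I \<in> im_units" and N: "N \<ge> 1" and f: "f \<in> slice_fock N I"
  shows "f r = slice_fock_inner I f (\<lambda>q. fock_kernel N q r)"
proof -
  interpret right_quat_inner_space "slice_fock N I" "slice_fock_inner I"
    by (rule slice_fock_inner_space[OF I N])
  let ?ip = "slice_fock_inner I" and ?K = "\<lambda>r q. fock_kernel N q r"
  have K: "?K r \<in> slice_fock N I" for r by (rule fock_kernel_in_slice_fock[OF I])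
  have right: "?ip f (\<lambda>q. g q * a + h q * b) = qcnj a * ?ip f g + qcnj b * ?ip f h"
    if g: "g \<in> slice_fock N I" and h: "h \<in> slice_fock N I" for g h a b
  proof -
    have "?ip f (\<lambda>q. g q * a + h q * b) = qcnj (?ip (\<lambda>q. g q * a + h q * b) f)"
      by (intro ip_cnj add_closed scale_closed g h f)
    also have "\<dots> = qcnj (?ip g f * a + ?ip h f * b)"
      using f g h by (simp add: ip_add ip_scale scale_closed)
    also have "\<dots> = qcnj a * qcnj (?ip g f) + qcnj b * qcnj (?ip h f)"
      by (simp add: qcnj_mult qcnj_linear)
    finally show ?thesis
      using ip_cnj[OF g f] ip_cnj[OF h f] by simp
  qed
  obtain J w where J: "J \<in> im_units" and r: "r = slice_emb J w" using slice_emb_surj by blast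
  have c: "qcnj ((1 / 2) *\<^sub>R (1 - I * J)) = (1 / 2) *\<^sub>R (1 - J * I)" "qcnj ((1 / 2) *\<^sub>R (1 + I * J)) = (1 / 2) *\<^sub>R (1 + J * I)"
  proof -
    have "qcnj (I * J) = J * I" by (simp add: qcnj_mult qcnj_im_unit[OF I] qcnj_im_unit[OF J])
    then show "qcnj ((1 / 2) *\<^sub>R (1 - I * J)) = (1 / 2) *\<^sub>R (1 - J * I)" "qcnj ((1 / 2) *\<^sub>R (1 + I * J)) = (1 / 2) *\<^sub>R (1 + J * I)"
      by (simp_all only: qcnj_linear)
  qed
  have "?ip f (?K r) = (1 / 2) *\<^sub>R (1 - J * I) * f (slice_emb I w) + (1 / 2) *\<^sub>R (1 + J * I) * f (slice_emb I (cnj w))"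
    unfolding r fock_kernel_representation[OF I J] right[OF K K] c slice_reproducing[OF I N f] ..
  also have "\<dots> = (1 / 2) *\<^sub>R ((1 - J * I) * f (slice_emb I w) + (1 + J * I) * f (slice_emb I (cnj w)))"
    by (simp only: scaleR_add_right[of _ "_ * _"] mult_scaleR_left)
  also have "\<dots> = f r"
    using f J unfolding slice_fock_iff[OF I] slice_representation[OF I] r by simp
  finally show ?thesis by simp
qed

lemma ip_norm_slice_fock:
  "I \<in> im_units \<Longrightarrow> ip_norm (slice_fock_inner I) f = gauss_norm (\<lambda>z. f (slice_pt I z)) / sqrt pi"
  unfolding ip_norm_def slice_fock_inner_eq gauss_inner_self quat_of_real_simps
  by (simp add: real_sqrt_divide)

lemma slice_fock_evaluation_bounded:
  assumes I: "I \<in> im_units" and N: "N \<ge> 1"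
  shows "\<exists>C. \<forall>f\<in>slice_fock N I. norm (f r) \<le> C * ip_norm (slice_fock_inner I) f"
proof (intro exI ballI)
  fix f assume f: "f \<in> slice_fock N I"
  let ?K = "\<lambda>z. fock_kernel N (slice_pt I z) r"
  have L2: "gauss_L2 (\<lambda>z. f (slice_pt I z))" "gauss_L2 ?K"
    using f fock_kernel_in_slice_fock[OF I, of N r] by (auto simp: slice_fock_iff[OF I])
  have "norm (f r) \<le> gauss_norm (\<lambda>z. f (slice_pt I z)) * gauss_norm ?K / pi"
    using norm_gauss_inner_le[OF L2] slice_fock_reproducing[OF I N f, of r] by (simp add: slice_fock_inner_eq[OF I])
  also have "\<dots> = (gauss_norm ?K / sqrt pi) * ip_norm (slice_fock_inner I) f"
    unfolding ip_norm_slice_fock[OF I] by (simp add: field_simps)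
  finally show "norm (f r) \<le> (gauss_norm ?K / sqrt pi) * ip_norm (slice_fock_inner I) f" .
qed

text \<open>
  The pointwise limit exists by bounded evaluation and is a limit in norm by Fatou's lemma. The reproducing
  formula is continuous in the norm, so it holds for the limit, whose restriction is then polyentire by
  \<open>polyentire_gauss_integral\<close>.
\<close>

lemma slice_fock_complete:
  assumes I: "I \<in> im_units" and N: "N \<ge> 1"
    and F: "\<And>n. F n \<in> slice_fock N I"
    and Cauchy: "\<And>e. e > 0 \<Longrightarrow> \<exists>M. \<forall>m\<ge>M. \<forall>n\<ge>M. ip_norm (slice_fock_inner I) (\<lambda>q. F m q - F n q) < e"
  shows "\<exists>f\<in>slice_fock N I. (\<lambda>n. ip_norm (slice_fock_inner I) (\<lambda>q. F n q - f q)) \<longlonglongrightarrow> 0"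
proof -
  have "convergent (\<lambda>n. F n q)" for q
  proof -
    obtain C where C: "\<forall>f\<in>slice_fock N I. norm (f q) \<le> C * ip_norm (slice_fock_inner I) f"
      using slice_fock_evaluation_bounded[OF I N] by blast
    have "Cauchy (\<lambda>n. F n q)"
    proof (rule metric_CauchyI)
      fix e :: real assume "e > 0"
      then have "e / (\<bar>C\<bar> + 1) > 0" by simp
      from Cauchy[OF this] obtain M where
        M: "\<And>m n. m \<ge> M \<Longrightarrow> n \<ge> M \<Longrightarrow> ip_norm (slice_fock_inner I) (\<lambda>q. F m q - F n q) < e / (\<bar>C\<bar> + 1)" by blast
      have "dist (F m q) (F n q) < e" if "m \<ge> M" "n \<ge> M" for m n
      proof -
        let ?d = "ip_norm (slice_fock_inner I) (\<lambda>q. F m q - F n q)"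
        have d: "?d \<ge> 0" by (simp add: ip_norm_slice_fock[OF I])
        have "dist (F m q) (F n q) \<le> C * ?d"
          using C[rule_format, OF slice_fock_diff[OF I F F]] by (simp add: dist_norm)
        also have "\<dots> \<le> (\<bar>C\<bar> + 1) * ?d" using d by (intro mult_right_mono) auto
        also have "\<dots> < (\<bar>C\<bar> + 1) * (e / (\<bar>C\<bar> + 1))" using M[OF that] by (intro mult_strict_left_mono) auto
        also have "\<dots> = e" by simp
        finally show ?thesis .
      qed
      then show "\<exists>M. \<forall>m\<ge>M. \<forall>n\<ge>M. dist (F m q) (F n q) < e" by blast
    qed
    then show ?thesis by (rule Cauchy_convergent)
  qed
  then obtain f where f: "\<And>q. (\<lambda>n. F n q) \<longlonglongrightarrow> f q" unfolding convergent_def by metis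
  define u where "u n z = F n (slice_pt I z)" for n z
  define v where "v z = f (slice_pt I z)" for z
  have uL2: "gauss_L2 (u n)" for n
    using F[of n] unfolding slice_fock_iff[OF I] u_def by blast
  have dL2: "gauss_L2 (\<lambda>z. u n z - u m z)" for m n
    by (intro gauss_L2_diff uL2)
  have near: "\<exists>M. \<forall>n\<ge>M. gauss_L2 (\<lambda>z. u n z - v z) \<and> gauss_norm (\<lambda>z. u n z - v z) \<le> e" if "e > 0" for e
  proof -
    have "e / sqrt pi > 0" using that by simp
    from Cauchy[OF this] obtain M where
      M: "\<And>m n. m \<ge> M \<Longrightarrow> n \<ge> M \<Longrightarrow> ip_norm (slice_fock_inner I) (\<lambda>q. F m q - F n q) < e / sqrt pi" by blast
    have le: "gauss_norm (\<lambda>z. u n z - u m z) \<le> e" if "n \<ge> M" "m \<ge> M" for m n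
      using M[OF that] unfolding ip_norm_slice_fock[OF I] u_def by (simp add: divide_less_cancel)
    have "gauss_L2 (\<lambda>z. u n z - v z) \<and> gauss_norm (\<lambda>z. u n z - v z) \<le> e" if "n \<ge> M" for n
    proof -
      have lim: "(\<lambda>m. u n z - u m z) \<longlonglongrightarrow> u n z - v z" for z
        unfolding u_def v_def by (intro tendsto_intros f)
      show ?thesis
        using gauss_norm_limit[of "\<lambda>m z. u n z - u m z" "\<lambda>z. u n z - v z" M e, OF dL2 lim le[OF that]] by blast
    qed
    then show ?thesis by blast
  qed
  have vL2: "gauss_L2 v"
  proof -
    obtain M where "gauss_L2 (\<lambda>z. u M z - v z)" using near[of 1] by auto
    from gauss_L2_diff[OF uL2[of M] this] show ?thesis by simp
  qed
  have normlim: "(\<lambda>n. gauss_norm (\<lambda>z. u n z - v z)) \<longlonglongrightarrow> 0"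
  proof (rule LIMSEQ_I)
    fix e :: real assume "e > 0"
    then obtain M where "\<forall>n\<ge>M. gauss_norm (\<lambda>z. u n z - v z) \<le> e / 2" using near[of "e / 2"] by auto
    then show "\<exists>M. \<forall>n\<ge>M. norm (gauss_norm (\<lambda>z. u n z - v z) - 0) < e"
      using \<open>e > 0\<close> by (intro exI[of _ M]) (fastforce intro: le_less_trans)
  qed
  have "is_slice f"
    unfolding slice_representation[OF I]
  proof (intro ballI allI)
    fix J c assume J: "J \<in> im_units"
    have "(\<lambda>n. (1 / 2) *\<^sub>R ((1 - J * I) * F n (slice_emb I c) + (1 + J * I) * F n (slice_emb I (cnj c))))
        \<longlonglongrightarrow> (1 / 2) *\<^sub>R ((1 - J * I) * f (slice_emb I c) + (1 + J * I) * f (slice_emb I (cnj c)))"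
      by (intro tendsto_intros f)
    moreover have "(1 / 2) *\<^sub>R ((1 - J * I) * F n (slice_emb I c) + (1 + J * I) * F n (slice_emb I (cnj c))) = F n (slice_emb J c)" for n
      using F[of n] J unfolding slice_fock_iff[OF I] slice_representation[OF I] by simp
    ultimately show "f (slice_emb J c) = (1 / 2) *\<^sub>R ((1 - J * I) * f (slice_emb I c) + (1 + J * I) * f (slice_emb I (cnj c)))"
      using LIMSEQ_unique[OF f] by simp
  qed
  moreover have "polyentire N (\<lambda>w. slice_coord I b (f (slice_emb I w)))" for b
  proof -
    have "f (slice_emb I w) = gauss_inner v (\<lambda>z. fock_kernel N (slice_pt I z) (slice_emb I w))" for w
    proof -
      let ?K = "\<lambda>z. fock_kernel N (slice_pt I z) (slice_emb I w)"
      have K: "gauss_L2 ?K"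
        using fock_kernel_in_slice_fock[OF I] by (simp add: slice_fock_iff[OF I])
      have "(\<lambda>n. gauss_norm (\<lambda>z. u n z - v z) * gauss_norm ?K / pi) \<longlonglongrightarrow> 0 * gauss_norm ?K / pi"
        by (intro tendsto_intros normlim) auto
      then have g: "(\<lambda>n. gauss_norm (\<lambda>z. u n z - v z) * gauss_norm ?K / pi) \<longlonglongrightarrow> 0"
        by simp
      have "(\<lambda>n. gauss_inner (\<lambda>z. u n z - v z) ?K) \<longlonglongrightarrow> 0"
        by (rule Lim_null_comparison[OF always_eventually g])
           (intro allI norm_gauss_inner_le gauss_L2_diff uL2 vL2 K)
      moreover have "gauss_inner (\<lambda>z. u n z - v z) ?K = F n (slice_emb I w) - gauss_inner v ?K" for n
      proof -
        have "gauss_inner (u n) ?K = gauss_inner (\<lambda>z. u n z - v z) ?K + gauss_inner v ?K"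
          using gauss_inner_add[OF gauss_L2_diff[OF uL2 vL2] vL2 K, of n] by simp
        moreover have "gauss_inner (u n) ?K = F n (slice_emb I w)"
          using slice_reproducing[OF I N F, of n w] by (simp add: slice_fock_inner_eq[OF I] u_def[abs_def])
        ultimately show ?thesis by simp
      qed
      ultimately have "(\<lambda>n. F n (slice_emb I w)) \<longlonglongrightarrow> gauss_inner v ?K"
        by (simp add: LIM_zero_iff)
      then show ?thesis using LIMSEQ_unique[OF f] by blast
    qed
    then have "(\<lambda>w. slice_coord I b (f (slice_emb I w))) = (\<lambda>w. of_real (1 / pi) *
        (LINT z|lborel. exp (- (norm z)\<^sup>2) *\<^sub>R (cnj (complex_kernel N (to_complex z) w) * slice_coord I b (v z))))"
      by (simp add: slice_coord_gauss_inner_kernel[OF I vL2] scaleR_conv_of_real)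
    then show ?thesis
      by (simp only: polyentire_cmult[OF polyentire_gauss_integral[OF gauss_L2_slice_coord[OF vL2]]])
  qed
  ultimately have "f \<in> slice_fock N I"
    using vL2 by (simp add: slice_fock_iff[OF I] v_def[abs_def])
  moreover have "(\<lambda>n. ip_norm (slice_fock_inner I) (\<lambda>q. F n q - f q)) \<longlonglongrightarrow> 0"
    using tendsto_divide_zero[OF normlim, of "sqrt pi"] unfolding ip_norm_slice_fock[OF I] u_def v_def .
  ultimately show ?thesis by blast
qed

theorem theorem4p6:
  fixes N :: nat and I :: quat
  assumes "N \<ge> 1" and "I \<in> im_units"
  shows "right_quat_rkhs (slice_fock N I) (slice_fock_inner I) \<and>
         reproducing_kernel (slice_fock N I) (slice_fock_inner I) (fock_kernel N)"
proof
  note I = assms(2) and N = assms(1)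
  interpret right_quat_inner_space "slice_fock N I" "slice_fock_inner I"
    by (rule slice_fock_inner_space[OF I N])
  show "right_quat_rkhs (slice_fock N I) (slice_fock_inner I)"
    by unfold_locales (use slice_fock_complete[OF I N] slice_fock_evaluation_bounded[OF I N] in blast)+
  show "reproducing_kernel (slice_fock N I) (slice_fock_inner I) (fock_kernel N)"
    unfolding reproducing_kernel_def
    using fock_kernel_in_slice_fock[OF I] slice_fock_reproducing[OF I N] by blast
qed

end
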